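(* Let $(N,\mathcal I,\mathcal J,\mathcal K)$ be a hypercomplex nilmanifold. Then the Ricci tensor of the Obata connection of $N$ vanishes.
   Context: A hypercomplex manifold is a manifold $M$ with three integrable complex structures $\mathcal I,\mathcal J,\mathcal K$ satisfying $\mathcal I\mathcal J=-\mathcal J\mathcal I=\mathcal K$. It carries a unique torsion-free connection $\nabla$ on $TM$ with $\nabla\mathcal I=\nabla\mathcal J=\nabla\mathcal K=0$, called the Obata connection. The Ricci tensor of $\nabla$, with curvature $R$, is $\mathrm{Ric}(X,Y)=\operatorname{tr}\bigl(Z\mapsto R(Z,X)Y\bigr)$. A nilmanifold is a quotient $N=\Gamma\backslash G$ of a connected, simply connected nilpotent Lie group $G$ by a co-compact discrete subgroup $\Gamma$. A hypercomplex structure on $G$ is left-invariant if left translations are holomorphic with respect to $\mathcal I,\mathcal J,\mathcal K$. A hypercomplex nilmanifold is a nilmanifold $N=\Gamma\backslash G$ with the hypercomplex structure induced by a left-invariant hypercomplex structure on $G$. *)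

theory Defs
  imports "HOL-Analysis.Analysis" "HOL-Algebra.Coset" "HOL-Algebra.Generated_Groups"
begin

section \<open>Smooth maps between open subsets of Euclidean spaces\<close>

text \<open>Both notions are meant for open \<open>S\<close>.\<close>

primrec Ck_on :: "nat \<Rightarrow> 'e set \<Rightarrow> ('e::euclidean_space \<Rightarrow> 'f::real_normed_vector) \<Rightarrow> bool" where
  "Ck_on 0 S f \<longleftrightarrow> continuous_on S f"
| "Ck_on (Suc k) S f \<longleftrightarrow>
     (\<forall>x\<in>S. f differentiable (at x)) \<and> (\<forall>v. Ck_on k S (\<lambda>x. frechet_derivative f (at x) v))"

definition smooth_on :: "'e set \<Rightarrow> ('e::euclidean_space \<Rightarrow> 'f::real_normed_vector) \<Rightarrow> bool" where
  "smooth_on S f \<longleftrightarrow> (\<forall>k. Ck_on k S f)"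


section \<open>Smooth manifolds\<close>

text \<open>A chart is a domain together with a coordinate map; the values of the coordinate map outside
  the domain are irrelevant.  The topology is part of the data, and the smooth structure is given by
  an atlas that need not be maximal.\<close>

type_synonym ('a, 'e) chart = "'a set \<times> ('a \<Rightarrow> 'e)"

record ('a, 'e) manifold =
  mtop :: "'a topology"
  atlas :: "('a, 'e) chart set"

abbreviation cdom :: "('a, 'e) chart \<Rightarrow> 'a set" where "cdom c \<equiv> fst c"

abbreviation crd :: "('a, 'e) chart \<Rightarrow> 'a \<Rightarrow> 'e" where "crd c \<equiv> snd c"

definition crd_inv :: "('a, 'e) chart \<Rightarrow> 'e \<Rightarrow> 'a" where
  "crd_inv c = inv_into (cdom c) (crd c)"

abbreviation points :: "('a, 'e) manifold \<Rightarrow> 'a set" where "points M \<equiv> topspace (mtop M)"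

definition chart_on :: "'a topology \<Rightarrow> ('a, 'e::euclidean_space) chart \<Rightarrow> bool" where
  "chart_on T c \<longleftrightarrow> openin T (cdom c) \<and> open (crd c ` cdom c) \<and>
     homeomorphic_map (subtopology T (cdom c)) (top_of_set (crd c ` cdom c)) (crd c)"

definition transition :: "('a, 'e) chart \<Rightarrow> ('a, 'e) chart \<Rightarrow> 'e \<Rightarrow> 'e" where
  "transition c d = crd d \<circ> crd_inv c"

definition smooth_manifold :: "('a, 'e::euclidean_space) manifold \<Rightarrow> bool" where
  "smooth_manifold M \<longleftrightarrow>
     Hausdorff_space (mtop M) \<and> second_countable (mtop M) \<and>
     (\<forall>c\<in>atlas M. chart_on (mtop M) c) \<and> points M = (\<Union>c\<in>atlas M. cdom c) \<and>
     (\<forall>c\<in>atlas M. \<forall>d\<in>atlas M. smooth_on (crd c ` (cdom c \<inter> cdom d)) (transition c d))"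

definition smooth_map ::
  "('a, 'e::euclidean_space) manifold \<Rightarrow> ('b, 'f::euclidean_space) manifold \<Rightarrow> ('a \<Rightarrow> 'b) \<Rightarrow> bool" where
  "smooth_map M N F \<longleftrightarrow> continuous_map (mtop M) (mtop N) F \<and>
     (\<forall>c\<in>atlas M. \<forall>d\<in>atlas N.
        smooth_on (crd c ` {p \<in> cdom c. F p \<in> cdom d}) (crd d \<circ> F \<circ> crd_inv c))"

definition smooth_fun :: "('a, 'e::euclidean_space) manifold \<Rightarrow> ('a \<Rightarrow> real) \<Rightarrow> bool" where
  "smooth_fun M f \<longleftrightarrow> (\<forall>c\<in>atlas M. smooth_on (crd c ` cdom c) (f \<circ> crd_inv c))"

definition prod_manifold :: "('a, 'e) manifold \<Rightarrow> ('b, 'f) manifold \<Rightarrow> ('a \<times> 'b, 'e \<times> 'f) manifold" where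
  "prod_manifold M N =
     \<lparr>mtop = prod_topology (mtop M) (mtop N),
      atlas = {(cdom c \<times> cdom d, map_prod (crd c) (crd d)) |c d. c \<in> atlas M \<and> d \<in> atlas N}\<rparr>"

definition chart_at :: "('a, 'e) manifold \<Rightarrow> 'a \<Rightarrow> ('a, 'e) chart" where
  "chart_at M p = (SOME c. c \<in> atlas M \<and> p \<in> cdom c)"


section \<open>Tangent vectors and tensor fields\<close>

text \<open>A tangent vector at \<open>p\<close> is the family of its components in the charts around \<open>p\<close>, related by the
  derivatives of the transition maps.  It is set to \<open>0\<close> at all other charts, so that equality of
  tangent vectors is equality of functions.\<close>

type_synonym ('a, 'e) tvec = "('a, 'e) chart \<Rightarrow> 'e"

definition tangent_space :: "('a, 'e::euclidean_space) manifold \<Rightarrow> 'a \<Rightarrow> ('a, 'e) tvec set" where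
  "tangent_space M p =
     {v. (\<forall>c\<in>atlas M. \<forall>d\<in>atlas M. p \<in> cdom c \<longrightarrow> p \<in> cdom d \<longrightarrow>
            v d = frechet_derivative (transition c d) (at (crd c p)) (v c)) \<and>
         (\<forall>c. \<not> (c \<in> atlas M \<and> p \<in> cdom c) \<longrightarrow> v c = 0)}"

text \<open>The tangent vector at \<open>p\<close> with components \<open>u\<close> in the chart \<open>c\<close>.\<close>

definition tvec_of :: "('a, 'e::euclidean_space) manifold \<Rightarrow> 'a \<Rightarrow> ('a, 'e) chart \<Rightarrow> 'e \<Rightarrow> ('a, 'e) tvec" where
  "tvec_of M p c u = (\<lambda>d. if d \<in> atlas M \<and> p \<in> cdom d
                          then frechet_derivative (transition c d) (at (crd c p)) u else 0)"

definition tangent_map ::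
  "('a, 'e::euclidean_space) manifold \<Rightarrow> ('b, 'f::euclidean_space) manifold \<Rightarrow> ('a \<Rightarrow> 'b) \<Rightarrow>
   'a \<Rightarrow> ('a, 'e) tvec \<Rightarrow> ('b, 'f) tvec" where
  "tangent_map M N F p v =
     (\<lambda>d. if d \<in> atlas N \<and> F p \<in> cdom d
          then (let c = chart_at M p
                in frechet_derivative (crd d \<circ> F \<circ> crd_inv c) (at (crd c p)) (v c))
          else 0)"

type_synonym ('a, 'e) vfield = "'a \<Rightarrow> ('a, 'e) tvec"

type_synonym ('a, 'e) endo = "'a \<Rightarrow> ('a, 'e) tvec \<Rightarrow> ('a, 'e) tvec"

text \<open>Since the tangent space at a point outside of the manifold is \<open>{0}\<close>, a vector field vanishes
  there.\<close>

definition vfields :: "('a, 'e::euclidean_space) manifold \<Rightarrow> ('a, 'e) vfield set" where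
  "vfields M = {X. (\<forall>p. X p \<in> tangent_space M p) \<and>
                   (\<forall>c\<in>atlas M. smooth_on (crd c ` cdom c) (\<lambda>x. X (crd_inv c x) c))}"

definition vf_add :: "('a, 'e::euclidean_space) vfield \<Rightarrow> ('a, 'e) vfield \<Rightarrow> ('a, 'e) vfield" where
  "vf_add X Y = (\<lambda>p c. X p c + Y p c)"

definition vf_diff :: "('a, 'e::euclidean_space) vfield \<Rightarrow> ('a, 'e) vfield \<Rightarrow> ('a, 'e) vfield" where
  "vf_diff X Y = (\<lambda>p c. X p c - Y p c)"

definition vf_scale :: "('a \<Rightarrow> real) \<Rightarrow> ('a, 'e::euclidean_space) vfield \<Rightarrow> ('a, 'e) vfield" where
  "vf_scale f X = (\<lambda>p c. f p *\<^sub>R X p c)"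

text \<open>The derivative \<open>X f\<close> of a function along a vector field.\<close>

definition vf_deriv :: "('a, 'e::euclidean_space) manifold \<Rightarrow> ('a, 'e) vfield \<Rightarrow> ('a \<Rightarrow> real) \<Rightarrow> 'a \<Rightarrow> real" where
  "vf_deriv M X f p = (let c = chart_at M p
                       in frechet_derivative (f \<circ> crd_inv c) (at (crd c p)) (X p c))"

text \<open>In a chart, the Lie bracket is \<open>[X, Y] = DY(X) - DX(Y)\<close>.\<close>

definition lie_bracket ::
  "('a, 'e::euclidean_space) manifold \<Rightarrow> ('a, 'e) vfield \<Rightarrow> ('a, 'e) vfield \<Rightarrow> ('a, 'e) vfield" where
  "lie_bracket M X Y = (\<lambda>p c. if c \<in> atlas M \<and> p \<in> cdom c
     then frechet_derivative (\<lambda>x. Y (crd_inv c x) c) (at (crd c p)) (X p c)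
        - frechet_derivative (\<lambda>x. X (crd_inv c x) c) (at (crd c p)) (Y p c)
     else 0)"

definition endo_field :: "('a, 'e::euclidean_space) manifold \<Rightarrow> ('a, 'e) endo \<Rightarrow> bool" where
  "endo_field M E \<longleftrightarrow>
     (\<forall>p\<in>points M. \<forall>v\<in>tangent_space M p. E p v \<in> tangent_space M p) \<and>
     (\<forall>p\<in>points M. \<forall>v\<in>tangent_space M p. \<forall>w\<in>tangent_space M p. \<forall>a b.
        E p (\<lambda>c. a *\<^sub>R v c + b *\<^sub>R w c) = (\<lambda>c. a *\<^sub>R E p v c + b *\<^sub>R E p w c)) \<and>
     (\<forall>c\<in>atlas M. \<forall>u. smooth_on (crd c ` cdom c)
        (\<lambda>x. E (crd_inv c x) (tvec_of M (crd_inv c x) c u) c))"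

definition endo_app :: "('a, 'e::euclidean_space) manifold \<Rightarrow> ('a, 'e) endo \<Rightarrow> ('a, 'e) vfield \<Rightarrow> ('a, 'e) vfield" where
  "endo_app M E X = (\<lambda>p. if p \<in> points M then E p (X p) else (\<lambda>_. 0))"


section \<open>Hypercomplex structures\<close>

definition almost_complex :: "('a, 'e::euclidean_space) manifold \<Rightarrow> ('a, 'e) endo \<Rightarrow> bool" where
  "almost_complex M I \<longleftrightarrow> endo_field M I \<and>
     (\<forall>p\<in>points M. \<forall>v\<in>tangent_space M p. I p (I p v) = (\<lambda>c. - v c))"

text \<open>Integrability is expressed by the vanishing of the Nijenhuis tensor
  \<open>[IX, IY] - I[IX, Y] - I[X, IY] - [X, Y]\<close>.\<close>

definition integrable_acs :: "('a, 'e::euclidean_space) manifold \<Rightarrow> ('a, 'e) endo \<Rightarrow> bool" where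
  "integrable_acs M I \<longleftrightarrow> almost_complex M I \<and>
     (\<forall>X\<in>vfields M. \<forall>Y\<in>vfields M.
        lie_bracket M (endo_app M I X) (endo_app M I Y) =
        vf_add (endo_app M I (lie_bracket M (endo_app M I X) Y))
          (vf_add (endo_app M I (lie_bracket M X (endo_app M I Y))) (lie_bracket M X Y)))"

definition hypercomplex ::
  "('a, 'e::euclidean_space) manifold \<Rightarrow> ('a, 'e) endo \<Rightarrow> ('a, 'e) endo \<Rightarrow> ('a, 'e) endo \<Rightarrow> bool" where
  "hypercomplex M I J K \<longleftrightarrow> integrable_acs M I \<and> integrable_acs M J \<and> integrable_acs M K \<and>
     (\<forall>p\<in>points M. \<forall>v\<in>tangent_space M p.
        I p (J p v) = K p v \<and> (\<lambda>c. - J p (I p v) c) = K p v)"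

definition holomorphic_map ::
  "('a, 'e::euclidean_space) manifold \<Rightarrow> ('a, 'e) endo \<Rightarrow> ('b, 'f::euclidean_space) manifold \<Rightarrow> ('b, 'f) endo \<Rightarrow>
   ('a \<Rightarrow> 'b) \<Rightarrow> bool" where
  "holomorphic_map M I N I' F \<longleftrightarrow> smooth_map M N F \<and>
     (\<forall>p\<in>points M. \<forall>v\<in>tangent_space M p.
        tangent_map M N F p (I p v) = I' (F p) (tangent_map M N F p v))"


section \<open>Connections\<close>

type_synonym ('a, 'e) conn = "('a, 'e) vfield \<Rightarrow> ('a, 'e) vfield \<Rightarrow> ('a, 'e) vfield"

definition affine_connection :: "('a, 'e::euclidean_space) manifold \<Rightarrow> ('a, 'e) conn \<Rightarrow> bool" where
  "affine_connection M D \<longleftrightarrow>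
     (\<forall>X\<in>vfields M. \<forall>Y\<in>vfields M. D X Y \<in> vfields M) \<and>
     (\<forall>X\<in>vfields M. \<forall>X'\<in>vfields M. \<forall>Y\<in>vfields M.
        D (vf_add X X') Y = vf_add (D X Y) (D X' Y) \<and>
        D Y (vf_add X X') = vf_add (D Y X) (D Y X')) \<and>
     (\<forall>f X Y. smooth_fun M f \<longrightarrow> X \<in> vfields M \<longrightarrow> Y \<in> vfields M \<longrightarrow>
        D (vf_scale f X) Y = vf_scale f (D X Y) \<and>
        D X (vf_scale f Y) = vf_add (vf_scale (vf_deriv M X f) Y) (vf_scale f (D X Y)))"

definition torsion_free :: "('a, 'e::euclidean_space) manifold \<Rightarrow> ('a, 'e) conn \<Rightarrow> bool" where
  "torsion_free M D \<longleftrightarrow>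
     (\<forall>X\<in>vfields M. \<forall>Y\<in>vfields M. vf_diff (D X Y) (D Y X) = lie_bracket M X Y)"

definition parallel :: "('a, 'e::euclidean_space) manifold \<Rightarrow> ('a, 'e) conn \<Rightarrow> ('a, 'e) endo \<Rightarrow> bool" where
  "parallel M D E \<longleftrightarrow>
     (\<forall>X\<in>vfields M. \<forall>Y\<in>vfields M. D X (endo_app M E Y) = endo_app M E (D X Y))"

definition obata_connection ::
  "('a, 'e::euclidean_space) manifold \<Rightarrow> ('a, 'e) endo \<Rightarrow> ('a, 'e) endo \<Rightarrow> ('a, 'e) endo \<Rightarrow> ('a, 'e) conn \<Rightarrow> bool" where
  "obata_connection M I J K D \<longleftrightarrow> affine_connection M D \<and> torsion_free M D \<and>
     parallel M D I \<and> parallel M D J \<and> parallel M D K"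

definition curvature ::
  "('a, 'e::euclidean_space) manifold \<Rightarrow> ('a, 'e) conn \<Rightarrow>
   ('a, 'e) vfield \<Rightarrow> ('a, 'e) vfield \<Rightarrow> ('a, 'e) vfield \<Rightarrow> ('a, 'e) vfield" where
  "curvature M D X Y Z =
     vf_diff (vf_diff (D X (D Y Z)) (D Y (D X Z))) (D (lie_bracket M X Y) Z)"

text \<open>The value at \<open>p\<close> of \<open>Ric(X, Y)\<close> is the trace of the endomorphism \<open>z \<mapsto> R(z, X)Y\<close> of the tangent
  space at \<open>p\<close>, computed with respect to the basis of the tangent space given by a chart.  The
  curvature is a tensor, so \<open>R(z, X)Y\<close> is the value at \<open>p\<close> of \<open>R(Z, X)Y\<close> for any vector field \<open>Z\<close> that
  extends \<open>z\<close>.\<close>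

definition extend :: "('a, 'e::euclidean_space) manifold \<Rightarrow> 'a \<Rightarrow> ('a, 'e) tvec \<Rightarrow> ('a, 'e) vfield" where
  "extend M p z = (SOME Z. Z \<in> vfields M \<and> Z p = z)"

definition ricci ::
  "('a, 'e::euclidean_space) manifold \<Rightarrow> ('a, 'e) conn \<Rightarrow> ('a, 'e) vfield \<Rightarrow> ('a, 'e) vfield \<Rightarrow> 'a \<Rightarrow> real" where
  "ricci M D X Y p =
     (let c = chart_at M p
      in \<Sum>b\<in>Basis. curvature M D (extend M p (tvec_of M p c b)) X Y p c \<bullet> b)"


section \<open>Nilpotent Lie groups and nilmanifolds\<close>

text \<open>\<open>lower_central G k\<close> is generated by the commutators of \<open>lower_central G (k - 1)\<close> with \<open>G\<close>.\<close>

primrec lower_central :: "('a, 'b) monoid_scheme \<Rightarrow> nat \<Rightarrow> 'a set" where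
  "lower_central G 0 = carrier G"
| "lower_central G (Suc k) = generate G
     {x \<otimes>\<^bsub>G\<^esub> y \<otimes>\<^bsub>G\<^esub> inv\<^bsub>G\<^esub> x \<otimes>\<^bsub>G\<^esub> inv\<^bsub>G\<^esub> y |x y. x \<in> lower_central G k \<and> y \<in> carrier G}"

definition nilpotent_group :: "('a, 'b) monoid_scheme \<Rightarrow> bool" where
  "nilpotent_group G \<longleftrightarrow> group G \<and> (\<exists>k. lower_central G k = {\<one>\<^bsub>G\<^esub>})"

definition lie_group :: "('a, 'b) monoid_scheme \<Rightarrow> ('a, 'e::euclidean_space) manifold \<Rightarrow> bool" where
  "lie_group G M \<longleftrightarrow> group G \<and> smooth_manifold M \<and> points M = carrier G \<and>
     smooth_map (prod_manifold M M) M (\<lambda>(x, y). x \<otimes>\<^bsub>G\<^esub> y) \<and>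
     smooth_map M M (\<lambda>x. inv\<^bsub>G\<^esub> x)"

definition simply_connected_space :: "'a topology \<Rightarrow> bool" where
  "simply_connected_space T \<longleftrightarrow> path_connected_space T \<and>
     (\<forall>g. pathin T g \<and> g 0 = g 1 \<longrightarrow>
        homotopic_with (\<lambda>h. h 0 = g 0 \<and> h 1 = g 0) (top_of_set {0..1}) T g (\<lambda>_. g 0))"

definition left_invariant ::
  "('a, 'b) monoid_scheme \<Rightarrow> ('a, 'e::euclidean_space) manifold \<Rightarrow> ('a, 'e) endo \<Rightarrow> bool" where
  "left_invariant G M I \<longleftrightarrow> (\<forall>g\<in>carrier G. holomorphic_map M I M I (\<lambda>x. g \<otimes>\<^bsub>G\<^esub> x))"

definition discrete_subgroup :: "'a set \<Rightarrow> ('a, 'b) monoid_scheme \<Rightarrow> 'a topology \<Rightarrow> bool" where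
  "discrete_subgroup \<Gamma> G T \<longleftrightarrow> subgroup \<Gamma> G \<and> subtopology T \<Gamma> = discrete_topology \<Gamma>"

text \<open>The points of \<open>\<Gamma> \<backslash> G\<close> are the cosets \<open>\<Gamma>g\<close>, which the library calls right cosets.\<close>

abbreviation coset_proj :: "('a, 'b) monoid_scheme \<Rightarrow> 'a set \<Rightarrow> 'a \<Rightarrow> 'a set" where
  "coset_proj G \<Gamma> \<equiv> (\<lambda>g. \<Gamma> #>\<^bsub>G\<^esub> g)"

definition quotient_top :: "'a topology \<Rightarrow> ('a \<Rightarrow> 'b) \<Rightarrow> 'b topology" where
  "quotient_top T f = topology (\<lambda>V. V \<subseteq> f ` topspace T \<and> openin T {x \<in> topspace T. f x \<in> V})"

text \<open>The smooth structure on the quotient is the one for which the projection is a local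
  diffeomorphism: its charts are the charts of \<open>G\<close>, restricted to open sets \<open>W\<close> on which the projection
  is injective and then composed with the inverse of the projection.\<close>

definition quotient_manifold ::
  "('a, 'b) monoid_scheme \<Rightarrow> ('a, 'e) manifold \<Rightarrow> 'a set \<Rightarrow> ('a set, 'e) manifold" where
  "quotient_manifold G M \<Gamma> =
     \<lparr>mtop = quotient_top (mtop M) (coset_proj G \<Gamma>),
      atlas = {(coset_proj G \<Gamma> ` W, crd c \<circ> inv_into W (coset_proj G \<Gamma>)) |c W.
                 c \<in> atlas M \<and> openin (mtop M) W \<and> W \<subseteq> cdom c \<and> inj_on (coset_proj G \<Gamma>) W}\<rparr>"

lemma openin_quotient_top:
  "openin (quotient_top T f) V \<longleftrightarrow> V \<subseteq> f ` topspace T \<and> openin T {x \<in> topspace T. f x \<in> V}"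
proof -
  have "istopology (\<lambda>V. V \<subseteq> f ` topspace T \<and> openin T {x \<in> topspace T. f x \<in> V})"
    unfolding istopology_def
  proof (intro conjI allI impI, goal_cases inter1 inter2 union1 union2)
    case (inter2 A B)
    have "{x \<in> topspace T. f x \<in> A \<inter> B} = {x \<in> topspace T. f x \<in> A} \<inter> {x \<in> topspace T. f x \<in> B}"
      by auto
    then show ?case using inter2 by auto
  next
    case (inter1 A B)
    then show ?case by blast
  next
    case (union1 \<K>)
    then show ?case by blast
  next
    case (union2 \<K>)
    have "{x \<in> topspace T. f x \<in> \<Union>\<K>} = (\<Union>V\<in>\<K>. {x \<in> topspace T. f x \<in> V})"
      by auto
    then show ?case using union2 by auto
  qed
  then show ?thesis by (simp add: quotient_top_def)
qed

lemma topspace_quotient_top: "topspace (quotient_top T f) = f ` topspace T"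
proof (rule antisym)
  show "topspace (quotient_top T f) \<subseteq> f ` topspace T"
    using openin_topspace[of "quotient_top T f"] unfolding openin_quotient_top by (rule conjunct1)
  have "{x \<in> topspace T. f x \<in> f ` topspace T} = topspace T"
    by auto
  then have "openin (quotient_top T f) (f ` topspace T)"
    unfolding openin_quotient_top by simp
  then show "f ` topspace T \<subseteq> topspace (quotient_top T f)"
    by (rule openin_subset)
qed

lemma quotient_map_quotient_top: "quotient_map T (quotient_top T f) f"
  by (simp add: quotient_map_def topspace_quotient_top openin_quotient_top)

end

theory Submission
  imports Defs
begin

text \<open>Left-invariant vector fields descend to a global frame \<open>E v\<close> (\<open>v\<close> in the Lie algebra) of the
  nilmanifold, on which the bracket and the complex structures have constant coefficients.  The identity
  \<open>2 D\<^sub>X Y = [X, Y] + I [I X, Y] - J [X, J Y] + I J [I X, J Y]\<close> shows that the Obata connection is constant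
  in this frame as well, so that the Ricci tensor is computed in the Lie algebra.  There the map
  \<open>v \<mapsto> ([u, v] - [I u, I v]) / 2\<close>, the bracket of the complex subalgebra of vectors of type (1,0), is nilpotent,
  and its trace being \<open>0\<close> gives \<open>tr D\<^sub>u = 0\<close>.  Hence the curvature is trace-free and the Ricci form is
  symmetric by the Bianchi identity; but \<open>Ric (I x, I y) = - Ric (y, x)\<close>, and likewise for \<open>J\<close> and \<open>K\<close>, makes it skew.

  The Lie algebra of a nilpotent group is nilpotent because the maps \<open>x \<mapsto> [\<dots>[[x, g\<^sub>1], g\<^sub>2]\<dots>, g\<^sub>n]\<close> are
  constant: their derivatives at \<open>\<one>\<close> are the products of the derivatives of the maps \<open>x \<mapsto> [x, g\<^sub>i]\<close>, whose
  derivatives in \<open>g\<^sub>i\<close> are in turn the maps \<open>v \<mapsto> [v, w]\<close>.\<close>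


section \<open>Calculus of smooth maps\<close>

text \<open>Two obstacles shape the proof. The terms of the lower central series are abstract
  subgroups without a smooth structure, so they have no tangent spaces of their own:
  \<open>flag\<close> is built from derivatives of maps into them, and the bracket is reached by
  differentiating a family of such derivatives in its parameter. About this family only a linear
  system with differentiable coefficients is known. Moreover, \<open>ricci\<close> evaluates the
  curvature on arbitrary extensions of tangent vectors, which is usually justified with cutoff
  functions. Here the global frame takes over their role: it extends every tangent vector, and every
  field is a combination of frame fields whose coefficients are smooth, again because they solve a
  linear system. For this reason the calculus section treats solutions of linear systems that depend
  on a parameter.\<close>

lemma Ck_on_subset: "Ck_on k S f \<Longrightarrow> T \<subseteq> S \<Longrightarrow> Ck_on k T f"
  by (induction k arbitrary: f) (auto intro: continuous_on_subset)

lemma Ck_on_Suc_imp_Ck_on: "Ck_on (Suc k) S f \<Longrightarrow> Ck_on k S f"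
proof (induction k arbitrary: f)
  case 0
  then show ?case
    by (auto intro!: continuous_at_imp_continuous_on differentiable_imp_continuous_within)
next
  case (Suc k)
  then show ?case by (metis Ck_on.simps(2))
qed

text \<open>Openness makes the derivatives agree as well. Coordinate expressions involve
  \<open>crd_inv\<close>, whose values off the chart are arbitrary, so equalities between them hold
  only on \<open>S\<close>.\<close>

lemma Ck_on_cong:
  assumes "open S" "\<And>x. x \<in> S \<Longrightarrow> f x = g x" "Ck_on k S f"
  shows "Ck_on k S g"
  using assms(2,3)
proof (induction k arbitrary: f g)
  case 0
  then show ?case using continuous_on_cong[of S S f g] by simp
next
  case (Suc k)
  have d: "frechet_derivative f (at x) = frechet_derivative g (at x)" if "x \<in> S" for x
    using Suc.prems that assms(1) by (intro frechet_derivative_transform_within_open) auto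
  have "g differentiable (at x)" if "x \<in> S" for x
    using Suc.prems that assms(1) has_derivative_transform_within_open[of f _ x _ S g]
    unfolding Ck_on.simps differentiable_def by blast
  moreover have "Ck_on k S (\<lambda>x. frechet_derivative g (at x) v)" for v
    using Suc.IH[of "\<lambda>x. frechet_derivative f (at x) v"] Suc.prems d by auto
  ultimately show ?case by simp
qed

lemma Ck_on_const: "Ck_on k S (\<lambda>x. c)"
  by (induction k arbitrary: c) auto

lemma Ck_on_add:
  assumes "open S" "Ck_on k S f" "Ck_on k S g"
  shows "Ck_on k S (\<lambda>x. f x + g x)"
  using assms(2,3)
proof (induction k arbitrary: f g)
  case 0
  then show ?case by (simp add: continuous_on_add)
next
  case (Suc k)
  have "((\<lambda>x. f x + g x) has_derivative
      (\<lambda>v. frechet_derivative f (at x) v + frechet_derivative g (at x) v)) (at x)" if "x \<in> S" for x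
    using Suc.prems that by (intro has_derivative_add) (auto simp: frechet_derivative_works)
  note d = this frechet_derivative_at[OF this]
  have "Ck_on k S (\<lambda>x. frechet_derivative f (at x) v + frechet_derivative g (at x) v)" for v
    using Suc by auto
  then have "Ck_on k S (\<lambda>x. frechet_derivative (\<lambda>x. f x + g x) (at x) v)" for v
    by (rule Ck_on_cong[OF assms(1), rotated]) (erule fun_cong[OF d(2)])
  then show ?case using d(1) unfolding Ck_on.simps differentiable_def by blast
qed

lemma Ck_on_scaleR:
  assumes "open S" "Ck_on k S f" "Ck_on k S g"
  shows "Ck_on k S (\<lambda>x. f x *\<^sub>R g x)"
  using assms(2,3)
proof (induction k arbitrary: f g)
  case 0
  then show ?case by (simp add: continuous_on_scaleR)
next
  case (Suc k)
  have "((\<lambda>x. f x *\<^sub>R g x) has_derivative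
      (\<lambda>v. f x *\<^sub>R frechet_derivative g (at x) v + frechet_derivative f (at x) v *\<^sub>R g x)) (at x)"
    if "x \<in> S" for x
    using Suc.prems that by (intro has_derivative_scaleR) (auto simp: frechet_derivative_works)
  note d = this frechet_derivative_at[OF this]
  have "Ck_on k S (\<lambda>x. f x *\<^sub>R frechet_derivative g (at x) v + frechet_derivative f (at x) v *\<^sub>R g x)" for v
    using Suc.prems Suc.prems[THEN Ck_on_Suc_imp_Ck_on] Suc.IH by (intro Ck_on_add[OF assms(1)]) auto
  then have "Ck_on k S (\<lambda>x. frechet_derivative (\<lambda>x. f x *\<^sub>R g x) (at x) v)" for v
    by (rule Ck_on_cong[OF assms(1), rotated]) (erule fun_cong[OF d(2)])
  then show ?case using d(1) unfolding Ck_on.simps differentiable_def by blast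
qed

lemma Ck_on_sum:
  assumes "open S" "\<And>i. i \<in> A \<Longrightarrow> Ck_on k S (f i)"
  shows "Ck_on k S (\<lambda>x. \<Sum>i\<in>A. f i x)"
  using assms(2)
  by (induction A rule: infinite_finite_induct) (auto intro!: Ck_on_const Ck_on_add assms(1))

lemma Ck_on_bounded_linear:
  assumes "open S" "bounded_linear h" "Ck_on k S f"
  shows "Ck_on k S (\<lambda>x. h (f x))"
  using assms(3)
proof (induction k arbitrary: f)
  case 0
  then show ?case by (simp add: assms(2) bounded_linear.continuous_on)
next
  case (Suc k)
  have "((\<lambda>x. h (f x)) has_derivative (\<lambda>v. h (frechet_derivative f (at x) v))) (at x)" if "x \<in> S" for x
    using Suc.prems that by (intro bounded_linear.has_derivative[OF assms(2)]) (auto simp: frechet_derivative_works)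
  note d = this frechet_derivative_at[OF this]
  have "Ck_on k S (\<lambda>x. h (frechet_derivative f (at x) v))" for v
    using Suc by auto
  then have "Ck_on k S (\<lambda>x. frechet_derivative (\<lambda>x. h (f x)) (at x) v)" for v
    by (rule Ck_on_cong[OF assms(1), rotated]) (erule fun_cong[OF d(2)])
  then show ?case using d(1) unfolding Ck_on.simps differentiable_def by blast
qed

text \<open>This stands in for the chain rule when a function of a pair is restricted to a slice.
  Under an affine substitution the derivative in the direction \<open>v\<close> becomes the
  derivative in the fixed direction \<open>L v\<close>, so the induction closes without
  products.\<close>

lemma Ck_on_affine:
  assumes "open S" "bounded_linear L" "open T" "\<And>x. x \<in> T \<Longrightarrow> a + L x \<in> S" "Ck_on k S f"
  shows "Ck_on k T (\<lambda>x. f (a + L x))"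
  using assms(5)
proof (induction k arbitrary: f)
  case 0
  then show ?case
    using assms(4) continuous_on_compose2[of S f T "\<lambda>x. a + L x"]
      continuous_on_add[OF continuous_on_const linear_continuous_on[OF assms(2)]] by auto
next
  case (Suc k)
  have "((\<lambda>x. f (a + L x)) has_derivative (\<lambda>v. frechet_derivative f (at (a + L x)) (L v))) (at x)"
    if "x \<in> T" for x
  proof -
    have 1: "((\<lambda>x. a + L x) has_derivative L) (at x)"
      using has_derivative_add[OF has_derivative_const[of a] bounded_linear_imp_has_derivative[OF assms(2)]] by simp
    have 2: "(f has_derivative frechet_derivative f (at (a + L x))) (at (a + L x))"
      using Suc.prems assms(4) that by (auto simp: frechet_derivative_works)
    show ?thesis using diff_chain_at[OF 1 2] by (simp add: o_def)
  qed
  note d = this frechet_derivative_at[OF this]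
  have "Ck_on k T (\<lambda>x. frechet_derivative f (at (a + L x)) (L v))" for v
    using Suc.IH[of "\<lambda>x. frechet_derivative f (at x) (L v)"] Suc.prems by simp
  then have "Ck_on k T (\<lambda>x. frechet_derivative (\<lambda>x. f (a + L x)) (at x) v)" for v
    by (rule Ck_on_cong[OF assms(3), rotated]) (erule fun_cong[OF d(2)])
  then show ?case using d(1) unfolding Ck_on.simps differentiable_def by blast
qed

lemma smooth_on_subset: "smooth_on S f \<Longrightarrow> T \<subseteq> S \<Longrightarrow> smooth_on T f"
  unfolding smooth_on_def using Ck_on_subset by blast

lemma smooth_on_cong: "open S \<Longrightarrow> (\<And>x. x \<in> S \<Longrightarrow> f x = g x) \<Longrightarrow> smooth_on S f \<Longrightarrow> smooth_on S g"
  unfolding smooth_on_def using Ck_on_cong by blast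

lemma smooth_on_differentiable: "smooth_on S f \<Longrightarrow> x \<in> S \<Longrightarrow> f differentiable (at x)"
  unfolding smooth_on_def by (meson Ck_on.simps(2))

lemma smooth_on_has_derivative:
  "smooth_on S f \<Longrightarrow> x \<in> S \<Longrightarrow> (f has_derivative frechet_derivative f (at x)) (at x)"
  using smooth_on_differentiable frechet_derivative_works by blast

lemma smooth_on_frechet_derivative: "smooth_on S f \<Longrightarrow> smooth_on S (\<lambda>x. frechet_derivative f (at x) v)"
  unfolding smooth_on_def using Ck_on.simps(2) by blast

lemma smooth_on_const: "smooth_on S (\<lambda>x. c)"
  unfolding smooth_on_def by (simp add: Ck_on_const)

lemma smooth_on_add: "open S \<Longrightarrow> smooth_on S f \<Longrightarrow> smooth_on S g \<Longrightarrow> smooth_on S (\<lambda>x. f x + g x)"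
  unfolding smooth_on_def by (simp add: Ck_on_add)

lemma smooth_on_scaleR: "open S \<Longrightarrow> smooth_on S f \<Longrightarrow> smooth_on S g \<Longrightarrow> smooth_on S (\<lambda>x. f x *\<^sub>R g x)"
  unfolding smooth_on_def by (simp add: Ck_on_scaleR)

lemma smooth_on_sum:
  "open S \<Longrightarrow> (\<And>i. i \<in> A \<Longrightarrow> smooth_on S (f i)) \<Longrightarrow> smooth_on S (\<lambda>x. \<Sum>i\<in>A. f i x)"
  unfolding smooth_on_def by (simp add: Ck_on_sum)

lemma smooth_on_bounded_linear:
  "open S \<Longrightarrow> bounded_linear h \<Longrightarrow> smooth_on S f \<Longrightarrow> smooth_on S (\<lambda>x. h (f x))"
  unfolding smooth_on_def by (simp add: Ck_on_bounded_linear)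

lemma smooth_on_affine:
  "\<lbrakk>smooth_on S f; open S; bounded_linear L; open T; \<And>x. x \<in> T \<Longrightarrow> a + L x \<in> S\<rbrakk>
   \<Longrightarrow> smooth_on T (\<lambda>x. f (a + L x))"
  unfolding smooth_on_def using Ck_on_affine[of S L T a] by blast

section \<open>Derivatives along vector fields and the symmetry of second derivatives\<close>

lemma linear_expand_Basis:
  fixes L :: "'e::euclidean_space \<Rightarrow> 'f::real_vector"
  assumes "linear L"
  shows "L u = (\<Sum>b\<in>Basis. (u \<bullet> b) *\<^sub>R L b)"
proof -
  have "L u = L (\<Sum>b\<in>Basis. (u \<bullet> b) *\<^sub>R b)" by (simp add: euclidean_representation)
  also have "\<dots> = (\<Sum>b\<in>Basis. (u \<bullet> b) *\<^sub>R L b)"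
    by (simp add: linear_sum[OF assms] linear_cmul[OF assms])
  finally show ?thesis .
qed

lemma frechet_derivative_expand:
  assumes "f differentiable (at x)"
  shows "frechet_derivative f (at x) u = (\<Sum>b\<in>Basis. (u \<bullet> b) *\<^sub>R frechet_derivative f (at x) b)"
  by (rule linear_expand_Basis[OF linear_frechet_derivative[OF assms]])

text \<open>\<open>smooth_on\<close> speaks of derivatives in fixed directions only. Expanding
  \<open>Y x\<close> in the standard basis turns the varying direction into smooth coefficients of
  fixed ones.\<close>

lemma smooth_on_derivative_along:
  assumes "open S" "smooth_on S h" "smooth_on S Y"
  shows "smooth_on S (\<lambda>x. frechet_derivative h (at x) (Y x))"
proof -
  have "smooth_on S (\<lambda>x. \<Sum>b\<in>Basis. (Y x \<bullet> b) *\<^sub>R frechet_derivative h (at x) b)"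
    using assms by (intro smooth_on_sum smooth_on_scaleR smooth_on_frechet_derivative
        smooth_on_bounded_linear[OF _ bounded_linear_inner_left])
  then show ?thesis
    by (rule smooth_on_cong[OF assms(1), rotated])
      (use frechet_derivative_expand[OF smooth_on_differentiable[OF assms(2)]] in metis)
qed

text \<open>A product rule. The second derivative of \<open>h\<close> appears with the direction
  \<open>Y x\<close> frozen at \<open>x\<close>, the form in which the symmetry of second
  derivatives applies to it.\<close>

lemma has_derivative_derivative_along:
  assumes "open S" "smooth_on S h" "x \<in> S" "(Y has_derivative Y') (at x)"
  shows "((\<lambda>y. frechet_derivative h (at y) (Y y)) has_derivative
     (\<lambda>w. frechet_derivative (\<lambda>y. frechet_derivative h (at y) (Y x)) (at x) w
        + frechet_derivative h (at x) (Y' w))) (at x)"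
proof -
  let ?H = "\<lambda>b y. frechet_derivative h (at y) b"
  have H: "(?H b has_derivative frechet_derivative (?H b) (at x)) (at x)" for b
    using smooth_on_frechet_derivative[OF assms(2)] assms(3) smooth_on_has_derivative by blast
  have "((\<lambda>y. \<Sum>b\<in>Basis. (Y y \<bullet> b) *\<^sub>R ?H b y) has_derivative
     (\<lambda>w. \<Sum>b\<in>Basis. (Y x \<bullet> b) *\<^sub>R frechet_derivative (?H b) (at x) w + (Y' w \<bullet> b) *\<^sub>R ?H b x)) (at x)"
    by (intro has_derivative_sum has_derivative_scaleR has_derivative_inner_left assms(4) H)
  moreover have "(\<Sum>b\<in>Basis. (Y y \<bullet> b) *\<^sub>R ?H b y) = ?H (Y y) y" if "y \<in> S" for y
    by (rule frechet_derivative_expand[OF smooth_on_differentiable[OF assms(2) that], symmetric])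
  ultimately have A: "((\<lambda>y. ?H (Y y) y) has_derivative
     (\<lambda>w. \<Sum>b\<in>Basis. (Y x \<bullet> b) *\<^sub>R frechet_derivative (?H b) (at x) w + (Y' w \<bullet> b) *\<^sub>R ?H b x)) (at x)"
    by (rule has_derivative_transform_within_open[OF _ assms(1,3)])
  have "((\<lambda>y. \<Sum>b\<in>Basis. (Y x \<bullet> b) *\<^sub>R ?H b y) has_derivative
     (\<lambda>w. \<Sum>b\<in>Basis. (Y x \<bullet> b) *\<^sub>R frechet_derivative (?H b) (at x) w)) (at x)"
    by (intro has_derivative_sum has_derivative_scaleR_right H)
  moreover have "(\<Sum>b\<in>Basis. (Y x \<bullet> b) *\<^sub>R ?H b y) = ?H (Y x) y" if "y \<in> S" for y
    by (rule frechet_derivative_expand[OF smooth_on_differentiable[OF assms(2) that], symmetric])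
  ultimately have B0: "((\<lambda>y. ?H (Y x) y) has_derivative
     (\<lambda>w. \<Sum>b\<in>Basis. (Y x \<bullet> b) *\<^sub>R frechet_derivative (?H b) (at x) w)) (at x)"
    by (rule has_derivative_transform_within_open[OF _ assms(1,3)])
  have B: "frechet_derivative (?H (Y x)) (at x) w =
      (\<Sum>b\<in>Basis. (Y x \<bullet> b) *\<^sub>R frechet_derivative (?H b) (at x) w)" for w
    using fun_cong[OF frechet_derivative_at[OF B0], of w] by simp
  show ?thesis
    using A unfolding B
    by (simp add: sum.distrib frechet_derivative_expand[OF smooth_on_differentiable[OF assms(2,3)], of "Y' _"])
qed

text \<open>Both mixed derivatives are the limit of the second difference quotients
  \<open>(f (x + t u + t v) - f (x + t u) - f (x + t v) + f x) / t\<^sup>2\<close>.\<close>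

lemma second_difference_tendsto:
  fixes f :: "'e::euclidean_space \<Rightarrow> real"
  assumes "open S" "x \<in> S" "\<And>y. y \<in> S \<Longrightarrow> f differentiable (at y)"
    and "((\<lambda>y. frechet_derivative f (at y) u) has_derivative h) (at x)"
  shows "((\<lambda>t. (f (x + t *\<^sub>R u + t *\<^sub>R v) - f (x + t *\<^sub>R u) - f (x + t *\<^sub>R v) + f x) / t\<^sup>2) \<longlongrightarrow> h v)
           (at_right 0)"
proof -
  define g where "g = (\<lambda>y. frechet_derivative f (at y) u)"
  have lh: "linear h" using assms(4) has_derivative_linear by blast
  obtain d0 where d0: "d0 > 0" "ball x d0 \<subseteq> S" using assms(1,2) openE by blast
  \<comment> \<open>All points used below lie within \<open>t * C\<close> of \<open>x\<close>; the
    summand 1 makes the bound strict and keeps \<open>C\<close> positive when \<open>u\<close> and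
    \<open>v\<close> vanish.\<close>
  define C where "C = norm u + norm v + 1"
  have C: "C > 0" "norm u + norm v < C" by (auto simp: C_def add_nonneg_pos)
  show ?thesis
  proof (rule tendstoI)
    fix e :: real assume e: "e > 0"
    \<comment> \<open>Two first-order expansions of \<open>g\<close> enter, each with error at most
      \<open>e' * (t * C)\<close>; together they contribute \<open>t * (e / 2)\<close>.\<close>
    define e' where "e' = e / (4 * C)"
    have e': "e' > 0" using e C by (simp add: e'_def)
    obtain d1 where d1: "d1 > 0"
      "\<And>y. norm (y - x) < d1 \<Longrightarrow> norm (g y - g x - h (y - x)) \<le> e' * norm (y - x)"
      using assms(4)[folded g_def] e' unfolding has_derivative_at_alt by blast
    define d where "d = min d0 d1 / C"
    have d: "d > 0" using d0 d1 C by (simp add: d_def)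
    have "dist ((f (x + t *\<^sub>R u + t *\<^sub>R v) - f (x + t *\<^sub>R u) - f (x + t *\<^sub>R v) + f x) / t\<^sup>2) (h v) < e"
      if t: "0 < t" "t < d" for t
    proof -
      have tC: "t * C < d0" "t * C < d1" using t C by (auto simp: d_def field_simps)
      \<comment> \<open>The second difference is \<open>\<phi> t - \<phi> 0\<close>. The mean value
        theorem reduces it to two values of \<open>g\<close>, which are compared through the
        derivative of \<open>g\<close> at the single point \<open>x\<close>.\<close>
      define \<phi> where "\<phi> = (\<lambda>s. f (x + s *\<^sub>R u + t *\<^sub>R v) - f (x + s *\<^sub>R u))"
      have near: "norm (s *\<^sub>R u + r *\<^sub>R v) \<le> t * (norm u + norm v)" 
        if "0 \<le> s" "s \<le> t" "0 \<le> r" "r \<le> t" for s r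
      proof -
        have "norm (s *\<^sub>R u + r *\<^sub>R v) \<le> s * norm u + r * norm v"
          using norm_triangle_ineq[of "s *\<^sub>R u" "r *\<^sub>R v"] that by simp
        also have "\<dots> \<le> t * norm u + t * norm v"
          using that by (intro add_mono mult_right_mono) auto
        finally show ?thesis by (simp add: algebra_simps)
      qed
      have lt: "t * (norm u + norm v) < t * C" using C t by simp
      have near': "norm (s *\<^sub>R u + r *\<^sub>R v) < t * C" if "0 \<le> s" "s \<le> t" "0 \<le> r" "r \<le> t" for s r
        using near[OF that] lt by linarith
      have inS: "x + s *\<^sub>R u + r *\<^sub>R v \<in> S" if "0 \<le> s" "s \<le> t" "0 \<le> r" "r \<le> t" for s r
        using near'[OF that] tC d0(2) by (auto simp: dist_norm subset_iff norm_minus_commute add.assoc)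
      have fd: "((\<lambda>s. f (x + s *\<^sub>R u + r *\<^sub>R v)) has_real_derivative g (x + s *\<^sub>R u + r *\<^sub>R v)) (at s)"
        if "0 \<le> s" "s \<le> t" "0 \<le> r" "r \<le> t" for s r
      proof -
        have 1: "((\<lambda>s. x + s *\<^sub>R u + r *\<^sub>R v) has_derivative (\<lambda>s. s *\<^sub>R u)) (at s)"
          by (auto intro!: derivative_eq_intros)
        have 2: "(f has_derivative frechet_derivative f (at (x + s *\<^sub>R u + r *\<^sub>R v))) (at (x + s *\<^sub>R u + r *\<^sub>R v))"
          using assms(3)[OF inS[OF that]] frechet_derivative_works by blast
        have "(\<lambda>c. frechet_derivative f (at (x + s *\<^sub>R u + r *\<^sub>R v)) (c *\<^sub>R u)) = (*) (g (x + s *\<^sub>R u + r *\<^sub>R v))"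
          using linear_cmul[OF has_derivative_linear[OF 2]] by (auto simp: g_def fun_eq_iff)
        then show ?thesis using diff_chain_at[OF 1 2] by (simp add: o_def has_field_derivative_def)
      qed
      have "(\<phi> has_real_derivative g (x + s *\<^sub>R u + t *\<^sub>R v) - g (x + s *\<^sub>R u)) (at s)" if "0 \<le> s" "s \<le> t" for s
        unfolding \<phi>_def using fd[of s t] fd[of s 0] that t by (intro DERIV_diff) auto
      then obtain s where s: "0 < s" "s < t" "\<phi> t - \<phi> 0 = t * (g (x + s *\<^sub>R u + t *\<^sub>R v) - g (x + s *\<^sub>R u))"
        using MVT2[of 0 t \<phi> "\<lambda>s. g (x + s *\<^sub>R u + t *\<^sub>R v) - g (x + s *\<^sub>R u)"] t by auto
      have n1: "norm (g (x + s *\<^sub>R u + t *\<^sub>R v) - g x - h (s *\<^sub>R u + t *\<^sub>R v)) \<le> e' * (t * C)"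
        using d1(2)[of "x + s *\<^sub>R u + t *\<^sub>R v"] near'[of s t] s t tC e'
        by (smt (verit) add.assoc add_diff_cancel_left' mult_left_mono)
      have n2: "norm (g (x + s *\<^sub>R u) - g x - h (s *\<^sub>R u)) \<le> e' * (t * C)"
        using d1(2)[of "x + s *\<^sub>R u"] near'[of s 0] s t tC e'
        by (smt (verit) add_diff_cancel_left' add.right_neutral mult_left_mono scaleR_zero_left)
      have "h (s *\<^sub>R u + t *\<^sub>R v) = h (s *\<^sub>R u) + t * h v"
        by (simp add: linear_add[OF lh] linear_cmul[OF lh])
      then have "\<bar>(g (x + s *\<^sub>R u + t *\<^sub>R v) - g (x + s *\<^sub>R u)) - t * h v\<bar> \<le> 2 * (e' * (t * C))"
        using n1 n2 unfolding real_norm_def by linarith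
      also have "\<dots> = t * (e / 2)" using C by (simp add: e'_def field_simps)
      finally have *: "\<bar>(g (x + s *\<^sub>R u + t *\<^sub>R v) - g (x + s *\<^sub>R u)) - t * h v\<bar> \<le> t * (e / 2)" .
      have "(f (x + t *\<^sub>R u + t *\<^sub>R v) - f (x + t *\<^sub>R u) - f (x + t *\<^sub>R v) + f x) = \<phi> t - \<phi> 0"
        by (simp add: \<phi>_def)
      then have "(f (x + t *\<^sub>R u + t *\<^sub>R v) - f (x + t *\<^sub>R u) - f (x + t *\<^sub>R v) + f x) / t\<^sup>2 - h v
         = ((g (x + s *\<^sub>R u + t *\<^sub>R v) - g (x + s *\<^sub>R u)) - t * h v) / t"
        using t s(3) by (simp add: diff_divide_distrib[of _ "t * h v"] power2_eq_square)
      then have "\<bar>(f (x + t *\<^sub>R u + t *\<^sub>R v) - f (x + t *\<^sub>R u) - f (x + t *\<^sub>R v) + f x) / t\<^sup>2 - h v\<bar> \<le> e / 2"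
        using divide_right_mono[OF *, of t] t by (simp only: abs_divide) simp
      then show ?thesis using e by (simp add: dist_real_def)
    qed
    then show "\<forall>\<^sub>F t in at_right 0. dist ((f (x + t *\<^sub>R u + t *\<^sub>R v) - f (x + t *\<^sub>R u) - f (x + t *\<^sub>R v) + f x) / t\<^sup>2) (h v) < e"
      unfolding eventually_at_right_field using d by auto
  qed
qed

lemma frechet_derivative_commute_real:
  fixes f :: "'e::euclidean_space \<Rightarrow> real"
  assumes "open S" "x \<in> S" "smooth_on S f"
  shows "frechet_derivative (\<lambda>y. frechet_derivative f (at y) u) (at x) v
       = frechet_derivative (\<lambda>y. frechet_derivative f (at y) v) (at x) u"
proof -
  note A = second_difference_tendsto[OF assms(1,2) smooth_on_differentiable[OF assms(3)]
      smooth_on_has_derivative[OF smooth_on_frechet_derivative[OF assms(3)] assms(2)]]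
  have "(\<lambda>t. (f (x + t *\<^sub>R u + t *\<^sub>R v) - f (x + t *\<^sub>R u) - f (x + t *\<^sub>R v) + f x) / t\<^sup>2)
     = (\<lambda>t. (f (x + t *\<^sub>R v + t *\<^sub>R u) - f (x + t *\<^sub>R v) - f (x + t *\<^sub>R u) + f x) / t\<^sup>2)"
    by (simp add: algebra_simps)
  then show ?thesis
    using tendsto_unique[OF _ A[of u v]] A[of v u] by simp
qed

lemma frechet_derivative_inner:
  assumes "f differentiable (at x)"
  shows "frechet_derivative (\<lambda>y. f y \<bullet> b) (at x) v = frechet_derivative f (at x) v \<bullet> b"
  using frechet_derivative_at[OF has_derivative_inner_left[OF assms[unfolded frechet_derivative_works], of b]]
  by (metis)

text \<open>The mean value theorem behind the real case has no vector-valued form, so the components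
  are treated one by one.\<close>

lemma frechet_derivative_commute:
  fixes f :: "'e::euclidean_space \<Rightarrow> 'f::euclidean_space"
  assumes "open S" "x \<in> S" "smooth_on S f"
  shows "frechet_derivative (\<lambda>y. frechet_derivative f (at y) u) (at x) v
       = frechet_derivative (\<lambda>y. frechet_derivative f (at y) v) (at x) u"
proof (rule euclidean_eqI)
  fix b :: 'f assume "b \<in> Basis"
  have sb: "smooth_on S (\<lambda>y. f y \<bullet> b)"
    using assms smooth_on_bounded_linear bounded_linear_inner_left by blast
  have "frechet_derivative (\<lambda>y. frechet_derivative (\<lambda>y. f y \<bullet> b) (at y) u) (at x) v
      = frechet_derivative (\<lambda>y. frechet_derivative f (at y) u) (at x) v \<bullet> b" for u v
  proof -
    have "frechet_derivative (\<lambda>y. frechet_derivative (\<lambda>y. f y \<bullet> b) (at y) u) (at x)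
       = frechet_derivative (\<lambda>y. frechet_derivative f (at y) u \<bullet> b) (at x)"
      by (rule frechet_derivative_transform_within_open[OF
            smooth_on_differentiable[OF smooth_on_frechet_derivative[OF sb] assms(2)] assms(1,2)])
        (rule frechet_derivative_inner[OF smooth_on_differentiable[OF assms(3)]])
    then show ?thesis
      using frechet_derivative_inner[OF smooth_on_differentiable[OF smooth_on_frechet_derivative[OF assms(3)] assms(2)]]
      by simp
  qed
  then show "frechet_derivative (\<lambda>y. frechet_derivative f (at y) u) (at x) v \<bullet> b
       = frechet_derivative (\<lambda>y. frechet_derivative f (at y) v) (at x) u \<bullet> b"
    using frechet_derivative_commute_real[OF assms(1,2) sb] by metis
qed

text \<open>The second derivatives of \<open>h\<close> in the directions \<open>X x\<close> and
  \<open>Y x\<close> cancel by symmetry, and only first-order terms remain. In coordinates this is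
  \<open>X (Y h) - Y (X h) = [X, Y] h\<close>; \<open>h\<close> is vector-valued because components
  of fields are inserted for it later.\<close>

lemma derivative_along_commutator:
  fixes h :: "'e::euclidean_space \<Rightarrow> 'f::euclidean_space"
  assumes "open S" "x \<in> S" "smooth_on S h" "smooth_on S X" "smooth_on S Y"
  shows "frechet_derivative (\<lambda>y. frechet_derivative h (at y) (Y y)) (at x) (X x)
       - frechet_derivative (\<lambda>y. frechet_derivative h (at y) (X y)) (at x) (Y x)
       = frechet_derivative h (at x)
           (frechet_derivative Y (at x) (X x) - frechet_derivative X (at x) (Y x))"
proof -
  have *: "frechet_derivative (\<lambda>y. frechet_derivative h (at y) (Z y)) (at x) w =
    frechet_derivative (\<lambda>y. frechet_derivative h (at y) (Z x)) (at x) w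
        + frechet_derivative h (at x) (frechet_derivative Z (at x) w)" if "smooth_on S Z" for Z w
    using fun_cong[OF frechet_derivative_at[OF has_derivative_derivative_along[OF assms(1,3,2)
          smooth_on_has_derivative[OF that assms(2)]]], of w] by simp
  show ?thesis
    unfolding *[OF assms(4)] *[OF assms(5)]
    using frechet_derivative_commute[OF assms(1-3), of "X x" "Y x"]
      linear_diff[OF linear_frechet_derivative[OF smooth_on_differentiable[OF assms(3,2)]]]
    by simp
qed

text \<open>At a common zero no derivative of \<open>\<phi>\<close> enters: \<open>\<psi> y\<close>
  is of order \<open>norm (y - x)\<close> and \<open>\<phi>\<close> tends to 0. This handles a
  factor that is so far known only to be continuous.\<close>

lemma has_derivative_scaleR_vanishing:
  fixes \<phi> :: "'e::real_normed_vector \<Rightarrow> real" and \<psi> :: "'e \<Rightarrow> 'f::real_normed_vector"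
  assumes "(\<phi> \<longlongrightarrow> 0) (at x)" "(\<psi> has_derivative \<psi>') (at x)" "\<psi> x = 0" "\<phi> x = 0"
  shows "((\<lambda>y. \<phi> y *\<^sub>R \<psi> y) has_derivative (\<lambda>_. 0)) (at x)"
proof -
  obtain K where K: "\<And>v. norm (\<psi>' v) \<le> norm v * K"
    using assms(2) has_derivative_bounded_linear bounded_linear.bounded by metis
  have "((\<lambda>y. \<bar>\<phi> y\<bar> * (norm ((\<psi> y - \<psi> x - \<psi>' (y - x)) /\<^sub>R norm (y - x)) + K)) \<longlongrightarrow> 0 * (norm (0::'f) + K)) (at x)"
    using assms(1,2) unfolding has_derivative_at_within
    by (intro tendsto_intros tendsto_norm) (auto simp: tendsto_rabs_zero_iff)
  then have L: "((\<lambda>y. \<bar>\<phi> y\<bar> * (norm ((\<psi> y - \<psi> x - \<psi>' (y - x)) /\<^sub>R norm (y - x)) + K)) \<longlongrightarrow> 0) (at x)"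
    by simp
  have "norm ((\<phi> y *\<^sub>R \<psi> y) /\<^sub>R norm (y - x)) \<le> \<bar>\<phi> y\<bar> * (norm ((\<psi> y - \<psi> x - \<psi>' (y - x)) /\<^sub>R norm (y - x)) + K)"
    if "y \<noteq> x" for y
  proof -
    have "norm (\<psi> y) \<le> norm (\<psi> y - \<psi>' (y - x)) + norm (\<psi>' (y - x))"
      using norm_triangle_sub by (metis add.commute)
    also have "\<dots> \<le> norm (\<psi> y - \<psi>' (y - x)) + norm (y - x) * K"
      using K by simp
    finally have "norm (\<psi> y) / norm (y - x) \<le> norm (\<psi> y - \<psi>' (y - x)) / norm (y - x) + K"
      using that by (simp add: field_simps)
    then have "\<bar>\<phi> y\<bar> * (norm (\<psi> y) / norm (y - x)) \<le> \<bar>\<phi> y\<bar> * (norm (\<psi> y - \<psi>' (y - x)) / norm (y - x) + K)"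
      by (intro mult_left_mono) auto
    then show ?thesis using assms(3) by (simp add: divide_inverse abs_mult mult_ac)
  qed
  then have "((\<lambda>y. (\<phi> y *\<^sub>R \<psi> y) /\<^sub>R norm (y - x)) \<longlongrightarrow> 0) (at x)"
    by (intro Lim_null_comparison[OF _ L]) (auto simp: eventually_at_filter)
  then show ?thesis using assms(3) unfolding has_derivative_at_within by simp
qed

section \<open>Solutions of linear systems that depend on a parameter\<close>

context
  fixes A :: "'e::euclidean_space \<Rightarrow> 'f::euclidean_space \<Rightarrow> 'f" and f X :: "'e \<Rightarrow> 'f" and S x
  assumes S: "open S" and x: "x \<in> S" and lin: "\<And>y. y \<in> S \<Longrightarrow> linear (A y)" and inj: "inj (A x)"
    and sol: "\<And>y. y \<in> S \<Longrightarrow> A y (f y) = X y"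
begin

lemma linear_family_diff:
  assumes "y \<in> S"
  shows "A y u - A x u = (\<Sum>b\<in>Basis. (u \<bullet> b) *\<^sub>R (A y b - A x b))"
  using linear_expand_Basis[OF lin[OF assms], of u] linear_expand_Basis[OF lin[OF x], of u]
  by (simp add: scaleR_diff_right sum_subtractf)

text \<open>\<open>A x\<close> is bounded below by some \<open>B\<close>, and near \<open>x\<close>
  the perturbation \<open>A y - A x\<close> costs at most half of it, so \<open>A y\<close> still
  controls \<open>f y - f x\<close> with the constant \<open>B / 2\<close>.\<close>

lemma linear_system_solution_isCont:
  assumes "\<And>u. isCont (\<lambda>y. A y u) x" "isCont X x"
  shows "isCont f x"
proof -
  obtain B where B: "B > 0" "\<And>u. B * norm u \<le> norm (A x u)"
    using linear_inj_bounded_below_pos[OF lin[OF x] inj] by blast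
  have evS: "\<forall>\<^sub>F y in at x. y \<in> S"
    using S x eventually_at_in_open' by blast
  define \<eta> where "\<eta> = (\<lambda>y. \<Sum>b\<in>Basis. norm (A y b - A x b))"
  have cA: "((\<lambda>y. A y u) \<longlongrightarrow> A x u) (at x)" for u
    using assms(1) by (simp add: isCont_def)
  have "(\<eta> \<longlongrightarrow> (\<Sum>b\<in>(Basis::'f set). norm (A x b - A x b))) (at x)"
    unfolding \<eta>_def by (intro tendsto_intros cA)
  then have eta0: "(\<eta> \<longlongrightarrow> 0) (at x)" by simp
  have diff_bd: "norm (A y u - A x u) \<le> norm u * \<eta> y" if "y \<in> S" for y u
  proof -
    have "norm (\<Sum>b\<in>Basis. (u \<bullet> b) *\<^sub>R (A y b - A x b)) \<le> (\<Sum>b\<in>Basis. norm u * norm (A y b - A x b))"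
      by (rule sum_norm_le) (simp add: mult_right_mono Basis_le_norm)
    then show ?thesis by (simp add: linear_family_diff[OF that, of u] \<eta>_def sum_distrib_left)
  qed
  have "((\<lambda>y. X y - A y (f x)) \<longlongrightarrow> X x - A x (f x)) (at x)"
    using assms(2) cA by (intro tendsto_intros) (simp_all add: isCont_def)
  then have X0: "((\<lambda>y. norm (X y - A y (f x)) * (2 / B)) \<longlongrightarrow> 0) (at x)"
    using sol[OF x] tendsto_norm_zero tendsto_mult_left_zero by fastforce
  have "\<forall>\<^sub>F y in at x. norm (f y - f x) \<le> norm (X y - A y (f x)) * (2 / B)"
    using order_tendstoD(2)[OF eta0 half_gt_zero[OF B(1)]] evS
  proof eventually_elim
    case (elim y)
    let ?w = "f y - f x"
    have "B * norm ?w \<le> norm (A y ?w) + norm (A y ?w - A x ?w)"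
      using B(2)[of ?w] norm_triangle_sub[of "A x ?w" "A y ?w"] by (simp add: norm_minus_commute)
    also have "norm (A y ?w - A x ?w) \<le> norm ?w * (B / 2)"
      using diff_bd[OF elim(2), of ?w] mult_left_mono[of "\<eta> y" "B/2" "norm ?w"] elim(1) by simp
    also have "A y ?w = X y - A y (f x)"
      using linear_diff[OF lin[OF elim(2)]] sol[OF elim(2)] by simp
    finally show ?case using B(1) by (simp add: field_simps)
  qed
  from Lim_null_comparison[OF this X0]
  show ?thesis by (simp add: isCont_def LIM_zero_iff)
qed

text \<open>Only \<open>A x\<close> is inverted, by \<open>Ai\<close>. This gives
  \<open>f y = f x + Ai (X y - A y (f x)) - r y\<close>, where the error term \<open>r\<close> has
  derivative 0 at \<open>x\<close>.\<close>

lemma linear_system_solution_differentiable: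
  assumes "\<And>u. (\<lambda>y. A y u) differentiable (at x)" "X differentiable (at x)"
  shows "f differentiable (at x)"
proof -
  obtain Ai where Ai: "linear Ai" "\<And>u. Ai (A x u) = u"
    using linear_injective_left_inverse[OF lin[OF x] inj] by (metis comp_apply id_apply)
  have "isCont f x"
    using assms by (intro linear_system_solution_isCont differentiable_imp_continuous_within)
  then have f0: "((\<lambda>y. f y - f x) \<longlongrightarrow> 0) (at x)" by (simp add: isCont_def LIM_zero_iff)
  have bAi: "bounded_linear Ai" using Ai(1) linear_conv_bounded_linear by blast
  \<comment> \<open>Each summand is the product of a component of \<open>f y - f x\<close>, which at
    this point is only known to tend to 0, and a differentiable factor that vanishes at
    \<open>x\<close>.\<close>
  define r where "r = (\<lambda>y. \<Sum>b\<in>Basis. ((f y - f x) \<bullet> b) *\<^sub>R Ai (A y b - A x b))"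
  have "((\<lambda>y. ((f y - f x) \<bullet> b) *\<^sub>R Ai (A y b - A x b)) has_derivative (\<lambda>_. 0)) (at x)" for b
  proof -
    have "((\<lambda>y. A y b - A x b) has_derivative frechet_derivative (\<lambda>y. A y b) (at x)) (at x)"
      using has_derivative_diff[OF assms(1)[unfolded frechet_derivative_works] has_derivative_const] by simp
    from bounded_linear.has_derivative[OF bAi this]
    have d: "((\<lambda>y. Ai (A y b - A x b)) has_derivative (\<lambda>v. Ai (frechet_derivative (\<lambda>y. A y b) (at x) v))) (at x)" .
    show ?thesis
      using tendsto_inner[OF f0 tendsto_const[of b]]
      by (intro has_derivative_scaleR_vanishing[OF _ d]) (auto simp: linear_0[OF Ai(1)])
  qed
  then have "(r has_derivative (\<lambda>_. \<Sum>b\<in>(Basis::'f set). 0)) (at x)"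
    unfolding r_def by (intro has_derivative_sum)
  then have rd: "r differentiable (at x)" unfolding differentiable_def by blast
  have "(\<lambda>y. Ai (X y - A y (f x))) differentiable (at x)"
    using has_derivative_diff[OF assms(2)[unfolded frechet_derivative_works] assms(1)[unfolded frechet_derivative_works]]
      bounded_linear.has_derivative[OF bAi] unfolding differentiable_def by blast
  then have "(\<lambda>y. f x + Ai (X y - A y (f x)) - r y) differentiable (at x)"
    using rd by (intro differentiable_diff differentiable_add) auto
  moreover have "f x + Ai (X y - A y (f x)) - r y = f y" if "y \<in> S" for y
  proof -
    let ?w = "f y - f x"
    have "r y = Ai (A y ?w - A x ?w)"
      unfolding linear_family_diff[OF that, of ?w]
      by (simp add: r_def linear_sum[OF Ai(1)] linear_cmul[OF Ai(1)])
    also have "A y ?w = X y - A y (f x)"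
      using linear_diff[OF lin[OF that]] sol[OF that] by simp
    finally show ?thesis by (simp add: linear_diff[OF Ai(1)] Ai(2))
  qed
  ultimately show ?thesis
    using S x has_derivative_transform_within_open unfolding differentiable_def by blast
qed

end

text \<open>Differentiating \<open>A x (f x) = X x\<close> in a direction \<open>w\<close> shows
  that the derivative of \<open>f\<close> in this direction solves a system with the same
  \<open>A\<close>. Its right-hand side contains only derivatives of \<open>X\<close> and
  \<open>A\<close>, and \<open>f\<close> itself, which drives the induction on
  \<open>k\<close>.\<close>

lemma Ck_on_linear_system_solution:
  fixes A :: "'e::euclidean_space \<Rightarrow> 'f::euclidean_space \<Rightarrow> 'f"
  assumes S: "open S" and lin: "\<And>x. x \<in> S \<Longrightarrow> linear (A x)" and inj: "\<And>x. x \<in> S \<Longrightarrow> inj (A x)"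
    and A: "\<And>u. smooth_on S (\<lambda>x. A x u)"
    and "Ck_on k S X" "\<And>x. x \<in> S \<Longrightarrow> A x (f x) = X x"
  shows "Ck_on k S f"
  using assms(5,6)
proof (induction k arbitrary: X f)
  case 0
  have "isCont f x" if "x \<in> S" for x
  proof (rule linear_system_solution_isCont[where A = A and X = X and f = f, OF S that lin inj[OF that]])
    show "isCont (\<lambda>y. A y u) x" for u
      by (rule differentiable_imp_continuous_within[OF smooth_on_differentiable[OF A that]])
    show "isCont X x"
      using 0(1) that S by (simp add: continuous_on_eq_continuous_at)
  qed (use 0 in auto)
  then show ?case by (auto intro: continuous_at_imp_continuous_on)
next
  case (Suc k)
  have df: "f differentiable (at x)" if "x \<in> S" for x
    using Suc.prems smooth_on_differentiable[OF A that] that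
    by (intro linear_system_solution_differentiable[where A = A and X = X and f = f, OF S that lin inj[OF that]]) auto
  have fk: "Ck_on k S f"
    using Suc.IH Suc.prems Ck_on_Suc_imp_Ck_on by blast
  let ?D = "\<lambda>x w. frechet_derivative X (at x) w + (\<Sum>b\<in>Basis. (- (f x \<bullet> b)) *\<^sub>R frechet_derivative (\<lambda>y. A y b) (at x) w)"
  have "Ck_on k S (\<lambda>x. frechet_derivative f (at x) w)" for w
  proof (rule Suc.IH[of "\<lambda>x. ?D x w"])
    have "bounded_linear (\<lambda>u::'f. - (u \<bullet> b))" for b
      by (intro bounded_linear_minus bounded_linear_inner_left)
    then show "Ck_on k S (\<lambda>x. ?D x w)"
      using Suc.prems(1) smooth_on_frechet_derivative[OF A] fk unfolding smooth_on_def
      by (intro Ck_on_add Ck_on_sum Ck_on_scaleR Ck_on_bounded_linear[of S "\<lambda>u. - (u \<bullet> _)" k f] S) auto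
    fix x assume x: "x \<in> S"
    have "((\<lambda>y. \<Sum>b\<in>Basis. (f y \<bullet> b) *\<^sub>R A y b) has_derivative
      (\<lambda>w. \<Sum>b\<in>Basis. (f x \<bullet> b) *\<^sub>R frechet_derivative (\<lambda>y. A y b) (at x) w + (frechet_derivative f (at x) w \<bullet> b) *\<^sub>R A x b)) (at x)"
      using df[OF x] smooth_on_has_derivative[OF A x]
      by (intro has_derivative_sum has_derivative_scaleR has_derivative_inner_left) (auto simp: frechet_derivative_works)
    moreover have "(\<Sum>b\<in>Basis. (f y \<bullet> b) *\<^sub>R A y b) = X y" if "y \<in> S" for y
      using linear_expand_Basis[OF lin[OF that], of "f y"] Suc.prems(2)[OF that] by simp
    ultimately have "(X has_derivative
      (\<lambda>w. \<Sum>b\<in>Basis. (f x \<bullet> b) *\<^sub>R frechet_derivative (\<lambda>y. A y b) (at x) w + (frechet_derivative f (at x) w \<bullet> b) *\<^sub>R A x b)) (at x)"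
      using has_derivative_transform_within_open[OF _ S x] by blast
    from fun_cong[OF frechet_derivative_at[OF this], of w]
    show "A x (frechet_derivative f (at x) w) = ?D x w"
      unfolding linear_expand_Basis[OF lin[OF x], of "frechet_derivative f (at x) w"]
      by (simp add: sum.distrib sum_negf algebra_simps)
  qed
  then show ?case using df by simp
qed

lemma smooth_on_linear_system_solution:
  fixes A :: "'e::euclidean_space \<Rightarrow> 'f::euclidean_space \<Rightarrow> 'f"
  assumes "open S" "\<And>x. x \<in> S \<Longrightarrow> linear (A x)" "\<And>x. x \<in> S \<Longrightarrow> inj (A x)"
    and "\<And>u. smooth_on S (\<lambda>x. A x u)" "smooth_on S X" "\<And>x. x \<in> S \<Longrightarrow> A x (f x) = X x"
  shows "smooth_on S f"
  using Ck_on_linear_system_solution[OF assms(1-4) _ assms(6)] assms(5) unfolding smooth_on_def by blast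


section \<open>Traces and the algebra of the Obata connection\<close>

definition trace_lin :: "('e::euclidean_space \<Rightarrow> 'e) \<Rightarrow> real" where
  "trace_lin f = (\<Sum>b\<in>Basis. f b \<bullet> b)"

lemma trace_lin_diff: "trace_lin (\<lambda>v. f v - g v) = trace_lin f - trace_lin g"
  by (simp add: trace_lin_def inner_diff_left sum_subtractf)

lemma trace_lin_minus: "trace_lin (\<lambda>v. - f v) = - trace_lin f"
  by (simp add: trace_lin_def sum_negf)

lemma trace_lin_scaleR: "trace_lin (\<lambda>v. c *\<^sub>R f v) = c * trace_lin f"
  by (simp add: trace_lin_def sum_distrib_left)

lemma trace_lin_commute:
  fixes f g :: "'e::euclidean_space \<Rightarrow> 'e"
  assumes "linear f" "linear g"
  shows "trace_lin (\<lambda>v. f (g v)) = trace_lin (\<lambda>v. g (f v))"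
proof -
  have *: "trace_lin (\<lambda>v. f (g v)) = (\<Sum>b\<in>Basis. \<Sum>c\<in>Basis. (g b \<bullet> c) * (f c \<bullet> b))"
    if "linear f" for f g :: "'e \<Rightarrow> 'e"
  proof -
    have "f (g b) = (\<Sum>c\<in>Basis. (g b \<bullet> c) *\<^sub>R f c)" for b
    proof -
      have "f (g b) = f (\<Sum>c\<in>Basis. (g b \<bullet> c) *\<^sub>R c)" by (simp add: euclidean_representation)
      then show ?thesis by (simp add: linear_sum[OF that] linear_cmul[OF that])
    qed
    then show ?thesis by (simp add: trace_lin_def inner_sum_left)
  qed
  show ?thesis
    unfolding *[OF assms(1)] *[OF assms(2)] by (subst sum.swap) (simp add: mult.commute)
qed

text \<open>If \<open>P\<^sub>k\<close> is a projection onto \<open>V k\<close>, then \<open>f P\<^sub>k = P\<^sub>k\<^sub>+\<^sub>1 f P\<^sub>k\<close> has the same trace as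
  \<open>f P\<^sub>k P\<^sub>k\<^sub>+\<^sub>1 = f P\<^sub>k\<^sub>+\<^sub>1\<close>.\<close>

lemma trace_lin_flag:
  fixes f :: "'e::euclidean_space \<Rightarrow> 'e"
  assumes f: "linear f" and V: "\<And>k. subspace (V k)" "V 0 = UNIV" "V n = {0}" "\<And>k. V (Suc k) \<subseteq> V k"
    and step: "\<And>k v. v \<in> V k \<Longrightarrow> f v \<in> V (Suc k)"
  shows "trace_lin f = 0"
proof -
  \<comment> \<open>A left inverse of the identity on \<open>V k\<close> with range in
    \<open>V k\<close> is a projection onto \<open>V k\<close>.\<close>
  have "\<exists>P. range P \<subseteq> V k \<and> linear P \<and> (\<forall>v\<in>V k. P v = v)" for k
    using linear_exists_left_inverse_on[OF linear_id V(1), of k] by (simp add: inj_on_def)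
  then obtain P where P: "\<And>k v. P k v \<in> V k" "\<And>k. linear (P k)" "\<And>k v. v \<in> V k \<Longrightarrow> P k v = v"
    by (metis rangeI subsetD)
  have lin: "linear (\<lambda>v. f (P k v))" for k
    using linear_compose[OF P(2) f] by (simp add: o_def)
  have "trace_lin (\<lambda>v. f (P k v)) = trace_lin (\<lambda>v. f (P (Suc k) v))" for k
  proof -
    have "trace_lin (\<lambda>v. f (P k v)) = trace_lin (\<lambda>v. P (Suc k) (f (P k v)))"
      using P step by simp
    also have "\<dots> = trace_lin (\<lambda>v. f (P k (P (Suc k) v)))"
      by (rule trace_lin_commute[OF P(2) lin])
    also have "\<dots> = trace_lin (\<lambda>v. f (P (Suc k) v))"
      using P V(4) by (metis subsetD)
    finally show ?thesis .
  qed
  then have "trace_lin (\<lambda>v. f (P 0 v)) = trace_lin (\<lambda>v. f (P n v))"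
    by (induction n) auto
  moreover have "P 0 v = v" "P n v = 0" for v
    using P(1)[of n v] P(3)[of v 0] V(2,3) by auto
  ultimately show ?thesis
    using linear_0[OF f] by (simp add: trace_lin_def)
qed

text \<open>It has two uses: to compare the basis of a chart with the frame, and, with a complex
  structure and its negative for \<open>A\<close> and \<open>B\<close>, to see that a map
  anticommuting with the structure is trace-free.\<close>

lemma trace_lin_conjugate:
  fixes A B f :: "'e::euclidean_space \<Rightarrow> 'e"
  assumes "linear A" "linear B" "linear f" "\<And>v. B (A v) = v"
  shows "trace_lin (\<lambda>v. A (f (B v))) = trace_lin f"
proof -
  have "linear (\<lambda>v. f (B v))"
    using linear_compose[OF assms(2,3)] by (simp add: o_def)
  from trace_lin_commute[OF assms(1) this] show ?thesis
    using assms(4) by simp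
qed

text \<open>\<open>\<Gamma> u v\<close> is the covariant derivative of \<open>v\<close> along
  \<open>u\<close> for invariant fields. Torsion-freeness is built in by writing each Lie bracket as
  \<open>\<Gamma> u v - \<Gamma> v u\<close>, and \<open>K\<close> is represented by the composition
  of \<open>I\<close> and \<open>J\<close>. Integrability of the complex structures is implied by
  \<open>conn_I\<close> and \<open>conn_J\<close>.\<close>

locale obata_algebra =
  fixes \<Gamma> :: "'e::euclidean_space \<Rightarrow> 'e \<Rightarrow> 'e" and I J :: "'e \<Rightarrow> 'e" and V :: "nat \<Rightarrow> 'e set" and n :: nat
  assumes linear_left: "\<And>v. linear (\<lambda>u. \<Gamma> u v)" and linear_right: "\<And>u. linear (\<Gamma> u)"
    and linear_I: "linear I" and linear_J: "linear J"
    and I_I: "\<And>v. I (I v) = - v" and J_J: "\<And>v. J (J v) = - v" and J_I: "\<And>v. J (I v) = - I (J v)"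
    and conn_I: "\<And>u v. \<Gamma> u (I v) = I (\<Gamma> u v)" and conn_J: "\<And>u v. \<Gamma> u (J v) = J (\<Gamma> u v)"
    and subspace_flag: "\<And>k. subspace (V k)" and flag_0: "V 0 = UNIV" and flag_n: "V n = {0}"
    and flag_Suc: "\<And>k. V (Suc k) \<subseteq> V k"
    and bracket_flag: "\<And>k u v. v \<in> V k \<Longrightarrow> \<Gamma> u v - \<Gamma> v u \<in> V (Suc k)"
    and jacobi: "\<And>u v w. \<Gamma> u (\<Gamma> v w - \<Gamma> w v) - \<Gamma> (\<Gamma> v w - \<Gamma> w v) u
      + (\<Gamma> v (\<Gamma> w u - \<Gamma> u w) - \<Gamma> (\<Gamma> w u - \<Gamma> u w) v)
      + (\<Gamma> w (\<Gamma> u v - \<Gamma> v u) - \<Gamma> (\<Gamma> u v - \<Gamma> v u) w) = 0"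
begin

definition bracket :: "'e \<Rightarrow> 'e \<Rightarrow> 'e" where
  "bracket u v = \<Gamma> u v - \<Gamma> v u"

definition curv :: "'e \<Rightarrow> 'e \<Rightarrow> 'e \<Rightarrow> 'e" where
  "curv u v w = \<Gamma> u (\<Gamma> v w) - \<Gamma> v (\<Gamma> u w) - \<Gamma> (bracket u v) w"

lemmas conn_simps =
  linear_add[OF linear_left] linear_add[OF linear_right] linear_diff[OF linear_left] linear_diff[OF linear_right]
  linear_neg[OF linear_left] linear_neg[OF linear_right] linear_cmul[OF linear_left] linear_cmul[OF linear_right]
  linear_add[OF linear_I] linear_diff[OF linear_I] linear_neg[OF linear_I] linear_cmul[OF linear_I]
  linear_add[OF linear_J] linear_diff[OF linear_J] linear_neg[OF linear_J] linear_cmul[OF linear_J]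
  conn_I conn_J I_I J_J J_I

lemma linear_bracket: "linear (bracket u)"
  unfolding bracket_def by (intro linear_compose_sub linear_left linear_right)

lemma linear_curv_left: "linear (\<lambda>u. curv u v w)"
  unfolding linear_iff by (simp add: curv_def bracket_def conn_simps algebra_simps)

lemma trace_bracket: "trace_lin (bracket u) = 0"
  by (rule trace_lin_flag[OF linear_bracket subspace_flag flag_0 flag_n flag_Suc])
    (simp add: bracket_def bracket_flag)

text \<open>With \<open>e v = (v - i I v) / 2\<close> one has \<open>[e u, e v] = e (b v)\<close>,
  which explains the factor 1/2 in \<open>b\<close>. From \<open>tr b = 0\<close> and
  \<open>tr ad u = 0\<close> it follows that \<open>v \<mapsto> [I u, I v]\<close> has trace 0, that
  is, \<open>I (\<Gamma> (I u) v)\<close> and \<open>I (\<Gamma> (I v) u)\<close> have equal traces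
  in \<open>v\<close>. The former is 0 because this map anticommutes with \<open>J\<close>; the
  latter is minus the trace of \<open>v \<mapsto> \<Gamma> v u\<close> by cyclicity. A second use of
  \<open>tr ad u = 0\<close> exchanges the arguments of \<open>\<Gamma>\<close>.\<close>

lemma trace_conn: "trace_lin (\<Gamma> u) = 0"
proof -
  \<comment> \<open>the bracket of \<open>u - i I u\<close> and \<open>v - i I v\<close> in the subalgebra of vectors of type (1,0)\<close>
  define b where "b = (\<lambda>v. (1/2) *\<^sub>R (bracket u v - bracket (I u) (I v)))"
  \<comment> \<open>This is the integrability of \<open>I\<close>.\<close>
  have b_I: "b (I v) = I (b v)" for v
    by (simp add: b_def bracket_def conn_simps algebra_simps)
  have b_step: "b v \<in> V (Suc k)" if v: "v \<in> range (b ^^ k)" for k v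
  proof -
    have pow: "(b ^^ k) v \<in> V k" for v k
    proof (induction k arbitrary: v)
      case 0
      then show ?case by (simp add: flag_0)
    next
      case (Suc k)
      \<comment> \<open>\<open>V k\<close> need not be \<open>I\<close>-invariant; moving
        \<open>I\<close> past the powers of \<open>b\<close> leads back to the induction hypothesis,
        taken at \<open>I v\<close>.\<close>
      have "I ((b ^^ k) v) = (b ^^ k) (I v)"
        by (induction k arbitrary: v) (auto simp flip: b_I)
      then show ?case
        using Suc[of v] Suc[of "I v"] subspace_flag[of "Suc k"]
        by (simp add: b_def bracket_def bracket_flag subspace_scale subspace_diff)
    qed
    obtain w where "v = (b ^^ k) w" using v by blast
    then show ?thesis using pow[of "Suc k" w] by simp
  qed
  have linb: "linear b"
    unfolding b_def using linear_compose_sub[OF linear_bracket[of u] linear_compose[OF linear_I linear_bracket[of "I u"]]]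
    by (intro linear_compose_scale_right) (simp add: o_def)
  have linbk: "linear (b ^^ k)" for k
    by (induction k) (auto simp: linear_id[unfolded id_def] linear_compose[OF _ linb, unfolded o_def] id_def)
  have "trace_lin b = 0"
  \<comment> \<open>The flag consists of ranges of powers, since \<open>b\<close> need not map
    \<open>V k\<close> into \<open>V (Suc k)\<close>. As \<open>b_step\<close> speaks of one further
    application of \<open>b\<close>, it is the range of the power \<open>Suc n\<close> that is seen
    to vanish.\<close>
  proof (rule trace_lin_flag[OF linb, of "\<lambda>k. range (b ^^ k)" "Suc n"])
    show "subspace (range (b ^^ k))" for k
      using linear_subspace_image[OF linbk subspace_UNIV] .
    show "range (b ^^ 0) = UNIV" by simp
    show "range (b ^^ Suc k) \<subseteq> range (b ^^ k)" for k
      by (auto simp: funpow_swap1)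
    show "range (b ^^ Suc n) = {0}"
    proof -
      have "b v = 0" if "v \<in> range (b ^^ n)" for v
        using b_step[OF that] flag_Suc[of n] flag_n by auto
      then show ?thesis using linear_0[OF linbk] by (auto intro: image_eqI[of _ _ 0])
    qed
    show "b v \<in> range (b ^^ Suc k)" if "v \<in> range (b ^^ k)" for k v
      using that by auto
  qed
  then have "trace_lin (\<lambda>v. bracket (I u) (I v)) = 0"
    using trace_bracket[of u] unfolding b_def trace_lin_scaleR trace_lin_diff by simp
  then have *: "trace_lin (\<lambda>v. I (\<Gamma> (I u) v)) = trace_lin (\<lambda>v. I (\<Gamma> (I v) u))"
    by (simp add: bracket_def conn_I trace_lin_diff)
  have "trace_lin (\<lambda>v. I (\<Gamma> (I u) v)) = 0"
  proof -
    let ?f = "\<lambda>v. I (\<Gamma> (I u) v)"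
    have lf: "linear ?f" using linear_compose[OF linear_right linear_I] by (simp add: o_def)
    have lJ: "linear (\<lambda>v. - J v)" using linear_J by (rule linear_compose_neg)
    have "trace_lin (\<lambda>v. J (?f (- J v))) = trace_lin ?f"
      by (rule trace_lin_conjugate[OF linear_J lJ lf]) (simp add: J_J)
    moreover have "J (?f (- J v)) = - ?f v" for v by (simp add: conn_simps)
    ultimately show ?thesis by (simp add: trace_lin_minus)
  qed
  moreover have "trace_lin (\<lambda>v. I (\<Gamma> (I v) u)) = - trace_lin (\<lambda>v. \<Gamma> v u)"
  proof -
    have "linear (\<lambda>v. I (\<Gamma> v u))" using linear_compose[OF linear_left linear_I] by (simp add: o_def)
    from trace_lin_commute[OF this linear_I] show ?thesis by (simp add: I_I trace_lin_minus)
  qed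
  ultimately have "trace_lin (\<lambda>v. \<Gamma> v u) = 0" using * by simp
  then show ?thesis using trace_bracket[of u] unfolding bracket_def trace_lin_diff by simp
qed

text \<open>The first two terms form a commutator of endomorphisms, and the last one is trace-free
  by \<open>trace_conn\<close>.\<close>

lemma trace_curv: "trace_lin (curv u v) = 0"
  unfolding curv_def trace_lin_diff trace_conn using trace_lin_commute[OF linear_right linear_right] by simp

lemma bianchi: "curv u v w + curv v w u + curv w u v = 0"
  using jacobi[of u v w] by (simp add: curv_def bracket_def conn_simps algebra_simps)

text \<open>The Bianchi identity makes the skew part of the Ricci form a trace of the curvature, and the
  symmetric part changes sign under each of the three complex structures.\<close>

lemma ricci_form_zero: "trace_lin (\<lambda>z. curv z x y) = 0"
proof -
  define r where "r = (\<lambda>x y. trace_lin (\<lambda>z. curv z x y))"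
  have swap: "curv z x y = curv z y x - curv x y z" for x y z
    using bianchi[of z x y] by (simp add: curv_def bracket_def conn_simps algebra_simps)
  have sym: "r x y = r y x" for x y
    unfolding r_def by (subst swap) (simp add: trace_lin_diff trace_curv)
  \<comment> \<open>Stated for a parallel complex structure \<open>S\<close> with an anticommuting
    parallel partner \<open>T\<close>, so that it covers \<open>I\<close>, \<open>J\<close> and
    their composition. The partner makes \<open>S\<close> composed with the curvature
    trace-free.\<close>
  have main: "r (S x) (S y) = - r y x"
    if S: "linear S" "\<And>v. S (S v) = - v" "linear T" "\<And>v. T (T v) = - v" "\<And>v. T (S v) = - S (T v)"
      and nS: "\<And>u v. \<Gamma> u (S v) = S (\<Gamma> u v)" and nT: "\<And>u v. \<Gamma> u (T v) = T (\<Gamma> u v)" for S T x y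
  proof -
    have cS: "curv u v (S w) = S (curv u v w)" for u v w
      by (simp add: curv_def nS linear_diff[OF S(1)])
    have cT: "curv u v (T w) = T (curv u v w)" for u v w
      by (simp add: curv_def nT linear_diff[OF S(3)])
    have tS: "trace_lin (\<lambda>z. S (curv x y z)) = 0" for x y
    proof -
      have lf: "linear (\<lambda>z. S (curv x y z))"
        unfolding linear_iff
        by (simp add: curv_def conn_simps linear_add[OF S(1)] linear_diff[OF S(1)] linear_cmul[OF S(1)] algebra_simps)
      have lT: "linear (\<lambda>v. - T v)" using S(3) by (rule linear_compose_neg)
      have "trace_lin (\<lambda>v. T (S (curv x y (- T v)))) = trace_lin (\<lambda>z. S (curv x y z))"
        by (rule trace_lin_conjugate[OF S(3) lT lf]) (simp add: S(4))
      moreover have "T (S (curv x y (- T v))) = - S (curv x y v)" for v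
      proof -
        have "curv x y (- T v) = - T (curv x y v)"
          unfolding cT[of x y v, symmetric] by (simp add: curv_def conn_simps algebra_simps)
        then show ?thesis by (simp add: S linear_neg[OF S(1)] linear_neg[OF S(3)])
      qed
      ultimately show ?thesis by (simp add: trace_lin_minus)
    qed
    \<comment> \<open>\<open>S\<close> passes out of the curvature, the Bianchi identity exchanges
      \<open>x\<close> and \<open>y\<close>, and the remaining term is trace-free by
      \<open>tS\<close>.\<close>
    have 1: "r x (S y) = r y (S x)" for x y
      unfolding r_def cS by (subst swap[of _ x y]) (simp add: linear_diff[OF S(1)] trace_lin_diff tS)
    have "r (S x) (S y) = r y (S (S x))" by (rule 1)
    also have "\<dots> = - r y x"
      unfolding r_def S(2) by (simp add: curv_def conn_simps flip: trace_lin_minus) (simp add: algebra_simps)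
    finally show ?thesis .
  qed
  have I: "r (I x) (I y) = - r y x" for x y
    by (rule main[OF linear_I I_I linear_J J_J]) (simp_all add: conn_simps)
  have J: "r (J x) (J y) = - r y x" for x y
    by (rule main[OF linear_J J_J linear_I I_I]) (simp_all add: conn_simps)
  have K: "r (I (J x)) (I (J y)) = - r y x" for x y
    by (rule main[OF _ _ linear_I I_I])
      (simp_all add: conn_simps linear_compose[OF linear_J linear_I, unfolded o_def])
  \<comment> \<open>Two sign-reversing exchanges, for \<open>J\<close> and for \<open>I\<close>,
    restore \<open>r x y\<close>, whereas the single exchange for the composition gives
    \<open>- r y x\<close>.\<close>
  have "r x y = - r y x" using I[of "J x" "J y"] J[of y x] K[of x y] by simp
  then show ?thesis using sym[of x y] by (simp add: r_def)
qed

end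


section \<open>Connections on a manifold with an atlas\<close>

context
  fixes T :: "'a topology" and c :: "('a, 'e::euclidean_space) chart"
  assumes c: "chart_on T c"
begin

lemma chart_homeomorphic_map:
  "homeomorphic_map (subtopology T (cdom c)) (top_of_set (crd c ` cdom c)) (crd c)"
  using c by (simp add: chart_on_def)

lemma openin_cdom: "openin T (cdom c)"
  using c by (simp add: chart_on_def)

lemma inj_on_crd: "inj_on (crd c) (cdom c)"
  using homeomorphic_imp_injective_map[OF chart_homeomorphic_map] openin_subset[OF openin_cdom]
  by (simp add: Int_absorb1)

lemma crd_inv_crd: "p \<in> cdom c \<Longrightarrow> crd_inv c (crd c p) = p"
  by (simp add: crd_inv_def inj_on_crd)

lemma crd_crd_inv: "x \<in> crd c ` cdom c \<Longrightarrow> crd c (crd_inv c x) = x"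
  by (simp add: crd_inv_def f_inv_into_f)

lemma crd_inv_in_cdom: "x \<in> crd c ` cdom c \<Longrightarrow> crd_inv c x \<in> cdom c"
  by (simp add: crd_inv_def inv_into_into)

lemma open_crd_image:
  assumes "openin T U" "U \<subseteq> cdom c"
  shows "open (crd c ` U)"
proof -
  have "openin (subtopology T (cdom c)) U"
    using assms by (simp add: openin_subtopology_alt) blast
  then have "openin (top_of_set (crd c ` cdom c)) (crd c ` U)"
    using chart_homeomorphic_map homeomorphic_imp_open_map open_map_def by metis
  moreover have "open (crd c ` cdom c)" using c by (simp add: chart_on_def)
  ultimately show ?thesis using openin_open_eq by blast
qed

lemma open_crd_cdom: "open (crd c ` cdom c)"
  using open_crd_image openin_cdom by blast

lemma crd_inv_preimage: "{x \<in> crd c ` cdom c. crd_inv c x \<in> U} = crd c ` (cdom c \<inter> U)"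
  by (auto simp: crd_inv_crd)

lemma open_crd_inv_preimage: "openin T U \<Longrightarrow> open {x \<in> crd c ` cdom c. crd_inv c x \<in> U}"
  unfolding crd_inv_preimage using openin_cdom by (intro open_crd_image) auto

text \<open>Identities between group elements that hold near \<open>p\<close> are transferred in
  this way to derivatives of coordinate expressions.\<close>

lemma has_derivative_crd_inv_cong:
  fixes F :: "'a \<Rightarrow> 'f::real_normed_vector"
  assumes "openin T U" "p \<in> U" "p \<in> cdom c" "\<And>q. q \<in> U \<Longrightarrow> q \<in> cdom c \<Longrightarrow> F q = F' q"
    "((F \<circ> crd_inv c) has_derivative A) (at (crd c p))"
  shows "((F' \<circ> crd_inv c) has_derivative A) (at (crd c p))"
  by (rule has_derivative_transform_within_open[OF assms(5) open_crd_inv_preimage[OF assms(1)]])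
    (use assms in \<open>auto simp: crd_inv_crd\<close>)

lemma has_derivative_crd: "p \<in> cdom c \<Longrightarrow> ((crd c \<circ> crd_inv c) has_derivative (\<lambda>u. u)) (at (crd c p))"
  by (rule has_derivative_transform_within_open[OF has_derivative_ident open_crd_cdom])
    (auto simp: crd_crd_inv)

end

text \<open>The coordinates of the middle chart cancel only where \<open>F\<close> takes values in
  the domain of \<open>d\<close>. The open set \<open>U\<close>, usually a preimage under a
  continuous map, provides a neighbourhood of \<open>p\<close> on which it does.\<close>

lemma has_derivative_chart_compose:
  fixes c :: "('a, 'e::euclidean_space) chart" and d :: "('b, 'f::euclidean_space) chart"
    and G :: "'b \<Rightarrow> 'g::real_normed_vector"
  assumes c: "chart_on T c" and d: "chart_on T' d" and p: "p \<in> cdom c"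
    and U: "openin T U" "p \<in> U" "\<And>q. q \<in> U \<Longrightarrow> q \<in> cdom c \<Longrightarrow> F q \<in> cdom d"
    and A: "((crd d \<circ> F \<circ> crd_inv c) has_derivative A) (at (crd c p))"
    and B: "((G \<circ> crd_inv d) has_derivative B) (at (crd d (F p)))"
  shows "((G \<circ> F \<circ> crd_inv c) has_derivative (\<lambda>u. B (A u))) (at (crd c p))"
proof -
  have "(crd d \<circ> F \<circ> crd_inv c) (crd c p) = crd d (F p)"
    by (simp add: crd_inv_crd[OF c p])
  then have *: "((G \<circ> crd_inv d) \<circ> (crd d \<circ> F \<circ> crd_inv c) has_derivative B \<circ> A) (at (crd c p))"
    using diff_chain_at[OF A] B by simp
  have eq: "((G \<circ> crd_inv d) \<circ> (crd d \<circ> F)) q = (G \<circ> F) q" if "q \<in> U" "q \<in> cdom c" for q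
    using crd_inv_crd[OF d U(3)[OF that]] by simp
  show ?thesis
    using has_derivative_crd_inv_cong[where A = "B \<circ> A", OF c U(1,2) p eq] * by (simp add: o_assoc o_def)
qed

text \<open>Everything is phrased in terms of charts, so that both the group and its quotient can
  interpret this locale.\<close>

locale atlas_manifold =
  fixes M :: "('a, 'e::euclidean_space) manifold"
  assumes chart: "c \<in> atlas M \<Longrightarrow> chart_on (mtop M) c"
    and cover: "points M = (\<Union>c\<in>atlas M. cdom c)"
    and smooth_transition:
      "c \<in> atlas M \<Longrightarrow> d \<in> atlas M \<Longrightarrow> smooth_on (crd c ` (cdom c \<inter> cdom d)) (transition c d)"
begin

lemma chart_at: 
  assumes "p \<in> points M"
  shows "chart_at M p \<in> atlas M" "p \<in> cdom (chart_at M p)"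
proof -
  have "\<exists>c. c \<in> atlas M \<and> p \<in> cdom c" using assms cover by blast
  from someI_ex[OF this] show "chart_at M p \<in> atlas M" "p \<in> cdom (chart_at M p)"
    by (simp_all add: chart_at_def)
qed

lemma in_points: "c \<in> atlas M \<Longrightarrow> p \<in> cdom c \<Longrightarrow> p \<in> points M"
  using cover by blast

lemma has_derivative_transition:
  assumes "c \<in> atlas M" "d \<in> atlas M" "p \<in> cdom c" "p \<in> cdom d"
  shows "(transition c d has_derivative frechet_derivative (transition c d) (at (crd c p))) (at (crd c p))"
  using smooth_on_has_derivative[OF smooth_transition[OF assms(1,2)]] assms by blast

lemma linear_transition:
  assumes "c \<in> atlas M" "d \<in> atlas M" "p \<in> cdom c" "p \<in> cdom d"
  shows "linear (frechet_derivative (transition c d) (at (crd c p)))"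
  using has_derivative_transition[OF assms] has_derivative_linear by blast

lemma has_derivative_change_chart:
  fixes G :: "'a \<Rightarrow> 'g::real_normed_vector"
  assumes "c \<in> atlas M" "d \<in> atlas M" "p \<in> cdom c" "p \<in> cdom d"
    and "((G \<circ> crd_inv d) has_derivative B) (at (crd d p))"
  shows "((G \<circ> crd_inv c) has_derivative
           (\<lambda>u. B (frechet_derivative (transition c d) (at (crd c p)) u))) (at (crd c p))"
  using has_derivative_chart_compose[OF chart[OF assms(1)] chart[OF assms(2)] assms(3)
      openin_cdom[OF chart[OF assms(2)]], of "\<lambda>q. q" _ G B] has_derivative_transition[OF assms(1-4)] assms(4,5)
  by (simp add: transition_def o_def)

lemma tangent_space_transition:
  "\<lbrakk>v \<in> tangent_space M p; c \<in> atlas M; d \<in> atlas M; p \<in> cdom c; p \<in> cdom d\<rbrakk> \<Longrightarrow>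
   v d = frechet_derivative (transition c d) (at (crd c p)) (v c)"
  unfolding tangent_space_def by blast

lemma tangent_space_eq_0:
  "v \<in> tangent_space M p \<Longrightarrow> \<not> (c \<in> atlas M \<and> p \<in> cdom c) \<Longrightarrow> v c = 0"
  unfolding tangent_space_def by blast

lemma tangent_space_eqI:
  assumes "v \<in> tangent_space M p" "w \<in> tangent_space M p" "c \<in> atlas M" "p \<in> cdom c" "v c = w c"
  shows "v = w"
proof
  fix d
  show "v d = w d"
    using tangent_space_transition[OF assms(1,3) _ assms(4), of d]
      tangent_space_transition[OF assms(2,3) _ assms(4), of d] assms(5)
      tangent_space_eq_0[OF assms(1)] tangent_space_eq_0[OF assms(2)] by metis
qed

lemma tangent_space_add: 
  "v \<in> tangent_space M p \<Longrightarrow> w \<in> tangent_space M p \<Longrightarrow> (\<lambda>c. v c + w c) \<in> tangent_space M p"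
  unfolding tangent_space_def mem_Collect_eq using linear_add[OF linear_transition, of _ _ p] by (metis add.right_neutral)

lemma tangent_space_scaleR: 
  "v \<in> tangent_space M p \<Longrightarrow> (\<lambda>c. a *\<^sub>R v c) \<in> tangent_space M p"
  unfolding tangent_space_def mem_Collect_eq using linear_cmul[OF linear_transition, of _ _ p] by (metis scaleR_zero_right)

lemma tvec_of_tangent_space:
  assumes "c \<in> atlas M" "p \<in> cdom c"
  shows "tvec_of M p c u \<in> tangent_space M p" "tvec_of M p c u c = u"
proof -
  have "frechet_derivative (transition c e) (at (crd c p)) u =
      frechet_derivative (transition d e) (at (crd d p)) (frechet_derivative (transition c d) (at (crd c p)) u)"
    if "d \<in> atlas M" "e \<in> atlas M" "p \<in> cdom d" "p \<in> cdom e" for d e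
  proof -
    have "((crd e \<circ> crd_inv d) has_derivative frechet_derivative (transition d e) (at (crd d p))) (at (crd d p))"
      using has_derivative_transition[OF that] unfolding transition_def .
    from fun_cong[OF frechet_derivative_at[OF has_derivative_change_chart[OF assms(1) that(1) assms(2) that(3) this]], of u]
    show ?thesis unfolding transition_def by (rule sym)
  qed
  note * = this
  show "tvec_of M p c u \<in> tangent_space M p"
    unfolding tangent_space_def tvec_of_def mem_Collect_eq
    by (intro conjI ballI impI allI) (auto simp: *[symmetric])
  show "tvec_of M p c u c = u"
    using fun_cong[OF frechet_derivative_at[OF has_derivative_crd[OF chart[OF assms(1)] assms(2)]], of u] assms
    by (simp add: tvec_of_def transition_def)
qed

lemma tvec_of_component:
  assumes "c \<in> atlas M" "p \<in> cdom c" "v \<in> tangent_space M p"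
  shows "tvec_of M p c (v c) = v"
  by (rule tangent_space_eqI[OF tvec_of_tangent_space(1)[OF assms(1,2)] assms(3,1,2)])
    (rule tvec_of_tangent_space(2)[OF assms(1,2)])

lemma vfieldsI:
  "(\<And>p. X p \<in> tangent_space M p) \<Longrightarrow>
   (\<And>c. c \<in> atlas M \<Longrightarrow> smooth_on (crd c ` cdom c) (\<lambda>x. X (crd_inv c x) c)) \<Longrightarrow> X \<in> vfields M"
  by (simp add: vfields_def)

lemma vfields_tangent: "X \<in> vfields M \<Longrightarrow> X p \<in> tangent_space M p"
  by (simp add: vfields_def)

lemma vfields_smooth:
  "X \<in> vfields M \<Longrightarrow> c \<in> atlas M \<Longrightarrow> smooth_on (crd c ` cdom c) (\<lambda>x. X (crd_inv c x) c)"
  by (simp add: vfields_def)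

lemma smooth_fun_chart:
  "smooth_fun M f \<Longrightarrow> c \<in> atlas M \<Longrightarrow> smooth_on (crd c ` cdom c) (\<lambda>x. f (crd_inv c x))"
  by (simp add: smooth_fun_def o_def)

lemma smooth_fun_const: "smooth_fun M (\<lambda>_. a)"
  by (simp add: smooth_fun_def o_def smooth_on_const)

lemma vf_add_vfields:
  assumes "X \<in> vfields M" "Y \<in> vfields M"
  shows "vf_add X Y \<in> vfields M"
proof (rule vfieldsI)
  show "vf_add X Y p \<in> tangent_space M p" for p
    using tangent_space_add assms[THEN vfields_tangent] by (simp add: vf_add_def)
  show "smooth_on (crd c ` cdom c) (\<lambda>x. vf_add X Y (crd_inv c x) c)" if c: "c \<in> atlas M" for c
    using smooth_on_add[OF open_crd_cdom[OF chart[OF c]] assms[THEN vfields_smooth, OF c]]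
    by (simp add: vf_add_def)
qed

lemma vf_scale_vfields:
  assumes "smooth_fun M f" "X \<in> vfields M"
  shows "vf_scale f X \<in> vfields M"
proof (rule vfieldsI)
  show "vf_scale f X p \<in> tangent_space M p" for p
    using tangent_space_scaleR vfields_tangent[OF assms(2)] by (simp add: vf_scale_def)
  show "smooth_on (crd c ` cdom c) (\<lambda>x. vf_scale f X (crd_inv c x) c)" if c: "c \<in> atlas M" for c
    using smooth_on_scaleR[OF open_crd_cdom[OF chart[OF c]] smooth_fun_chart[OF assms(1) c] vfields_smooth[OF assms(2) c]]
    by (simp add: vf_scale_def)
qed

lemma vf_diff_eq: "vf_diff X Y = vf_add X (vf_scale (\<lambda>_. -1) Y)"
  by (simp add: vf_diff_def vf_add_def vf_scale_def)

lemma vf_diff_vfields: "X \<in> vfields M \<Longrightarrow> Y \<in> vfields M \<Longrightarrow> vf_diff X Y \<in> vfields M"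
  unfolding vf_diff_eq by (intro vf_add_vfields vf_scale_vfields smooth_fun_const)

text \<open>\<open>vf_deriv\<close> takes its own chosen chart at each point; smoothness and
  iterated derivatives require one chart for a whole neighbourhood.\<close>

lemma vf_deriv_chart:
  assumes "X \<in> vfields M" "smooth_fun M f" "c \<in> atlas M" "p \<in> cdom c"
  shows "vf_deriv M X f p = frechet_derivative (\<lambda>x. f (crd_inv c x)) (at (crd c p)) (X p c)"
proof -
  note p = in_points[OF assms(3,4)]
  have "((f \<circ> crd_inv c) has_derivative frechet_derivative (\<lambda>x. f (crd_inv c x)) (at (crd c p))) (at (crd c p))"
    using smooth_on_has_derivative[OF smooth_fun_chart[OF assms(2,3)]] assms(4) by (simp add: o_def)
  from frechet_derivative_at[OF has_derivative_change_chart[OF chart_at(1)[OF p] assms(3) chart_at(2)[OF p] assms(4) this]]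
  show ?thesis
    using tangent_space_transition[OF vfields_tangent[OF assms(1)] chart_at(1)[OF p] assms(3) chart_at(2)[OF p] assms(4)]
    by (simp add: vf_deriv_def Let_def fun_eq_iff)
qed

lemma vf_deriv_smooth:
  assumes "X \<in> vfields M" "smooth_fun M f"
  shows "smooth_fun M (vf_deriv M X f)"
  unfolding smooth_fun_def
proof
  fix c assume c: "c \<in> atlas M"
  note oc = open_crd_cdom[OF chart[OF c]]
  show "smooth_on (crd c ` cdom c) (vf_deriv M X f \<circ> crd_inv c)"
    by (rule smooth_on_cong[OF oc _ smooth_on_derivative_along[OF oc smooth_fun_chart[OF assms(2) c] vfields_smooth[OF assms(1) c]]])
      (simp add: vf_deriv_chart[OF assms c crd_inv_in_cdom[OF chart[OF c]]] crd_crd_inv[OF chart[OF c]])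
qed

lemma vf_deriv_diff:
  assumes "X \<in> vfields M" "Y \<in> vfields M" "smooth_fun M f" "p \<in> points M"
  shows "vf_deriv M (vf_diff X Y) f p = vf_deriv M X f p - vf_deriv M Y f p"
proof -
  note c = chart_at[OF assms(4)]
  have "linear (frechet_derivative (\<lambda>x. f (crd_inv (chart_at M p) x)) (at (crd (chart_at M p) p)))"
    using smooth_on_differentiable[OF smooth_fun_chart[OF assms(3) c(1)]] c(2) linear_frechet_derivative by blast
  from linear_diff[OF this] show ?thesis
    using vf_deriv_chart[OF _ assms(3) c] vf_diff_vfields[OF assms(1,2)] assms(1,2) by (simp add: vf_diff_def)
qed

lemma vf_deriv_commutator:
  assumes "X \<in> vfields M" "Y \<in> vfields M" "smooth_fun M f" "p \<in> points M"
  shows "vf_deriv M X (vf_deriv M Y f) p - vf_deriv M Y (vf_deriv M X f) p = vf_deriv M (lie_bracket M X Y) f p"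
proof -
  define c where "c = chart_at M p"
  have c: "c \<in> atlas M" "p \<in> cdom c" using chart_at[OF assms(4)] by (simp_all add: c_def)
  note oc = open_crd_cdom[OF chart[OF c(1)]]
  have pc: "crd c p \<in> crd c ` cdom c" using c by blast
  have *: "vf_deriv M X (vf_deriv M Y f) p = frechet_derivative
      (\<lambda>x. frechet_derivative (\<lambda>x. f (crd_inv c x)) (at x) (Y (crd_inv c x) c)) (at (crd c p)) (X p c)"
    if "X \<in> vfields M" "Y \<in> vfields M" for X Y
  proof -
    have "frechet_derivative (\<lambda>x. vf_deriv M Y f (crd_inv c x)) (at (crd c p)) =
      frechet_derivative
      (\<lambda>x. frechet_derivative (\<lambda>x. f (crd_inv c x)) (at x) (Y (crd_inv c x) c)) (at (crd c p))"
      by (rule frechet_derivative_transform_within_open[OF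
          smooth_on_differentiable[OF smooth_fun_chart[OF vf_deriv_smooth[OF that(2) assms(3)] c(1)] pc] oc pc])
       (simp add: vf_deriv_chart[OF that(2) assms(3) c(1) crd_inv_in_cdom[OF chart[OF c(1)]]] crd_crd_inv[OF chart[OF c(1)]])
    then show ?thesis
      by (simp add: vf_deriv_chart[OF that(1) vf_deriv_smooth[OF that(2) assms(3)] c])
  qed
  have deriv_c: "vf_deriv M Z f p = frechet_derivative (\<lambda>x. f (crd_inv c x)) (at (crd c p)) (Z p c)" for Z
    by (simp add: vf_deriv_def c_def Let_def o_def)
  have "lie_bracket M X Y p c = frechet_derivative (\<lambda>x. Y (crd_inv c x) c) (at (crd c p)) (X p c)
        - frechet_derivative (\<lambda>x. X (crd_inv c x) c) (at (crd c p)) (Y p c)"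
    using c by (simp add: lie_bracket_def)
  then show ?thesis
    using derivative_along_commutator[OF oc pc smooth_fun_chart[OF assms(3) c(1)] vfields_smooth[OF assms(1) c(1)]
      vfields_smooth[OF assms(2) c(1)]]
    by (simp only: *[OF assms(1,2)] *[OF assms(2,1)] crd_inv_crd[OF chart[OF c(1)] c(2)]
        deriv_c[of "lie_bracket M X Y"])
qed

end

section \<open>The curvature of a torsion-free connection as a tensor\<close>

locale torsion_free_connection = atlas_manifold M for M :: "('a, 'e::euclidean_space) manifold" +
  fixes D :: "('a, 'e) conn"
  assumes affine: "affine_connection M D" and torsion: "torsion_free M D"
begin

lemma D_vfields [simp]: "X \<in> vfields M \<Longrightarrow> Y \<in> vfields M \<Longrightarrow> D X Y \<in> vfields M"
  using affine by (simp add: affine_connection_def)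

lemma D_add_left [simp]:
  "X \<in> vfields M \<Longrightarrow> X' \<in> vfields M \<Longrightarrow> Y \<in> vfields M \<Longrightarrow> D (vf_add X X') Y = vf_add (D X Y) (D X' Y)"
  using affine by (simp add: affine_connection_def)

lemma D_add_right [simp]:
  "X \<in> vfields M \<Longrightarrow> X' \<in> vfields M \<Longrightarrow> Y \<in> vfields M \<Longrightarrow> D Y (vf_add X X') = vf_add (D Y X) (D Y X')"
  using affine by (simp add: affine_connection_def)

lemma D_scale_left [simp]:
  "smooth_fun M f \<Longrightarrow> X \<in> vfields M \<Longrightarrow> Y \<in> vfields M \<Longrightarrow> D (vf_scale f X) Y = vf_scale f (D X Y)"
  using affine unfolding affine_connection_def by blast

lemma D_scale_right [simp]:
  "smooth_fun M f \<Longrightarrow> X \<in> vfields M \<Longrightarrow> Y \<in> vfields M \<Longrightarrow>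
   D X (vf_scale f Y) = vf_add (vf_scale (vf_deriv M X f) Y) (vf_scale f (D X Y))"
  using affine unfolding affine_connection_def by blast

lemmas [simp] = vf_add_vfields vf_scale_vfields vf_diff_vfields vf_deriv_smooth smooth_fun_const

lemma D_diff_left [simp]:
  "X \<in> vfields M \<Longrightarrow> X' \<in> vfields M \<Longrightarrow> Y \<in> vfields M \<Longrightarrow> D (vf_diff X X') Y = vf_diff (D X Y) (D X' Y)"
  by (simp add: vf_diff_eq)

lemma lie_bracket_eq: "X \<in> vfields M \<Longrightarrow> Y \<in> vfields M \<Longrightarrow> lie_bracket M X Y = vf_diff (D X Y) (D Y X)"
  using torsion by (simp add: torsion_free_def)

text \<open>Torsion-freeness trades the bracket for \<open>D X Y - D Y X\<close>; tensoriality in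
  the first two arguments then follows from the rules for \<open>D\<close>, without a Leibniz rule
  for \<open>lie_bracket\<close>.\<close>

lemma curvature_eq:
  assumes "X \<in> vfields M" "Y \<in> vfields M" "Z \<in> vfields M"
  shows "curvature M D X Y Z =
    vf_diff (vf_diff (D X (D Y Z)) (D Y (D X Z))) (vf_diff (D (D X Y) Z) (D (D Y X) Z))"
  using assms by (simp add: curvature_def lie_bracket_eq)

lemma curvature_swap:
  assumes "X \<in> vfields M" "Y \<in> vfields M" "Z \<in> vfields M"
  shows "curvature M D X Y Z = vf_scale (\<lambda>_. -1) (curvature M D Y X Z)"
  using assms by (simp add: curvature_eq vf_diff_def vf_scale_def fun_eq_iff)

lemma curvature_add:
  assumes "X \<in> vfields M" "X' \<in> vfields M" "Y \<in> vfields M" "Z \<in> vfields M"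
  shows "curvature M D (vf_add X X') Y Z = vf_add (curvature M D X Y Z) (curvature M D X' Y Z)"
    and "curvature M D Y (vf_add X X') Z = vf_add (curvature M D Y X Z) (curvature M D Y X' Z)"
    and "curvature M D Y Z (vf_add X X') = vf_add (curvature M D Y Z X) (curvature M D Y Z X')"
  using assms by (simp_all add: curvature_eq) (simp_all add: vf_diff_def vf_add_def fun_eq_iff)

lemma curvature_scale_left:
  assumes "smooth_fun M f" "X \<in> vfields M" "Y \<in> vfields M" "Z \<in> vfields M"
  shows "curvature M D (vf_scale f X) Y Z = vf_scale f (curvature M D X Y Z)"
  using assms
  by (simp add: curvature_eq vf_diff_def fun_eq_iff)
    (simp add: vf_add_def vf_scale_def algebra_simps)

lemma curvature_scale_middle:
  assumes "smooth_fun M f" "X \<in> vfields M" "Y \<in> vfields M" "Z \<in> vfields M"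
  shows "curvature M D Y (vf_scale f X) Z = vf_scale f (curvature M D Y X Z)"
  using assms curvature_swap[of Y "vf_scale f X" Z] curvature_swap[of Y X Z]
  by (simp add: curvature_scale_left) (simp add: vf_scale_def)

text \<open>Second derivatives of \<open>f\<close> occur only in the combination
  \<open>X (Y f) - Y (X f)\<close>, which is the derivative along \<open>[X, Y]\<close> and cancels
  against the last term of the curvature.\<close>

lemma curvature_scale_right:
  assumes "smooth_fun M f" "X \<in> vfields M" "Y \<in> vfields M" "Z \<in> vfields M"
  shows "curvature M D X Y (vf_scale f Z) = vf_scale f (curvature M D X Y Z)"
proof (intro ext)
  fix p c
  show "curvature M D X Y (vf_scale f Z) p c = vf_scale f (curvature M D X Y Z) p c"
  proof (cases "p \<in> points M")
    case True
    have "vf_deriv M X (vf_deriv M Y f) p - vf_deriv M Y (vf_deriv M X f) p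
        = vf_deriv M (D X Y) f p - vf_deriv M (D Y X) f p"
      using vf_deriv_commutator[OF assms(2,3,1) True] vf_deriv_diff[OF _ _ assms(1) True] assms
      by (simp add: lie_bracket_eq)
    then have "vf_deriv M X (vf_deriv M Y f) p *\<^sub>R Z p c - vf_deriv M Y (vf_deriv M X f) p *\<^sub>R Z p c
        = vf_deriv M (D X Y) f p *\<^sub>R Z p c - vf_deriv M (D Y X) f p *\<^sub>R Z p c"
      unfolding scaleR_diff_left[symmetric] by simp
    then show ?thesis
      using assms by (simp add: curvature_eq vf_diff_def) (simp add: vf_add_def vf_scale_def algebra_simps)
  next
    case False
    \<comment> \<open>Off the manifold the values of \<open>vf_deriv\<close> are meaningless, but
      those that do not cancel multiply \<open>Z\<close>, which vanishes there.\<close>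
    then have "Z p c = 0"
      using tangent_space_eq_0[OF vfields_tangent[OF assms(4)]] in_points by blast
    then show ?thesis
      using assms by (simp add: curvature_eq) (simp add: vf_add_def vf_scale_def vf_diff_def algebra_simps)
  qed
qed

end


section \<open>Frames with constant structure\<close>

text \<open>The model space \<open>'e\<close> doubles as the Lie algebra, and \<open>E v\<close> is
  the field with constant coefficients \<open>v\<close>. By equality of dimensions, injectivity at
  each point makes these fields a frame.\<close>

locale frame_manifold = atlas_manifold M for M :: "('a, 'e::euclidean_space) manifold" +
  fixes E :: "'e \<Rightarrow> ('a, 'e) vfield" and br :: "'e \<Rightarrow> 'e \<Rightarrow> 'e"
  assumes frame_vfields [simp]: "E v \<in> vfields M"
    and frame_linear: "linear (\<lambda>v. E v p c)"
    and frame_inj: "c \<in> atlas M \<Longrightarrow> p \<in> cdom c \<Longrightarrow> inj (\<lambda>v. E v p c)"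
    and frame_bracket: "lie_bracket M (E u) (E v) = E (br u v)"
begin

lemma frame_eqD: 
  assumes "p \<in> points M" "E u p = E v p"
  shows "u = v"
  using injD[OF frame_inj[OF chart_at[OF assms(1)]], of u v] assms(2) by simp

lemma frame_surj:
  assumes "p \<in> points M" "w \<in> tangent_space M p"
  obtains v where "w = E v p"
proof -
  note c = chart_at[OF assms(1)]
  have "surj (\<lambda>v. E v p (chart_at M p))"
    using linear_injective_imp_surjective[OF frame_linear frame_inj[OF c]] by blast
  from surjD[OF this, of "w (chart_at M p)"]
  obtain v where "w (chart_at M p) = E v p (chart_at M p)" by blast
  then have "w = E v p"
    by (intro tangent_space_eqI[OF assms(2) vfields_tangent[OF frame_vfields] c])
  then show thesis by (rule that)
qed

lemma frame_outside: "p \<notin> points M \<Longrightarrow> X \<in> vfields M \<Longrightarrow> X p c = 0"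
  using tangent_space_eq_0[OF vfields_tangent] in_points by blast

definition coef :: "('a, 'e) vfield \<Rightarrow> 'a \<Rightarrow> 'e" where
  "coef X p = (SOME v. X p = E v p)"

lemma frame_coef:
  assumes "X \<in> vfields M" "p \<in> points M"
  shows "E (coef X p) p = X p"
  unfolding coef_def using frame_surj[OF assms(2) vfields_tangent[OF assms(1)]] by (metis (mono_tags, lifting) someI)

text \<open>In each chart the coefficients solve the linear system whose operators are given by the
  frame and whose right-hand side is \<open>X\<close>.\<close>

lemma smooth_fun_coef:
  assumes "X \<in> vfields M"
  shows "smooth_fun M (\<lambda>p. coef X p \<bullet> b)"
  unfolding smooth_fun_def o_def
proof
  fix c assume c: "c \<in> atlas M"
  note cc = chart[OF c]
  have "smooth_on (crd c ` cdom c) (\<lambda>x. coef X (crd_inv c x))"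
  proof (rule smooth_on_linear_system_solution[OF open_crd_cdom[OF cc], of "\<lambda>x v. E v (crd_inv c x) c"
        "\<lambda>x. X (crd_inv c x) c"])
    fix x assume "x \<in> crd c ` cdom c"
    then have x: "crd_inv c x \<in> cdom c" by (rule crd_inv_in_cdom[OF cc])
    show "linear (\<lambda>v. E v (crd_inv c x) c)" by (rule frame_linear)
    show "inj (\<lambda>v. E v (crd_inv c x) c)" by (rule frame_inj[OF c x])
    show "E (coef X (crd_inv c x)) (crd_inv c x) c = X (crd_inv c x) c"
      by (simp add: frame_coef[OF assms in_points[OF c x]])
  qed (rule vfields_smooth[OF frame_vfields c] vfields_smooth[OF assms c])+
  then show "smooth_on (crd c ` cdom c) (\<lambda>x. coef X (crd_inv c x) \<bullet> b)"
    using smooth_on_bounded_linear[OF open_crd_cdom[OF cc] bounded_linear_inner_left] by blast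
qed

text \<open>Membership in \<open>vfields\<close> is carried along because additivity of
  \<open>T\<close> requires it. The coefficients are left general: \<open>tensor_frame\<close> takes
  smooth functions in one place and constants in another.\<close>

lemma tensor_sum_frame:
  assumes add: "\<And>X Y. X \<in> vfields M \<Longrightarrow> Y \<in> vfields M \<Longrightarrow> T (vf_add X Y) = vf_add (T X) (T Y)"
    and scale: "\<And>f X. smooth_fun M f \<Longrightarrow> X \<in> vfields M \<Longrightarrow> T (vf_scale f X) = vf_scale f (T X)"
    and f: "\<And>b. smooth_fun M (f b)" and "finite A"
  shows "(\<lambda>q c. \<Sum>b\<in>A. f b q *\<^sub>R E b q c) \<in> vfields M \<and>
    T (\<lambda>q c. \<Sum>b\<in>A. f b q *\<^sub>R E b q c) p c = (\<Sum>b\<in>A. f b p *\<^sub>R T (E b) p c)"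
  using \<open>finite A\<close>
proof (induction A)
  case empty
  \<comment> \<open>That \<open>T\<close> preserves the zero field is obtained by scaling with the
    constant function 0.\<close>
  have "vf_scale (\<lambda>_. 0) (E 0) = (\<lambda>q c. 0)" by (simp add: vf_scale_def)
  then show ?case
    using scale[OF smooth_fun_const[of 0] frame_vfields[of 0]] vf_scale_vfields[OF smooth_fun_const[of 0] frame_vfields[of 0]]
    by (simp add: vf_scale_def)
next
  case (insert a A)
  let ?S = "\<lambda>A q c. \<Sum>b\<in>A. f b q *\<^sub>R E b q c"
  have "?S (insert a A) = vf_add (vf_scale (f a) (E a)) (?S A)"
    using insert.hyps by (simp add: vf_add_def vf_scale_def)
  moreover have "vf_scale (f a) (E a) \<in> vfields M" by (simp add: vf_scale_vfields f)
  ultimately show ?case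
    using insert add[of "vf_scale (f a) (E a)" "?S A"] vf_add_vfields[of "vf_scale (f a) (E a)" "?S A"]
    by (simp add: scale f) (simp add: vf_add_def vf_scale_def)
qed

text \<open>Here the frame replaces cutoff functions: \<open>X\<close> is expanded with function
  coefficients, these come out of \<open>T\<close> and are evaluated at \<open>p\<close>, and the
  resulting constants reassemble to a frame field.\<close>

lemma tensor_frame:
  assumes add: "\<And>X Y. X \<in> vfields M \<Longrightarrow> Y \<in> vfields M \<Longrightarrow> T (vf_add X Y) = vf_add (T X) (T Y)"
    and scale: "\<And>f X. smooth_fun M f \<Longrightarrow> X \<in> vfields M \<Longrightarrow> T (vf_scale f X) = vf_scale f (T X)"
    and X: "X \<in> vfields M" and p: "p \<in> points M"
  shows "T X p c = T (E (coef X p)) p c"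
proof -
  have rep: "E v q c = (\<Sum>b\<in>Basis. (v \<bullet> b) *\<^sub>R E b q c)" for v q c
    by (rule linear_expand_Basis[OF frame_linear])
  have "X = (\<lambda>q c. \<Sum>b\<in>Basis. (coef X q \<bullet> b) *\<^sub>R E b q c)"
  proof (intro ext)
    fix q c
    show "X q c = (\<Sum>b\<in>Basis. (coef X q \<bullet> b) *\<^sub>R E b q c)"
    proof (cases "q \<in> points M")
      case True
      then show ?thesis using frame_coef[OF X True] rep[of "coef X q" q c] by simp
    qed (simp add: frame_outside X)
  qed
  then have "T X p c = T (\<lambda>q c. \<Sum>b\<in>Basis. (coef X q \<bullet> b) *\<^sub>R E b q c) p c" by metis
  also have "\<dots> = (\<Sum>b\<in>Basis. (coef X p \<bullet> b) *\<^sub>R T (E b) p c)"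
    by (rule conjunct2[OF tensor_sum_frame[where f = "\<lambda>b q. coef X q \<bullet> b"]])
      (simp_all add: add scale smooth_fun_coef[OF X])
  also have "\<dots> = T (\<lambda>q c. \<Sum>b\<in>Basis. (coef X p \<bullet> b) *\<^sub>R E b q c) p c"
    by (rule conjunct2[OF tensor_sum_frame[where f = "\<lambda>b _. coef X p \<bullet> b"], symmetric])
      (simp_all add: add scale smooth_fun_const)
  also have "(\<lambda>q c. \<Sum>b\<in>Basis. (coef X p \<bullet> b) *\<^sub>R E b q c) = E (coef X p)"
    by (intro ext) (rule rep[symmetric])
  finally show ?thesis .
qed

text \<open>With \<open>\<delta> u h\<close> the derivative of \<open>h\<close> along \<open>E u\<close>, \<open>E u\<close> is \<open>\<delta> u\<close> of the coordinates and
  \<open>[E u, E v]\<close> acts as the commutator of \<open>\<delta> u\<close> and \<open>\<delta> v\<close>.\<close>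

lemma bracket_jacobi:
  assumes p: "p \<in> points M"
  shows "br u (br v w) + br v (br w u) + br w (br u v) = 0"
proof -
  define c where "c = chart_at M p"
  have c: "c \<in> atlas M" "p \<in> cdom c" using chart_at[OF p] by (simp_all add: c_def)
  note cc = chart[OF c(1)]
  define S where "S = crd c ` cdom c"
  have S: "open S" "crd c p \<in> S" using open_crd_cdom[OF cc] c by (auto simp: S_def)
  define e where "e = (\<lambda>v x. E v (crd_inv c x) c)"
  have e: "smooth_on S (e v)" for v
    unfolding e_def S_def using vfields_smooth[OF frame_vfields c(1)] .
  define \<delta> where "\<delta> = (\<lambda>u (h :: 'e \<Rightarrow> 'e) x. frechet_derivative h (at x) (e u x))"
  have sd: "smooth_on S (\<delta> u h)" if "smooth_on S h" for u h
    unfolding \<delta>_def using smooth_on_derivative_along[OF S(1) that e] .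
  have br: "e (br u v) x = \<delta> u (e v) x - \<delta> v (e u) x" if "x \<in> S" for u v x
  proof -
    have "lie_bracket M (E u) (E v) (crd_inv c x) c = \<delta> u (e v) x - \<delta> v (e u) x"
      using c that crd_inv_in_cdom[OF cc] crd_crd_inv[OF cc] by (simp add: lie_bracket_def \<delta>_def e_def S_def)
    then show ?thesis by (simp add: frame_bracket e_def)
  qed
  have comm: "\<delta> (br u v) h x = \<delta> u (\<delta> v h) x - \<delta> v (\<delta> u h) x" if "x \<in> S" "smooth_on S h" for u v h x
  proof -
    have "frechet_derivative (e v) (at x) (e u x) - frechet_derivative (e u) (at x) (e v x) = e (br u v) x"
      using br[OF that(1)] by (simp add: \<delta>_def)
    then show ?thesis
      using derivative_along_commutator[OF S(1) that e[of u] e[of v]] by (simp add: \<delta>_def)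
  qed
  let ?x = "crd c p"
  have *: "e (br u (br v w)) ?x = \<delta> u (\<delta> v (e w)) ?x - \<delta> u (\<delta> w (e v)) ?x
      - \<delta> v (\<delta> w (e u)) ?x + \<delta> w (\<delta> v (e u)) ?x" for u v w
  proof -
    have "frechet_derivative (e (br v w)) (at ?x) = frechet_derivative (\<lambda>x. \<delta> v (e w) x - \<delta> w (e v) x) (at ?x)"
      by (rule frechet_derivative_transform_within_open[OF smooth_on_differentiable[OF e S(2)] S br])
    also have "\<dots> = (\<lambda>a. frechet_derivative (\<delta> v (e w)) (at ?x) a - frechet_derivative (\<delta> w (e v)) (at ?x) a)"
      by (rule frechet_derivative_at[symmetric], intro has_derivative_diff)
        (auto intro: smooth_on_has_derivative sd e S)
    finally have "\<delta> u (e (br v w)) ?x = \<delta> u (\<delta> v (e w)) ?x - \<delta> u (\<delta> w (e v)) ?x"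
      by (simp add: \<delta>_def)
    then show ?thesis by (simp add: br[OF S(2)] comm[OF S(2) e])
  qed
  have lin: "linear (\<lambda>v. e v ?x)" unfolding e_def by (rule frame_linear)
  have "e (br u (br v w) + br v (br w u) + br w (br u v)) ?x = 0"
    by (simp add: linear_add[OF lin] *)
  moreover have "inj (\<lambda>v. e v ?x)"
    unfolding e_def crd_inv_crd[OF cc c(2)] by (rule frame_inj[OF c])
  ultimately show ?thesis
    using linear_injective_0[OF lin] by blast
qed

end

section \<open>The Obata connection in a frame with constant structure\<close>

locale hypercomplex_frame = frame_manifold M E br + torsion_free_connection M D
  for M :: "('a, 'e::euclidean_space) manifold" and E br D +
  fixes I' J' :: "('a, 'e) endo" and I J :: "'e \<Rightarrow> 'e" and V :: "nat \<Rightarrow> 'e set" and n :: nat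
  assumes parallel_I: "parallel M D I'" and parallel_J: "parallel M D J'" 
    and frame_I: "p \<in> points M \<Longrightarrow> I' p (E v p) = E (I v) p"
    and frame_J: "p \<in> points M \<Longrightarrow> J' p (E v p) = E (J v) p"
    and linear_I: "linear I" and linear_J: "linear J"
    and I_I: "\<And>v. I (I v) = - v" and J_J: "\<And>v. J (J v) = - v" and J_I: "\<And>v. J (I v) = - I (J v)"
    and linear_br_left: "\<And>v. linear (\<lambda>u. br u v)" and linear_br_right: "\<And>u. linear (br u)"
    and subspace_flag: "\<And>k. subspace (V k)" and flag_0: "V 0 = UNIV" and flag_n: "V n = {0}"
    and flag_Suc: "\<And>k. V (Suc k) \<subseteq> V k"
    and br_flag: "\<And>k u v. v \<in> V k \<Longrightarrow> br u v \<in> V (Suc k)"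
begin

definition conn_alg :: "'e \<Rightarrow> 'e \<Rightarrow> 'e" where
  "conn_alg u v = (1/2) *\<^sub>R (br u v + I (br (I u) v) - J (br u (J v)) + I (J (br (I u) (J v))))"

lemma endo_frame:
  assumes "\<And>p v. p \<in> points M \<Longrightarrow> S' p (E v p) = E (S v) p"
  shows "endo_app M S' (E v) = E (S v)"
  using assms frame_outside[OF _ frame_vfields] by (simp add: endo_app_def fun_eq_iff)

text \<open>At this stage the coefficients of \<open>D (E u) (E v)\<close> may still vary with the
  point, so they are named \<open>g\<close> for one fixed \<open>p\<close>;
  \<open>conn_alg_unique\<close> makes them constant afterwards.\<close>

lemma pointwise_conn:
  assumes p: "p \<in> points M"
  obtains g where "\<And>u v. D (E u) (E v) p = E (g u v) p" "\<And>u v. g u v - g v u = br u v"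
    "\<And>u v. g u (I v) = I (g u v)" "\<And>u v. g u (J v) = J (g u v)"
proof -
  define g where "g = (\<lambda>u v. coef (D (E u) (E v)) p)"
  have g: "D (E u) (E v) p = E (g u v) p" for u v
    using frame_coef[OF _ p, of "D (E u) (E v)"] by (simp add: g_def)
  have "E (g u v - g v u) p = E (br u v) p" for u v
  proof
    fix c
    have "E (br u v) p c = D (E u) (E v) p c - D (E v) (E u) p c"
      using lie_bracket_eq[of "E u" "E v"] by (simp add: frame_bracket vf_diff_def)
    then show "E (g u v - g v u) p c = E (br u v) p c"
      by (simp add: g linear_diff[OF frame_linear])
  qed
  then have 1: "g u v - g v u = br u v" for u v by (rule frame_eqD[OF p])
  have S: "g u (S v) = S (g u v)" if "parallel M D S'" "\<And>p v. p \<in> points M \<Longrightarrow> S' p (E v p) = E (S v) p" for S S' u v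
  proof -
    have "D (E u) (E (S v)) = endo_app M S' (D (E u) (E v))"
      using that(1) endo_frame[of S' S, OF that(2)] by (simp add: parallel_def) (metis frame_vfields)
    then have "E (g u (S v)) p = S' p (E (g u v) p)"
      by (simp add: g[symmetric] endo_app_def p)
    then show ?thesis using that(2)[OF p] frame_eqD[OF p] by metis
  qed
  show thesis
    by (rule that[OF g 1 S[OF parallel_I frame_I] S[OF parallel_J frame_J]])
qed

text \<open>When \<open>g u v - g v u\<close> is inserted for the brackets, the terms in
  \<open>g v u\<close>, \<open>g (I u) v\<close> and \<open>g (J v) u\<close> cancel in pairs, and
  two copies of \<open>g u v\<close> remain.\<close>

lemma conn_alg_unique:
  assumes "\<And>u v. g u v - g v u = br u v" "\<And>u v. g u (I v) = I (g u v)" "\<And>u v. g u (J v) = J (g u v)"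
  shows "g u v = conn_alg u v"
proof -
  have "br u v + I (br (I u) v) - J (br u (J v)) + I (J (br (I u) (J v))) = 2 *\<^sub>R g u v"
    unfolding assms(1)[symmetric] 
    by (simp add: assms(2,3) linear_diff[OF linear_I] linear_diff[OF linear_J] linear_neg[OF linear_I]
       linear_neg[OF linear_J] I_I J_J J_I scaleR_2)
  then show ?thesis by (simp add: conn_alg_def)
qed

lemma D_frame: "D (E u) (E v) = E (conn_alg u v)"
proof
  fix p
  show "D (E u) (E v) p = E (conn_alg u v) p"
  proof (cases "p \<in> points M")
    case True
    then obtain g where "\<And>u v. D (E u) (E v) p = E (g u v) p" "\<And>u v. g u v - g v u = br u v"
      "\<And>u v. g u (I v) = I (g u v)" "\<And>u v. g u (J v) = J (g u v)"
      using pointwise_conn by metis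
    then show ?thesis using conn_alg_unique[of g u v] by simp
  next
    case False
    show ?thesis
      using frame_outside[OF False, of "D (E u) (E v)"] frame_outside[OF False frame_vfields]
      by (simp add: fun_eq_iff)
  qed
qed

text \<open>Torsion-freeness and the commutation with \<open>I\<close> and \<open>J\<close> are
  inherited from the given connection at one point \<open>p\<close> instead of being computed from
  the formula for \<open>conn_alg\<close>, which would require integrability. Linearity is visible
  from the formula.\<close>

lemma obata_algebra_conn:
  assumes p: "p \<in> points M"
  shows "obata_algebra conn_alg I J V n" "conn_alg u v - conn_alg v u = br u v"
proof -
  obtain g where g: "\<And>u v. g u v - g v u = br u v"
      "\<And>u v. g u (I v) = I (g u v)" "\<And>u v. g u (J v) = J (g u v)"
    using pointwise_conn[OF p] by metis
  have "g = conn_alg" using conn_alg_unique[of g, OF g] by (simp add: fun_eq_iff)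
  note g = g[unfolded this]
  show "conn_alg u v - conn_alg v u = br u v" by (rule g(1))
  show "obata_algebra conn_alg I J V n"
  proof (rule obata_algebra.intro)
    note lin = linear_add[OF linear_I] linear_add[OF linear_J] linear_cmul[OF linear_I] linear_cmul[OF linear_J]
        linear_add[OF linear_br_left] linear_cmul[OF linear_br_left] linear_add[OF linear_br_right]
        linear_cmul[OF linear_br_right]
    show "linear (\<lambda>u. conn_alg u v)" for v
      unfolding linear_iff conn_alg_def by (simp add: lin algebra_simps)
    show "linear (conn_alg u)" for u
      unfolding linear_iff conn_alg_def by (simp add: lin algebra_simps)
    show "conn_alg u v - conn_alg v u \<in> V (Suc k)" if "v \<in> V k" for k u v
      using br_flag[OF that] g(1) by simp
    show "conn_alg u (conn_alg v w - conn_alg w v) - conn_alg (conn_alg v w - conn_alg w v) u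
      + (conn_alg v (conn_alg w u - conn_alg u w) - conn_alg (conn_alg w u - conn_alg u w) v)
      + (conn_alg w (conn_alg u v - conn_alg v u) - conn_alg (conn_alg u v - conn_alg v u) w) = 0" for u v w
      unfolding g(1) by (rule bracket_jacobi[OF p])
  qed (simp_all add: linear_I linear_J I_I J_J J_I g subspace_flag flag_0 flag_n flag_Suc)
qed

lemma curvature_frame:
  "curvature M D (E u) (E v) (E w) = 
   E (conn_alg u (conn_alg v w) - conn_alg v (conn_alg u w) - conn_alg (br u v) w)"
  by (simp add: fun_eq_iff curvature_def D_frame frame_bracket vf_diff_def linear_diff[OF frame_linear])

lemma curvature_coef:
  assumes "X \<in> vfields M" "Y \<in> vfields M" "Z \<in> vfields M" "p \<in> points M"
  shows "curvature M D X Y Z p c = curvature M D (E (coef X p)) (E (coef Y p)) (E (coef Z p)) p c"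
proof -
  have "curvature M D X Y Z p c = curvature M D (E (coef X p)) Y Z p c"
    using assms by (intro tensor_frame[of "\<lambda>X. curvature M D X Y Z"]) (auto simp: curvature_add curvature_scale_left)
  also have "\<dots> = curvature M D (E (coef X p)) (E (coef Y p)) Z p c"
    using assms by (intro tensor_frame[of "\<lambda>Y. curvature M D _ Y Z"]) (auto simp: curvature_add curvature_scale_middle)
  also have "\<dots> = curvature M D (E (coef X p)) (E (coef Y p)) (E (coef Z p)) p c"
    using assms by (intro tensor_frame[of "\<lambda>Z. curvature M D _ _ Z"]) (auto simp: curvature_add curvature_scale_right)
  finally show ?thesis .
qed

lemma ricci_zero:
  assumes X: "X \<in> vfields M" and Y: "Y \<in> vfields M" and p: "p \<in> points M"
  shows "ricci M D X Y p = 0"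
proof -
  interpret alg: obata_algebra conn_alg I J V n by (rule obata_algebra_conn(1)[OF p])
  define c where "c = chart_at M p"
  have c: "c \<in> atlas M" "p \<in> cdom c" using chart_at[OF p] by (simp_all add: c_def)
  \<comment> \<open>\<open>A\<close> compares the frame with the chart basis in which
    \<open>ricci\<close> takes the trace; its inverse turns a basis vector into frame
    coefficients.\<close>
  define A where "A = (\<lambda>v. E v p c)"
  have A: "linear A" "inj A" unfolding A_def using frame_linear frame_inj[OF c] by auto
  obtain B where B: "linear B" "\<And>v. B (A v) = v" "\<And>v. A (B v) = v"
    using linear_injective_isomorphism[OF A] by metis
  have ext: "extend M p (tvec_of M p c b) \<in> vfields M \<and> coef (extend M p (tvec_of M p c b)) p = B b" for b
  proof -
    have "tvec_of M p c b = E (B b) p"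
      using tvec_of_component[OF c vfields_tangent[OF frame_vfields[of "B b"]]] B(3)[of b] by (simp add: A_def)
    \<comment> \<open>A frame field is an extension, so the choice in \<open>extend\<close> is well
      founded; the curvature depends on the chosen field through its value at \<open>p\<close>
      alone.\<close>
    then have "\<exists>Z. Z \<in> vfields M \<and> Z p = tvec_of M p c b" using frame_vfields by metis
    then have "extend M p (tvec_of M p c b) \<in> vfields M \<and> extend M p (tvec_of M p c b) p = tvec_of M p c b"
      unfolding extend_def by (rule someI_ex)
    then show ?thesis
      using frame_coef[OF _ p, of "extend M p (tvec_of M p c b)"] \<open>tvec_of M p c b = E (B b) p\<close> frame_eqD[OF p] by metis
  qed
  have "curvature M D (extend M p (tvec_of M p c b)) X Y p c = A (alg.curv (B b) (coef X p) (coef Y p))" for b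
    using curvature_coef[OF _ X Y p, of "extend M p (tvec_of M p c b)" c] ext[of b]
    by (simp add: curvature_frame A_def alg.curv_def alg.bracket_def obata_algebra_conn(2)[OF p])
  then have "ricci M D X Y p = trace_lin (\<lambda>b. A (alg.curv (B b) (coef X p) (coef Y p)))"
    by (simp add: ricci_def c_def[symmetric] trace_lin_def)
  also have "\<dots> = 0"
    using trace_lin_conjugate[OF A(1) B(1) alg.linear_curv_left B(2)] alg.ricci_form_zero by simp
  finally show ?thesis .
qed

end


section \<open>Left-invariant vector fields on a Lie group\<close>

lemma continuous_map_crd_inv:
  assumes "chart_on T c"
  shows "continuous_map (top_of_set (crd c ` cdom c)) T (crd_inv c)"
  unfolding continuous_map_def
proof (intro conjI allI impI)
  show "crd_inv c \<in> topspace (top_of_set (crd c ` cdom c)) \<rightarrow> topspace T"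
    using crd_inv_in_cdom[OF assms] openin_subset[OF openin_cdom[OF assms]] by auto
  fix U assume "openin T U"
  then show "openin (top_of_set (crd c ` cdom c)) {x \<in> topspace (top_of_set (crd c ` cdom c)). crd_inv c x \<in> U}"
    using open_crd_inv_preimage[OF assms, of U] by (auto intro: open_subset)
qed

lemma crd_inv_map_prod:
  assumes "chart_on T a" "chart_on T' b" "x \<in> crd a ` cdom a" "y \<in> crd b ` cdom b"
  shows "crd_inv (cdom a \<times> cdom b, map_prod (crd a) (crd b)) (x, y) = (crd_inv a x, crd_inv b y)"
proof -
  have "inj_on (map_prod (crd a) (crd b)) (cdom a \<times> cdom b)"
    using inj_on_crd[OF assms(1)] inj_on_crd[OF assms(2)] by (rule map_prod_inj_on)
  then show ?thesis
    unfolding crd_inv_def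
    using crd_inv_in_cdom[OF assms(1,3)] crd_inv_in_cdom[OF assms(2,4)] crd_crd_inv[OF assms(1,3)] crd_crd_inv[OF assms(2,4)]
    by (intro inv_into_f_eq) (auto simp: crd_inv_def)
qed

locale lie_group_manifold = group G + atlas_manifold M
  for G :: "('g, 'b) monoid_scheme" (structure) and M :: "('g, 'e::euclidean_space) manifold" +
  assumes lie: "lie_group G M"
begin

lemma points_carrier: "points M = carrier G"
  using lie by (simp add: lie_group_def)

lemma cdom_carrier: "c \<in> atlas M \<Longrightarrow> p \<in> cdom c \<Longrightarrow> p \<in> carrier G"
  using in_points points_carrier by blast

lemma continuous_mult:
  assumes "continuous_map X (mtop M) f" "continuous_map X (mtop M) g"
  shows "continuous_map X (mtop M) (\<lambda>x. f x \<otimes> g x)"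
proof -
  have "continuous_map (prod_topology (mtop M) (mtop M)) (mtop M) (\<lambda>(x, y). x \<otimes> y)"
    using lie by (simp add: lie_group_def smooth_map_def prod_manifold_def)
  from continuous_map_compose[OF _ this, of X "\<lambda>x. (f x, g x)"] show ?thesis
    using assms by (simp add: continuous_map_pairwise o_def)
qed

lemma continuous_inv: "continuous_map (mtop M) (mtop M) (\<lambda>x. inv x)"
  using lie by (simp add: lie_group_def smooth_map_def)

lemma continuous_left: "g \<in> carrier G \<Longrightarrow> continuous_map (mtop M) (mtop M) (\<lambda>p. g \<otimes> p)"
  by (intro continuous_mult) (simp_all add: points_carrier)

lemma openin_vimage:
  "continuous_map (mtop M) (mtop M) F \<Longrightarrow> d \<in> atlas M \<Longrightarrow> openin (mtop M) {p \<in> carrier G. F p \<in> cdom d}"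
  unfolding points_carrier[symmetric] by (rule openin_continuous_map_preimage[OF _ openin_cdom[OF chart]])

definition mdom :: "('g, 'e) chart \<Rightarrow> ('g, 'e) chart \<Rightarrow> ('g, 'e) chart \<Rightarrow> ('e \<times> 'e) set" where
  "mdom a b d = {(x, y). x \<in> crd a ` cdom a \<and> y \<in> crd b ` cdom b \<and> crd_inv a x \<otimes> crd_inv b y \<in> cdom d}"

definition mul :: "('g, 'e) chart \<Rightarrow> ('g, 'e) chart \<Rightarrow> ('g, 'e) chart \<Rightarrow> 'e \<times> 'e \<Rightarrow> 'e" where
  "mul a b d z = crd d (crd_inv a (fst z) \<otimes> crd_inv b (snd z))"

context
  fixes a b d assumes abd: "a \<in> atlas M" "b \<in> atlas M" "d \<in> atlas M"
begin

lemma open_mdom: "open (mdom a b d)"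
proof -
  let ?A = "crd a ` cdom a" and ?B = "crd b ` cdom b"
  let ?X = "prod_topology (top_of_set ?A) (top_of_set ?B)"
  have X: "?X = top_of_set (?A \<times> ?B)" by (simp add: prod_topology_subtopology_eu)
  have "continuous_map ?X (mtop M) (\<lambda>z. crd_inv a (fst z) \<otimes> crd_inv b (snd z))"
    by (intro continuous_mult
        continuous_map_compose[OF continuous_map_fst continuous_map_crd_inv[OF chart[OF abd(1)]], unfolded o_def]
        continuous_map_compose[OF continuous_map_snd continuous_map_crd_inv[OF chart[OF abd(2)]], unfolded o_def])
  from openin_continuous_map_preimage[OF this openin_cdom[OF chart[OF abd(3)]]]
  have "openin (top_of_set (?A \<times> ?B)) {z \<in> ?A \<times> ?B. crd_inv a (fst z) \<otimes> crd_inv b (snd z) \<in> cdom d}"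
    unfolding X by simp
  moreover have "{z \<in> ?A \<times> ?B. crd_inv a (fst z) \<otimes> crd_inv b (snd z) \<in> cdom d} = mdom a b d"
    by (auto simp: mdom_def)
  moreover have "open (?A \<times> ?B)"
    by (rule open_Times[OF open_crd_cdom[OF chart[OF abd(1)]] open_crd_cdom[OF chart[OF abd(2)]]])
  ultimately show ?thesis by (metis openin_open_eq)
qed

lemma smooth_mul: "smooth_on (mdom a b d) (mul a b d)"
proof -
  let ?c = "(cdom a \<times> cdom b, map_prod (crd a) (crd b))"
  have "smooth_map (prod_manifold M M) M (\<lambda>(x, y). x \<otimes> y)"
    using lie by (simp add: lie_group_def)
  moreover have "?c \<in> atlas (prod_manifold M M)"
    unfolding prod_manifold_def manifold.select_convs using abd by blast
  ultimately have "smooth_on (crd ?c ` {p \<in> cdom ?c. (\<lambda>(x, y). x \<otimes> y) p \<in> cdom d}) (crd d \<circ> (\<lambda>(x, y). x \<otimes> y) \<circ> crd_inv ?c)"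
    using abd(3) unfolding smooth_map_def by blast
  moreover have "crd ?c ` {p \<in> cdom ?c. (\<lambda>(x, y). x \<otimes> y) p \<in> cdom d} = mdom a b d" (is "?l = ?r")
  proof
    show "?l \<subseteq> ?r"
      by (auto simp: mdom_def crd_inv_crd[OF chart[OF abd(1)]] crd_inv_crd[OF chart[OF abd(2)]])
    show "?r \<subseteq> ?l"
    proof
      fix z assume "z \<in> ?r"
      then show "z \<in> ?l"
        using crd_crd_inv[OF chart[OF abd(1)], of "fst z"] crd_crd_inv[OF chart[OF abd(2)], of "snd z"]
          crd_inv_in_cdom[OF chart[OF abd(1)], of "fst z"] crd_inv_in_cdom[OF chart[OF abd(2)], of "snd z"]
        by (intro image_eqI[of _ _ "(crd_inv a (fst z), crd_inv b (snd z))"]) (auto simp: mdom_def)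
    qed
  qed
  ultimately have *: "smooth_on (mdom a b d) (crd d \<circ> (\<lambda>(x, y). x \<otimes> y) \<circ> crd_inv ?c)" by simp
  show ?thesis
    by (rule smooth_on_cong[OF open_mdom _ *])
      (auto simp: mdom_def mul_def crd_inv_map_prod[OF chart[OF abd(1)] chart[OF abd(2)]])
qed

end

lemma mdom_iff: 
  "a \<in> atlas M \<Longrightarrow> b \<in> atlas M \<Longrightarrow> p \<in> cdom a \<Longrightarrow> q \<in> cdom b \<Longrightarrow> (crd a p, crd b q) \<in> mdom a b d \<longleftrightarrow> p \<otimes> q \<in> cdom d"
  by (simp add: mdom_def crd_inv_crd[OF chart])

lemma mul_crd: 
  "a \<in> atlas M \<Longrightarrow> b \<in> atlas M \<Longrightarrow> p \<in> cdom a \<Longrightarrow> q \<in> cdom b \<Longrightarrow> mul a b d (crd a p, crd b q) = crd d (p \<otimes> q)"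
  by (simp add: mul_def crd_inv_crd[OF chart])

lemma has_derivative_mul:
  assumes "a \<in> atlas M" "b \<in> atlas M" "d \<in> atlas M" "p \<in> cdom a" "q \<in> cdom b" "p \<otimes> q \<in> cdom d"
  shows "(mul a b d has_derivative frechet_derivative (mul a b d) (at (crd a p, crd b q))) (at (crd a p, crd b q))"
  using smooth_on_has_derivative[OF smooth_mul[OF assms(1-3)]] mdom_iff[OF assms(1,2,4,5)] assms(6) by blast

lemma open_left_domain:
  assumes "g \<in> carrier G" "c \<in> atlas M" "d \<in> atlas M"
  shows "open {y \<in> crd c ` cdom c. g \<otimes> crd_inv c y \<in> cdom d}"
proof -
  have "{y \<in> crd c ` cdom c. g \<otimes> crd_inv c y \<in> cdom d}
      = {y \<in> crd c ` cdom c. crd_inv c y \<in> {p \<in> carrier G. g \<otimes> p \<in> cdom d}}"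
    using cdom_carrier[OF assms(2)] crd_inv_in_cdom[OF chart[OF assms(2)]] by auto
  then show ?thesis
    using open_crd_inv_preimage[OF chart[OF assms(2)] openin_vimage[OF continuous_left[OF assms(1)] assms(3)]] by simp
qed

lemma smooth_left:
  assumes "g \<in> carrier G" "c \<in> atlas M" "d \<in> atlas M"
  shows "smooth_on {y \<in> crd c ` cdom c. g \<otimes> crd_inv c y \<in> cdom d} (crd d \<circ> (\<lambda>p. g \<otimes> p) \<circ> crd_inv c)"
proof -
  define a where "a = chart_at M g"
  have a: "a \<in> atlas M" "g \<in> cdom a" using chart_at[of g] assms(1) points_carrier by (auto simp: a_def)
  \<comment> \<open>Left translation is the slice of the multiplication through the coordinates of
    \<open>g\<close>, hence arises from it by an affine substitution.\<close>
  have eq: "mul a c d ((crd a g, 0) + (0, y)) = (crd d \<circ> (\<lambda>p. g \<otimes> p) \<circ> crd_inv c) y" for y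
    by (simp add: mul_def crd_inv_crd[OF chart[OF a(1)] a(2)])
  have "smooth_on {y \<in> crd c ` cdom c. g \<otimes> crd_inv c y \<in> cdom d} (\<lambda>y. mul a c d ((crd a g, 0) + (0, y)))"
  proof (rule smooth_on_affine[OF smooth_mul[OF a(1) assms(2,3)] open_mdom[OF a(1) assms(2,3)]])
    show "bounded_linear (\<lambda>y::'e. (0::'e, y))"
      by (intro bounded_linear_Pair bounded_linear_zero bounded_linear_ident)
    show "open {y \<in> crd c ` cdom c. g \<otimes> crd_inv c y \<in> cdom d}"
      by (rule open_left_domain[OF assms])
  qed (use a in \<open>auto simp: mdom_def crd_inv_crd[OF chart]\<close>)
  then show ?thesis unfolding eq .
qed

lemma has_derivative_left:
  assumes "g \<in> carrier G" "c \<in> atlas M" "d \<in> atlas M" "p \<in> cdom c" "g \<otimes> p \<in> cdom d"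
  shows "((crd d \<circ> (\<lambda>p. g \<otimes> p) \<circ> crd_inv c) has_derivative
     frechet_derivative (crd d \<circ> (\<lambda>p. g \<otimes> p) \<circ> crd_inv c) (at (crd c p))) (at (crd c p))"
  by (rule smooth_on_has_derivative[OF smooth_left[OF assms(1-3)]])
    (use assms in \<open>simp add: crd_inv_crd[OF chart]\<close>)

lemma differentiable_right:
  assumes "g \<in> carrier G" "c \<in> atlas M" "d \<in> atlas M" "p \<in> cdom c" "p \<otimes> g \<in> cdom d"
  shows "(crd d \<circ> (\<lambda>p. p \<otimes> g) \<circ> crd_inv c) differentiable (at (crd c p))"
proof -
  define a where "a = chart_at M g"
  have a: "a \<in> atlas M" "g \<in> cdom a" using chart_at[of g] assms(1) points_carrier by (auto simp: a_def)
  have "((\<lambda>x. (x, crd a g)) has_derivative (\<lambda>v. (v, 0))) (at (crd c p))"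
    by (intro has_derivative_Pair has_derivative_ident has_derivative_const)
  from diff_chain_at[OF this has_derivative_mul[OF assms(2) a(1) assms(3,4) a(2) assms(5)]]
  show ?thesis
    unfolding differentiable_def by (auto simp: o_def mul_def crd_inv_crd[OF chart[OF a(1)] a(2)])
qed

definition c0 :: "('g, 'e) chart" where "c0 = chart_at M \<one>"

definition x0 :: 'e where "x0 = crd c0 \<one>"

lemma c0: "c0 \<in> atlas M" "\<one> \<in> cdom c0"
  using chart_at[of \<one>] points_carrier by (auto simp: c0_def)

lemma crd_inv_x0: "crd_inv c0 x0 = \<one>"
  by (simp add: x0_def crd_inv_crd[OF chart[OF c0(1)] c0(2)])

text \<open>The chart \<open>c0\<close> identifies the Lie algebra with \<open>'e\<close>. Only the
  coordinate expression of the field is recorded, since the frame of the quotient has the same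
  expression in the charts there.\<close>

definition lfield :: "'e \<Rightarrow> 'g \<Rightarrow> ('g, 'e) chart \<Rightarrow> 'e" where
  "lfield v g d = frechet_derivative (crd d \<circ> (\<lambda>p. g \<otimes> p) \<circ> crd_inv c0) (at x0) v"

lemma has_derivative_lfield:
  assumes "d \<in> atlas M" "g \<in> cdom d"
  shows "((crd d \<circ> (\<lambda>p. g \<otimes> p) \<circ> crd_inv c0) has_derivative (\<lambda>v. lfield v g d)) (at x0)"
  using has_derivative_left[OF cdom_carrier[OF assms] c0(1) assms(1) c0(2)] assms cdom_carrier[OF assms]
  by (simp add: lfield_def[abs_def] x0_def)

lemma linear_lfield: "d \<in> atlas M \<Longrightarrow> g \<in> cdom d \<Longrightarrow> linear (\<lambda>v. lfield v g d)"
  using has_derivative_lfield has_derivative_linear by blast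

lemma lfield_translate:
  assumes "h \<in> carrier G" "c \<in> atlas M" "d \<in> atlas M" "g \<in> cdom c" "h \<otimes> g \<in> cdom d"
  shows "lfield v (h \<otimes> g) d = frechet_derivative (crd d \<circ> (\<lambda>p. h \<otimes> p) \<circ> crd_inv c) (at (crd c g)) (lfield v g c)"
proof -
  let ?B = "frechet_derivative (crd d \<circ> (\<lambda>p. h \<otimes> p) \<circ> crd_inv c) (at (crd c g))"
  note g = cdom_carrier[OF assms(2,4)]
  have 1: "((crd c \<circ> (\<lambda>p. g \<otimes> p) \<circ> crd_inv c0) has_derivative (\<lambda>v. lfield v g c)) (at (crd c0 \<one>))"
    using has_derivative_lfield[OF assms(2,4)] by (simp add: x0_def)
  have 2: "((crd d \<circ> (\<lambda>p. h \<otimes> p) \<circ> crd_inv c) has_derivative ?B) (at (crd c (g \<otimes> \<one>)))"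
    using has_derivative_left[OF assms] g by simp
  have "((crd d \<circ> (\<lambda>p. h \<otimes> p) \<circ> (\<lambda>p. g \<otimes> p) \<circ> crd_inv c0) has_derivative (\<lambda>v. ?B (lfield v g c))) (at (crd c0 \<one>))"
    by (rule has_derivative_chart_compose[OF chart[OF c0(1)] chart[OF assms(2)] c0(2)
          openin_vimage[OF continuous_left[OF g] assms(2)] _ _ 1 2])
      (use assms g in auto)
  then have "((crd d \<circ> (\<lambda>p. (h \<otimes> g) \<otimes> p) \<circ> crd_inv c0) has_derivative (\<lambda>v. ?B (lfield v g c))) (at x0)"
    unfolding x0_def
    by (rule has_derivative_crd_inv_cong[OF chart[OF c0(1)] openin_cdom[OF chart[OF c0(1)]] c0(2,2), rotated])
      (use assms(1) g cdom_carrier[OF c0(1)] in \<open>simp add: m_assoc\<close>)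
  from fun_cong[OF frechet_derivative_at[OF this], of v] show ?thesis by (simp add: lfield_def)
qed

lemma lfield_one: "lfield v \<one> c0 = v"
proof -
  have "((crd c0 \<circ> (\<lambda>p. \<one> \<otimes> p) \<circ> crd_inv c0) has_derivative (\<lambda>v. v)) (at x0)"
    unfolding x0_def
    by (rule has_derivative_crd_inv_cong[OF chart[OF c0(1)] openin_cdom[OF chart[OF c0(1)]] c0(2,2) _
          has_derivative_crd[OF chart[OF c0(1)] c0(2)]])
      (use cdom_carrier[OF c0(1)] in simp)
  from fun_cong[OF frechet_derivative_at[OF this], of v] show ?thesis by (simp add: lfield_def)
qed

text \<open>Translating back by \<open>inv g\<close> recovers \<open>v\<close>.\<close>

lemma inj_lfield:
  assumes "d \<in> atlas M" "g \<in> cdom d"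
  shows "inj (\<lambda>v. lfield v g d)"
proof -
  note g = cdom_carrier[OF assms]
  have *: "v = frechet_derivative (crd c0 \<circ> (\<lambda>p. inv g \<otimes> p) \<circ> crd_inv d) (at (crd d g)) (lfield v g d)" for v
    using lfield_translate[of "inv g" d c0 g v] assms g c0 by (simp add: l_inv lfield_one)
  show ?thesis by (rule injI) (metis *)
qed

text \<open>As a partial derivative of the jointly smooth multiplication the field is smooth in
  \<open>g\<close>, which its definition by separate translations does not show.\<close>

lemma lfield_mul:
  assumes "c \<in> atlas M" "g \<in> cdom c"
  shows "lfield v g c = frechet_derivative (mul c c0 c) (at (crd c g, x0)) (0, v)"
proof -
  have 1: "((\<lambda>y. (crd c g, y)) has_derivative (\<lambda>v. (0, v))) (at x0)"
    by (intro has_derivative_Pair has_derivative_ident has_derivative_const)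
  have "(mul c c0 c has_derivative frechet_derivative (mul c c0 c) (at (crd c g, x0))) (at (crd c g, x0))"
    using has_derivative_mul[OF assms(1) c0(1) assms(1,2) c0(2)] assms cdom_carrier[OF assms] by (simp add: x0_def)
  from fun_cong[OF frechet_derivative_at[OF diff_chain_at[OF 1 this]], of v]
  show ?thesis
    by (simp add: lfield_def o_def mul_def crd_inv_crd[OF chart[OF assms(1)] assms(2)])
qed

lemma smooth_lfield:
  assumes c: "c \<in> atlas M"
  shows "smooth_on (crd c ` cdom c) (\<lambda>x. lfield v (crd_inv c x) c)"
proof -
  note oc = open_crd_cdom[OF chart[OF c]]
  have "smooth_on (crd c ` cdom c) (\<lambda>x. frechet_derivative (mul c c0 c) (at ((0, x0) + (x, 0))) (0, v))"
  proof (rule smooth_on_affine[OF smooth_on_frechet_derivative[OF smooth_mul[OF c c0(1) c]] open_mdom[OF c c0(1) c] _ oc])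
    show "bounded_linear (\<lambda>y::'e. (y, 0::'e))"
      by (intro bounded_linear_Pair bounded_linear_zero bounded_linear_ident)
    fix x assume "x \<in> crd c ` cdom c"
    then obtain p where "p \<in> cdom c" "x = crd c p" by blast
    then show "(0, x0) + (x, 0) \<in> mdom c c0 c"
      using mdom_iff[OF c c0(1) _ c0(2)] cdom_carrier[OF c] by (simp add: x0_def)
  qed
  then show ?thesis
    by (rule smooth_on_cong[OF oc, rotated])
      (use lfield_mul[OF c crd_inv_in_cdom[OF chart[OF c]]] crd_crd_inv[OF chart[OF c]] in simp)
qed

text \<open>The coordinate bracket of two left-invariant fields at \<open>\<one>\<close>, where
  their components in \<open>c0\<close> are \<open>u\<close> and \<open>v\<close> by
  \<open>lfield_one\<close>.\<close>

definition lie_br :: "'e \<Rightarrow> 'e \<Rightarrow> 'e" where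
  "lie_br u v = frechet_derivative (\<lambda>x. lfield v (crd_inv c0 x) c0) (at x0) u
     - frechet_derivative (\<lambda>x. lfield u (crd_inv c0 x) c0) (at x0) v"

text \<open>Left translation \<open>F\<close> by \<open>g\<close> maps left-invariant fields near \<open>\<one>\<close> to themselves near \<open>g\<close>; the
  second derivatives of \<open>F\<close> cancel in the bracket.\<close>

lemma lfield_bracket:
  assumes c: "c \<in> atlas M" and g: "g \<in> cdom c"
  shows "frechet_derivative (\<lambda>x. lfield v (crd_inv c x) c) (at (crd c g)) (lfield u g c)
     - frechet_derivative (\<lambda>x. lfield u (crd_inv c x) c) (at (crd c g)) (lfield v g c) = lfield (lie_br u v) g c"
proof -
  note gG = cdom_carrier[OF c g]
  define F where "F = crd c \<circ> (\<lambda>p. g \<otimes> p) \<circ> crd_inv c0"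
  define S where "S = {y \<in> crd c0 ` cdom c0. g \<otimes> crd_inv c0 y \<in> cdom c}"
  have S: "open S" "x0 \<in> S"
    using open_left_domain[OF gG c0(1) c] c0(2) crd_inv_x0 gG g unfolding S_def by (auto simp: x0_def)
  have F: "smooth_on S F" unfolding F_def S_def by (rule smooth_left[OF gG c0(1) c])
  have DF: "frechet_derivative F (at x0) v = lfield v g c" for v by (simp add: F_def lfield_def)
  have Fx0: "F x0 = crd c g" by (simp add: F_def crd_inv_x0 gG)
  let ?l = "\<lambda>v y. lfield v (crd_inv c0 y) c0"
  have rel: "lfield v (crd_inv c (F y)) c = frechet_derivative F (at y) (?l v y)" if "y \<in> S" for v y
  proof -
    have y: "crd_inv c0 y \<in> cdom c0" "g \<otimes> crd_inv c0 y \<in> cdom c" "crd c0 (crd_inv c0 y) = y"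
      using that crd_inv_in_cdom[OF chart[OF c0(1)]] crd_crd_inv[OF chart[OF c0(1)]] by (auto simp: S_def)
    have "crd_inv c (F y) = g \<otimes> crd_inv c0 y"
      using y by (simp add: F_def crd_inv_crd[OF chart[OF c]])
    then show ?thesis using lfield_translate[OF gG c0(1) c y(1,2), of v] y(3) by (simp add: F_def)
  qed
  \<comment> \<open>One function of \<open>y\<close> is differentiated in two ways: by the chain
    rule on the left-hand side of \<open>rel\<close> and by the product rule on its right-hand
    side.\<close>
  have *: "frechet_derivative (\<lambda>x. lfield v (crd_inv c x) c) (at (crd c g)) (lfield u g c)
     = frechet_derivative (\<lambda>y. frechet_derivative F (at y) v) (at x0) u
       + lfield (frechet_derivative (?l v) (at x0) u) g c" for u v
  proof -
    have x0c: "x0 \<in> crd c0 ` cdom c0" using S by (simp add: S_def)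
    have lx0: "?l v x0 = v" by (simp add: crd_inv_x0 lfield_one)
    have "((\<lambda>y. frechet_derivative F (at y) (?l v y)) has_derivative
     (\<lambda>w. frechet_derivative (\<lambda>y. frechet_derivative F (at y) v) (at x0) w
        + lfield (frechet_derivative (?l v) (at x0) w) g c)) (at x0)"
      using has_derivative_derivative_along[OF S(1) F S(2) smooth_on_has_derivative[OF smooth_lfield[OF c0(1)] x0c], of v]
      unfolding lx0 DF .
    then have 1: "((\<lambda>y. lfield v (crd_inv c (F y)) c) has_derivative
     (\<lambda>w. frechet_derivative (\<lambda>y. frechet_derivative F (at y) v) (at x0) w
        + lfield (frechet_derivative (?l v) (at x0) w) g c)) (at x0)"
      by (rule has_derivative_transform_within_open[OF _ S rel[symmetric]])
    have "((\<lambda>x. lfield v (crd_inv c x) c) has_derivative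
        frechet_derivative (\<lambda>x. lfield v (crd_inv c x) c) (at (F x0))) (at (F x0))"
      using smooth_on_has_derivative[OF smooth_lfield[OF c]] g by (simp add: Fx0)
    from diff_chain_at[OF smooth_on_has_derivative[OF F S(2)] this]
    have 2: "((\<lambda>y. lfield v (crd_inv c (F y)) c) has_derivative
       (\<lambda>u. frechet_derivative (\<lambda>x. lfield v (crd_inv c x) c) (at (crd c g)) (lfield u g c))) (at x0)"
      by (simp add: o_def DF Fx0)
    show ?thesis using fun_cong[OF has_derivative_unique[OF 2 1], of u] .
  qed
  show ?thesis
    unfolding * lie_br_def linear_diff[OF linear_lfield[OF c g]]
    using frechet_derivative_commute[OF S F, of u v] by simp
qed

end


section \<open>The lower central series and the Lie bracket\<close>

lemma (in group) lower_central_subset: "lower_central G k \<subseteq> carrier G"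
proof (induction k)
  case (Suc k)
  then show ?case by (auto intro!: generate_incl)
qed simp

lemma (in group) lower_central_commutator:
  "x \<in> lower_central G k \<Longrightarrow> y \<in> carrier G \<Longrightarrow> x \<otimes> y \<otimes> inv x \<otimes> inv y \<in> lower_central G (Suc k)"
  by (auto intro!: generate.incl)

lemma (in group) lower_central_Suc_subset: "lower_central G (Suc k) \<subseteq> lower_central G k"
proof (induction k)
  case 0
  then show ?case using lower_central_subset[of "Suc 0"] by simp
next
  case (Suc k)
  define C where "C = (\<lambda>A. {x \<otimes> y \<otimes> inv x \<otimes> inv y |x y. x \<in> A \<and> y \<in> carrier G})"
  have eq: "lower_central G (Suc j) = generate G (C (lower_central G j))" for j
    by (simp add: C_def)
  have "C (lower_central G (Suc k)) \<subseteq> C (lower_central G k)"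
    using Suc unfolding C_def by blast
  then have "generate G (C (lower_central G (Suc k))) \<subseteq> generate G (C (lower_central G k))"
    by (rule mono_generate)
  then show ?case by (simp only: eq[symmetric])
qed

context lie_group_manifold
begin

lemma has_derivative_mult:
  assumes "a \<in> atlas M" "b \<in> atlas M" "c \<in> atlas M" "d \<in> atlas M" "p \<in> cdom c"
    and F: "continuous_map (mtop M) (mtop M) F" "F p \<in> cdom a"
      "((crd a \<circ> F \<circ> crd_inv c) has_derivative A) (at (crd c p))"
    and H: "continuous_map (mtop M) (mtop M) H" "H p \<in> cdom b"
      "((crd b \<circ> H \<circ> crd_inv c) has_derivative B) (at (crd c p))"
    and d: "F p \<otimes> H p \<in> cdom d"
  shows "((crd d \<circ> (\<lambda>q. F q \<otimes> H q) \<circ> crd_inv c) has_derivative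
    (\<lambda>v. frechet_derivative (mul a b d) (at (crd a (F p), crd b (H p))) (A v, B v))) (at (crd c p))"
proof -
  have "((\<lambda>x. ((crd a \<circ> F \<circ> crd_inv c) x, (crd b \<circ> H \<circ> crd_inv c) x)) has_derivative (\<lambda>v. (A v, B v))) (at (crd c p))"
    by (intro has_derivative_Pair F H)
  moreover have "(mul a b d has_derivative frechet_derivative (mul a b d) (at (crd a (F p), crd b (H p))))
    (at ((crd a \<circ> F \<circ> crd_inv c) (crd c p), (crd b \<circ> H \<circ> crd_inv c) (crd c p)))"
    using has_derivative_mul[OF assms(1,2,4) F(2) H(2) d] by (simp add: crd_inv_crd[OF chart[OF assms(3)] assms(5)])
  ultimately have "((\<lambda>q. mul a b d (crd a (F q), crd b (H q))) \<circ> crd_inv c has_derivative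
    (\<lambda>v. frechet_derivative (mul a b d) (at (crd a (F p), crd b (H p))) (A v, B v))) (at (crd c p))"
    using diff_chain_at by (fastforce simp: o_def)
  then show ?thesis
    by (rule has_derivative_crd_inv_cong[OF chart[OF assms(3)]
        openin_Int[OF openin_vimage[OF F(1) assms(1)] openin_vimage[OF H(1) assms(2)]] _ assms(5), rotated 2])
      (use F(2) H(2) cdom_carrier[OF assms(3,5)] mul_crd[OF assms(1,2)] in auto)
qed

abbreviation mul0 :: "'e \<times> 'e \<Rightarrow> 'e" where "mul0 \<equiv> mul c0 c0 c0"

lemma x0_in: "x0 \<in> crd c0 ` cdom c0"
  using c0 by (simp add: x0_def)

lemma z0_in: "(x0, x0) \<in> mdom c0 c0 c0"
  using mdom_iff[OF c0(1,1) c0(2,2)] c0(2) by (simp add: x0_def)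

lemma has_derivative_const_chart: 
  "((crd b \<circ> (\<lambda>_. g) \<circ> crd_inv c) has_derivative (\<lambda>_. 0)) F"
  by (simp add: o_def)

lemma has_derivative_id_chart:
  "c \<in> atlas M \<Longrightarrow> p \<in> cdom c \<Longrightarrow> ((crd c \<circ> (\<lambda>q. q) \<circ> crd_inv c) has_derivative (\<lambda>v. v)) (at (crd c p))"
  using has_derivative_crd[OF chart] by (simp add: o_def)

text \<open>The counterpart of \<open>lfield\<close> for right translations, in the chart
  \<open>c0\<close>; the translating element is given by its coordinates \<open>y\<close>.\<close>

definition rfield :: "'e \<Rightarrow> 'e \<Rightarrow> 'e" where
  "rfield v y = frechet_derivative mul0 (at (x0, y)) (v, 0)"

lemma has_derivative_mul0:
  assumes "g \<in> cdom c0"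
  shows "(mul0 has_derivative frechet_derivative mul0 (at (x0, crd c0 g))) (at (x0, crd c0 g))"
  using has_derivative_mul[OF c0(1,1,1) c0(2) assms] cdom_carrier[OF c0(1) assms] assms by (simp add: x0_def)

lemma linear_rfield: 
  assumes "g \<in> cdom c0"
  shows "linear (\<lambda>v. rfield v (crd c0 g))"
  unfolding rfield_def
  using linear_compose[OF _ has_derivative_linear[OF has_derivative_mul0[OF assms]], of "\<lambda>v. (v, 0)"]
  by (simp add: o_def linear_iff)

lemma rfield_one: "rfield v x0 = v"
proof -
  have "((crd c0 \<circ> (\<lambda>q. q \<otimes> \<one>) \<circ> crd_inv c0) has_derivative
    (\<lambda>v. frechet_derivative mul0 (at (crd c0 \<one>, crd c0 \<one>)) (v, 0))) (at (crd c0 \<one>))"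
    using has_derivative_mult[OF c0(1,1,1,1,2) _ _ has_derivative_id_chart[OF c0] _ _ has_derivative_const_chart[of c0 \<one>]]
      c0(2) by (simp add: points_carrier)
  then have "((crd c0 \<circ> crd_inv c0) has_derivative
    (\<lambda>v. frechet_derivative mul0 (at (crd c0 \<one>, crd c0 \<one>)) (v, 0))) (at (crd c0 \<one>))"
    by (rule has_derivative_crd_inv_cong[OF chart[OF c0(1)] openin_cdom[OF chart[OF c0(1)]] c0(2,2), rotated])
      (use cdom_carrier[OF c0(1)] in simp)
  from fun_cong[OF has_derivative_unique[OF this has_derivative_crd[OF chart[OF c0(1)] c0(2)]], of v]
  show ?thesis by (simp add: rfield_def x0_def)
qed

lemma mul0_right:
  assumes g: "g \<in> cdom c0"
  shows "frechet_derivative mul0 (at (x0, crd c0 g)) (0, v) = v"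
proof -
  have "((crd c0 \<circ> (\<lambda>q. \<one> \<otimes> q) \<circ> crd_inv c0) has_derivative
    (\<lambda>v. frechet_derivative mul0 (at (crd c0 \<one>, crd c0 g)) (0, v))) (at (crd c0 g))"
    using has_derivative_mult[OF c0(1,1,1,1) g _ _ has_derivative_const_chart[of c0 \<one>] _ _ has_derivative_id_chart[OF c0(1) g]]
      c0(2) g cdom_carrier[OF c0(1) g] by (simp add: points_carrier)
  then have "((crd c0 \<circ> crd_inv c0) has_derivative
    (\<lambda>v. frechet_derivative mul0 (at (crd c0 \<one>, crd c0 g)) (0, v))) (at (crd c0 g))"
    by (rule has_derivative_crd_inv_cong[OF chart[OF c0(1)] openin_cdom[OF chart[OF c0(1)]] g g, rotated])
      (use cdom_carrier[OF c0(1)] in simp)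
  from fun_cong[OF has_derivative_unique[OF this has_derivative_crd[OF chart[OF c0(1)] g]], of v]
  show ?thesis by (simp add: x0_def)
qed

text \<open>The bilinear second-order term of the multiplication at \<open>(\<one>, \<one>)\<close>.
  It is both the derivative of \<open>lfield v\<close> in the direction \<open>u\<close> and that of
  \<open>rfield u\<close> in the direction \<open>v\<close>, and its antisymmetrization is the
  bracket.\<close>

definition mixed :: "'e \<Rightarrow> 'e \<Rightarrow> 'e" where
  "mixed u v = frechet_derivative (\<lambda>z. frechet_derivative mul0 (at z) (0, v)) (at (x0, x0)) (u, 0)"

lemma smooth_mul0_derivative: 
  "smooth_on (mdom c0 c0 c0) (\<lambda>z. frechet_derivative mul0 (at z) w)"
  by (rule smooth_on_frechet_derivative[OF smooth_mul[OF c0(1,1,1)]])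

lemma mixed_eq: "mixed u v = frechet_derivative (\<lambda>z. frechet_derivative mul0 (at z) (u, 0)) (at (x0, x0)) (0, v)"
  unfolding mixed_def by (rule frechet_derivative_commute[OF open_mdom[OF c0(1,1,1)] z0_in smooth_mul[OF c0(1,1,1)]])

lemma linear_mixed: "linear (\<lambda>u. mixed u v)" "linear (mixed u)"
proof -
  have lin: "linear (frechet_derivative (\<lambda>z. frechet_derivative mul0 (at z) w) (at (x0, x0)))" for w
    by (rule linear_frechet_derivative[OF smooth_on_differentiable[OF smooth_mul0_derivative z0_in]])
  show "linear (\<lambda>u. mixed u v)"
    unfolding mixed_def using linear_compose[OF _ lin, of "\<lambda>u. (u, 0)"] by (simp add: o_def linear_iff)
  show "linear (mixed u)"
    unfolding mixed_eq[abs_def] using linear_compose[OF _ lin, of "\<lambda>v. (0, v)"] by (simp add: o_def linear_iff)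
qed

lemma has_derivative_rfield: "(rfield v has_derivative mixed v) (at x0)"
proof -
  have 1: "((\<lambda>y. (x0, y)) has_derivative (\<lambda>w. (0, w))) (at x0)"
    by (intro has_derivative_Pair has_derivative_ident has_derivative_const)
  have 2: "((\<lambda>z. frechet_derivative mul0 (at z) (v, 0)) has_derivative
      frechet_derivative (\<lambda>z. frechet_derivative mul0 (at z) (v, 0)) (at (x0, x0))) (at (x0, x0))"
    by (rule smooth_on_has_derivative[OF smooth_mul0_derivative z0_in])
  show ?thesis
    using diff_chain_at[OF 1 2] by (simp add: o_def rfield_def[abs_def] mixed_eq[abs_def])
qed

lemma has_derivative_lfield0:
  "((\<lambda>x. lfield v (crd_inv c0 x) c0) has_derivative (\<lambda>u. mixed u v)) (at x0)"
proof -
  have 1: "((\<lambda>x. (x, x0)) has_derivative (\<lambda>w. (w, 0))) (at x0)"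
    by (intro has_derivative_Pair has_derivative_ident has_derivative_const)
  have 2: "((\<lambda>z. frechet_derivative mul0 (at z) (0, v)) has_derivative
      frechet_derivative (\<lambda>z. frechet_derivative mul0 (at z) (0, v)) (at (x0, x0))) (at (x0, x0))"
    by (rule smooth_on_has_derivative[OF smooth_mul0_derivative z0_in])
  have "((\<lambda>x. frechet_derivative mul0 (at (x, x0)) (0, v)) has_derivative (\<lambda>u. mixed u v)) (at x0)"
    using diff_chain_at[OF 1 2] by (simp add: o_def mixed_def)
  then show ?thesis
    by (rule has_derivative_transform_within_open[OF _ open_crd_cdom[OF chart[OF c0(1)]] x0_in])
      (use lfield_mul[OF c0(1) crd_inv_in_cdom[OF chart[OF c0(1)]]] crd_crd_inv[OF chart[OF c0(1)]] in simp)
qed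

lemma lie_br_mixed: "lie_br u v = mixed u v - mixed v u"
  unfolding lie_br_def frechet_derivative_at[OF has_derivative_lfield0, symmetric] ..

lemma linear_lie_br: "linear (\<lambda>u. lie_br u v)" "linear (lie_br u)"
  unfolding lie_br_mixed[abs_def] by (intro linear_compose_sub linear_mixed)+

section \<open>Commutators with a fixed element and the flag that they generate\<close>

abbreviation commutator_map :: "'g \<Rightarrow> 'g \<Rightarrow> 'g" where
  "commutator_map g \<equiv> (\<lambda>x. x \<otimes> g \<otimes> inv x \<otimes> inv g)"

lemma continuous_commutator_map: "g \<in> carrier G \<Longrightarrow> continuous_map (mtop M) (mtop M) (commutator_map g)"
  by (intro continuous_mult continuous_inv) (simp_all add: points_carrier)

text \<open>For \<open>x\<close> near \<open>\<one>\<close> the product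
  \<open>inv x \<otimes> inv g\<close> stays near \<open>inv g\<close>, possibly far from
  \<open>\<one>\<close>. It is followed in a chart \<open>a\<close> around that point, and
  multiplication by \<open>g\<close> brings it back to \<open>c0\<close>; hence the regrouping as
  \<open>q \<otimes> (g \<otimes> (inv q \<otimes> inv g))\<close>.\<close>

lemma commutator_map_derivative:
  assumes g: "g \<in> carrier G"
  shows "\<exists>A. ((crd c0 \<circ> commutator_map g \<circ> crd_inv c0) has_derivative A) (at (crd c0 \<one>))"
proof -
  define a where "a = chart_at M (inv g)"
  have a: "a \<in> atlas M" "inv g \<in> cdom a" using chart_at[of "inv g"] g points_carrier by (auto simp: a_def)
  have "smooth_map M M (\<lambda>x. inv x)" using lie by (simp add: lie_group_def)
  then have "smooth_on (crd c0 ` {p \<in> cdom c0. inv p \<in> cdom c0}) (crd c0 \<circ> (\<lambda>x. inv x) \<circ> crd_inv c0)"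
    using c0 by (simp add: smooth_map_def)
  moreover have "crd c0 \<one> \<in> crd c0 ` {p \<in> cdom c0. inv p \<in> cdom c0}" using c0 by simp
  ultimately obtain A1 where A1: "((crd c0 \<circ> (\<lambda>x. inv x) \<circ> crd_inv c0) has_derivative A1) (at (crd c0 \<one>))"
    using smooth_on_has_derivative by blast
  obtain A2 where A2: "((crd a \<circ> (\<lambda>p. p \<otimes> inv g) \<circ> crd_inv c0) has_derivative A2) (at (crd c0 (inv \<one>)))"
    using differentiable_right[of "inv g" c0 a \<one>] g a c0 by (auto simp: differentiable_def)
  have A12: "((crd a \<circ> (\<lambda>p. p \<otimes> inv g) \<circ> (\<lambda>x. inv x) \<circ> crd_inv c0) has_derivative (\<lambda>u. A2 (A1 u))) (at (crd c0 \<one>))"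
    by (rule has_derivative_chart_compose[OF chart[OF c0(1)] chart[OF c0(1)] c0(2)
          openin_vimage[OF continuous_inv c0(1)] _ _ A1 A2]) (use c0 in auto)
  have A3: "((crd c0 \<circ> (\<lambda>p. g \<otimes> p) \<circ> crd_inv a) has_derivative
      frechet_derivative (crd c0 \<circ> (\<lambda>p. g \<otimes> p) \<circ> crd_inv a) (at (crd a (inv g)))) (at (crd a (inv g)))"
    by (rule has_derivative_left[OF g a(1) c0(1) a(2)]) (use g c0 in simp)
  have ch: "continuous_map (mtop M) (mtop M) (\<lambda>x. inv x \<otimes> inv g)"
    by (intro continuous_mult continuous_inv) (simp_all add: points_carrier g)
  have A123: "((crd c0 \<circ> (\<lambda>p. g \<otimes> p) \<circ> (\<lambda>x. inv x \<otimes> inv g) \<circ> crd_inv c0) has_derivative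
     (\<lambda>u. frechet_derivative (crd c0 \<circ> (\<lambda>p. g \<otimes> p) \<circ> crd_inv a) (at (crd a (inv g))) (A2 (A1 u)))) (at (crd c0 \<one>))"
    by (rule has_derivative_chart_compose[OF chart[OF c0(1)] chart[OF a(1)] c0(2) openin_vimage[OF ch a(1)]])
      (use A12 A3 c0 a g in \<open>auto simp: o_def\<close>)
  have "((crd c0 \<circ> (\<lambda>q. q \<otimes> (g \<otimes> (inv q \<otimes> inv g))) \<circ> crd_inv c0) has_derivative
    (\<lambda>v. frechet_derivative mul0 (at (crd c0 \<one>, crd c0 (g \<otimes> (inv \<one> \<otimes> inv g))))
       (v, frechet_derivative (crd c0 \<circ> (\<lambda>p. g \<otimes> p) \<circ> crd_inv a) (at (crd a (inv g))) (A2 (A1 v))))) (at (crd c0 \<one>))"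
  proof (rule has_derivative_mult[OF c0(1,1,1,1,2)])
    show "continuous_map (mtop M) (mtop M) (\<lambda>q. g \<otimes> (inv q \<otimes> inv g))"
      by (intro continuous_mult continuous_inv) (simp_all add: points_carrier g)
    show "((crd c0 \<circ> (\<lambda>q. q) \<circ> crd_inv c0) has_derivative (\<lambda>v. v)) (at (crd c0 \<one>))"
      by (rule has_derivative_id_chart[OF c0])
    show "((crd c0 \<circ> (\<lambda>q. g \<otimes> (inv q \<otimes> inv g)) \<circ> crd_inv c0) has_derivative
     (\<lambda>u. frechet_derivative (crd c0 \<circ> (\<lambda>p. g \<otimes> p) \<circ> crd_inv a) (at (crd a (inv g))) (A2 (A1 u)))) (at (crd c0 \<one>))"
      using A123 by (simp add: o_def)
  qed (use c0 g in simp_all)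
  then have "((crd c0 \<circ> commutator_map g \<circ> crd_inv c0) has_derivative
    (\<lambda>v. frechet_derivative mul0 (at (crd c0 \<one>, crd c0 (g \<otimes> (inv \<one> \<otimes> inv g))))
       (v, frechet_derivative (crd c0 \<circ> (\<lambda>p. g \<otimes> p) \<circ> crd_inv a) (at (crd a (inv g))) (A2 (A1 v))))) (at (crd c0 \<one>))"
    by (rule has_derivative_crd_inv_cong[OF chart[OF c0(1)] openin_cdom[OF chart[OF c0(1)]] c0(2,2), rotated])
      (use cdom_carrier[OF c0(1)] g in \<open>simp add: m_assoc\<close>)
  then show ?thesis by blast
qed

text \<open>This is the linear map \<open>id - Ad g\<close> in the chart \<open>c0\<close>; since
  \<open>commutator_map g\<close> fixes \<open>\<one>\<close>, the same chart serves on both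
  sides.\<close>

definition commutator_deriv :: "'g \<Rightarrow> 'e \<Rightarrow> 'e" where
  "commutator_deriv g = frechet_derivative (crd c0 \<circ> commutator_map g \<circ> crd_inv c0) (at (crd c0 \<one>))"

lemma has_derivative_commutator_map:
  assumes "g \<in> carrier G"
  shows "((crd c0 \<circ> commutator_map g \<circ> crd_inv c0) has_derivative commutator_deriv g) (at (crd c0 \<one>))"
  unfolding commutator_deriv_def
  using commutator_map_derivative[OF assms] unfolding frechet_derivative_works[symmetric] differentiable_def .

text \<open>Differentiating \<open>[x, g] (g x) = x g\<close> with respect to \<open>x\<close> at \<open>\<one>\<close>.\<close>

lemma rfield_commutator_deriv:
  assumes g: "g \<in> cdom c0"
  shows "rfield (commutator_deriv g v) (crd c0 g) = rfield v (crd c0 g) - lfield v g c0"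
proof -
  note gG = cdom_carrier[OF c0(1) g]
  let ?D = "frechet_derivative mul0 (at (x0, crd c0 g))"
  have eq: "commutator_map g q \<otimes> (g \<otimes> q) = q \<otimes> g" if "q \<in> carrier G" for q
  proof -
    have "inv g \<otimes> (g \<otimes> q) = q" using that gG by (simp flip: m_assoc)
    then show ?thesis using that gG by (simp add: m_assoc)
  qed
  have "((crd c0 \<circ> (\<lambda>q. commutator_map g q \<otimes> (g \<otimes> q)) \<circ> crd_inv c0) has_derivative
    (\<lambda>v. frechet_derivative mul0 (at (crd c0 (commutator_map g \<one>), crd c0 (g \<otimes> \<one>)))
       (commutator_deriv g v, lfield v g c0))) (at (crd c0 \<one>))"
    by (rule has_derivative_mult[OF c0(1,1,1,1,2) continuous_commutator_map[OF gG] _ has_derivative_commutator_map[OF gG]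
          continuous_left[OF gG] _ has_derivative_lfield[OF c0(1) g, unfolded x0_def]])
      (use c0 g gG in \<open>simp_all add: r_inv\<close>)
  then have "((crd c0 \<circ> (\<lambda>q. commutator_map g q \<otimes> (g \<otimes> q)) \<circ> crd_inv c0) has_derivative
    (\<lambda>v. ?D (commutator_deriv g v, lfield v g c0))) (at (crd c0 \<one>))"
    using gG by (simp add: x0_def r_inv)
  then have 1: "((crd c0 \<circ> (\<lambda>q. q \<otimes> g) \<circ> crd_inv c0) has_derivative
    (\<lambda>v. ?D (commutator_deriv g v, lfield v g c0))) (at (crd c0 \<one>))"
    by (rule has_derivative_crd_inv_cong[OF chart[OF c0(1)] openin_cdom[OF chart[OF c0(1)]] c0(2,2), rotated])
      (use cdom_carrier[OF c0(1)] eq in simp)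
  have 2: "((crd c0 \<circ> (\<lambda>q. q \<otimes> g) \<circ> crd_inv c0) has_derivative (\<lambda>v. ?D (v, 0))) (at (crd c0 \<one>))"
    using has_derivative_mult[OF c0(1,1,1,1,2) _ _ has_derivative_id_chart[OF c0] _ _ has_derivative_const_chart[of c0 g]]
      c0(2) g gG by (simp add: points_carrier x0_def)
  have "?D (commutator_deriv g v, lfield v g c0) = ?D (v, 0)"
    using fun_cong[OF has_derivative_unique[OF 1 2], of v] .
  moreover have "?D (commutator_deriv g v, lfield v g c0) = ?D (commutator_deriv g v, 0) + ?D (0, lfield v g c0)"
    using linear_add[OF has_derivative_linear[OF has_derivative_mul0[OF g]], of "(commutator_deriv g v, 0)" "(0, lfield v g c0)"]
    by simp
  ultimately show ?thesis by (simp add: mul0_right[OF g] rfield_def algebra_simps)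
qed

text \<open>A substitute for the tangent space of \<open>lower_central G k\<close> at
  \<open>\<one>\<close>. Continuity, a derivative at the single point \<open>\<one>\<close> and
  \<open>F \<one> = \<one>\<close> are the conditions that survive composition with
  \<open>commutator_map g\<close>.\<close>

definition flag_gens :: "nat \<Rightarrow> 'e set" where
  "flag_gens k = {L v |F L v. continuous_map (mtop M) (mtop M) F \<and> F \<one> = \<one> \<and> F ` carrier G \<subseteq> lower_central G k \<and>
     ((crd c0 \<circ> F \<circ> crd_inv c0) has_derivative L) (at (crd c0 \<one>))}"

definition flag :: "nat \<Rightarrow> 'e set" where
  "flag k = span (flag_gens k)"

lemma flag_gens_0: "v \<in> flag_gens 0"
  unfolding flag_gens_def using has_derivative_id_chart[OF c0]
  by (intro CollectI exI[of _ "\<lambda>q. q"] exI[of _ "\<lambda>v. v"] exI[of _ v]) auto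

lemma flag_0: "flag 0 = UNIV"
  unfolding flag_def using flag_gens_0 span_superset by blast

lemma flag_Suc_subset: "flag (Suc k) \<subseteq> flag k"
  unfolding flag_def flag_gens_def using lower_central_Suc_subset by (intro span_mono) blast

text \<open>A map into the trivial group is constant, so its derivative is 0.\<close>

lemma flag_trivial:
  assumes "lower_central G n = {\<one>}"
  shows "flag n = {0}"
proof -
  have "w = 0" if w: "w \<in> flag_gens n" for w
  proof -
    obtain F L v where F: "w = L v" "F ` carrier G \<subseteq> {\<one>}"
      "((crd c0 \<circ> F \<circ> crd_inv c0) has_derivative L) (at (crd c0 \<one>))"
      using w assms unfolding flag_gens_def by auto
    have F1: "F q = \<one>" if "q \<in> cdom c0" for q
      using F(2) cdom_carrier[OF c0(1) that] by blast
    have "((crd c0 \<circ> (\<lambda>_. \<one>) \<circ> crd_inv c0) has_derivative L) (at (crd c0 \<one>))"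
      by (rule has_derivative_crd_inv_cong[OF chart[OF c0(1)] openin_cdom[OF chart[OF c0(1)]] c0(2,2) _ F(3)])
        (simp add: F1)
    from has_derivative_unique[OF this has_derivative_const_chart] show ?thesis by (simp add: F(1))
  qed
  then have "flag_gens n \<subseteq> {0}" by blast
  then have "flag n \<subseteq> {0}" unfolding flag_def using span_minimal subspace_single_0 by blast
  then show ?thesis using span_zero[of "flag_gens n"] unfolding flag_def by blast
qed

text \<open>Composition with \<open>commutator_map g\<close> moves the values of \<open>F\<close>
  one step down the lower central series.\<close>

lemma commutator_deriv_flag_gens:
  assumes v: "v \<in> flag_gens k" and g: "g \<in> carrier G"
  shows "commutator_deriv g v \<in> flag_gens (Suc k)"
proof -
  obtain F L u where F: "v = L u" "continuous_map (mtop M) (mtop M) F" "F \<one> = \<one>" "F ` carrier G \<subseteq> lower_central G k"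
    "((crd c0 \<circ> F \<circ> crd_inv c0) has_derivative L) (at (crd c0 \<one>))"
    using v unfolding flag_gens_def by auto
  have "((crd c0 \<circ> commutator_map g \<circ> F \<circ> crd_inv c0) has_derivative (\<lambda>u. commutator_deriv g (L u))) (at (crd c0 \<one>))"
    by (rule has_derivative_chart_compose[where G = "crd c0 \<circ> commutator_map g",
          OF chart[OF c0(1)] chart[OF c0(1)] c0(2) openin_vimage[OF F(2) c0(1)] _ _ F(5)])
      (use c0 F(3) has_derivative_commutator_map[OF g] in simp_all)
  then have D: "((crd c0 \<circ> (commutator_map g \<circ> F) \<circ> crd_inv c0) has_derivative (\<lambda>u. commutator_deriv g (L u))) (at (crd c0 \<one>))"
    by (simp add: o_assoc)
  have "(commutator_map g \<circ> F) \<one> = \<one>" using F(3) g by simp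
  moreover have "(commutator_map g \<circ> F) ` carrier G \<subseteq> lower_central G (Suc k)"
    using F(4) lower_central_commutator[OF _ g] by auto
  moreover note continuous_map_compose[OF F(2) continuous_commutator_map[OF g]] D
  ultimately show ?thesis
    unfolding flag_gens_def F(1)
    by (intro CollectI exI[of _ "commutator_map g \<circ> F"] exI[of _ "\<lambda>u. commutator_deriv g (L u)"] exI[of _ u] conjI) auto
qed

text \<open>\<open>[v, w]\<close> is the derivative at \<open>\<one>\<close> in the direction \<open>w\<close> of \<open>g \<mapsto> commutator_deriv g v\<close>, a function
  with values in the subspace \<open>flag (Suc k)\<close>.\<close>

lemma lie_br_flag_gens:
  assumes v: "v \<in> flag_gens k"
  shows "lie_br v w \<in> flag (Suc k)"
proof -
  define f where "f = (\<lambda>y. commutator_deriv (crd_inv c0 y) v)"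
  define X where "X = (\<lambda>y. rfield v y - lfield v (crd_inv c0 y) c0)"
  let ?S = "crd c0 ` cdom c0"
  note cc = chart[OF c0(1)]
  have sol: "rfield (f y) y = X y" if "y \<in> ?S" for y
    using rfield_commutator_deriv[OF crd_inv_in_cdom[OF cc that], of v] crd_crd_inv[OF cc that]
    by (simp add: f_def X_def)
  have lin: "linear (\<lambda>u. rfield u y)" if "y \<in> ?S" for y
    using linear_rfield[OF crd_inv_in_cdom[OF cc that]] crd_crd_inv[OF cc that] by simp
  have dX: "(X has_derivative (\<lambda>w. mixed v w - mixed w v)) (at x0)"
    unfolding X_def by (intro has_derivative_diff has_derivative_rfield has_derivative_lfield0)
  \<comment> \<open>Differentiability in the parameter is not visible from the definition of
    \<open>commutator_deriv\<close>; it comes from the linear system \<open>sol\<close>, whose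
    operator at \<open>x0\<close> is the identity.\<close>
  have "f differentiable (at x0)"
  proof (rule linear_system_solution_differentiable[where A = "\<lambda>y u. rfield u y" and X = X, OF open_crd_cdom[OF cc] x0_in])
    show "inj (\<lambda>u. rfield u x0)" by (simp add: rfield_one inj_on_def)
    show "(\<lambda>y. rfield u y) differentiable (at x0)" for u
      using has_derivative_rfield unfolding differentiable_def by blast
    show "X differentiable (at x0)" using dX unfolding differentiable_def by blast
  qed (use sol lin in auto)
  then obtain f' where f': "(f has_derivative f') (at x0)" unfolding differentiable_def by blast
  \<comment> \<open>Because of this the derivatives of the operators \<open>rfield\<close> do not
    contribute, and \<open>X\<close> and \<open>f\<close> have the same derivative at
    \<open>x0\<close>.\<close>
  have f0: "f x0 = 0"
    using sol[OF x0_in] by (simp add: rfield_one X_def crd_inv_x0 lfield_one)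
  have "((\<lambda>y. \<Sum>b\<in>Basis. (f y \<bullet> b) *\<^sub>R rfield b y) has_derivative
    (\<lambda>w. \<Sum>b\<in>Basis. (f x0 \<bullet> b) *\<^sub>R mixed b w + (f' w \<bullet> b) *\<^sub>R rfield b x0)) (at x0)"
    by (intro has_derivative_sum has_derivative_scaleR has_derivative_inner_left f' has_derivative_rfield)
  then have "((\<lambda>y. \<Sum>b\<in>Basis. (f y \<bullet> b) *\<^sub>R rfield b y) has_derivative f') (at x0)"
    by (simp add: f0 rfield_one euclidean_representation)
  then have "(X has_derivative f') (at x0)"
    by (rule has_derivative_transform_within_open[OF _ open_crd_cdom[OF cc] x0_in])
      (use linear_expand_Basis[OF lin] sol in metis)
  from fun_cong[OF has_derivative_unique[OF this dX], of w]
  have f'w: "f' w = lie_br v w" by (simp add: lie_br_mixed)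
  have sub: "subspace (flag (Suc k))" unfolding flag_def by (rule subspace_span)
  \<comment> \<open>\<open>Q\<close> is a projection onto the flag space. As \<open>f\<close> takes
    its values there, \<open>f - Q f\<close> vanishes near \<open>x0\<close>, which forces
    \<open>f' w\<close> into the same space.\<close>
  obtain Q where Q: "\<And>z. Q z \<in> flag (Suc k)" "linear Q" "\<And>z. z \<in> flag (Suc k) \<Longrightarrow> Q z = z"
    using linear_exists_left_inverse_on[OF linear_id sub] by (auto simp: inj_on_def)
  have bl: "bounded_linear (\<lambda>z. z - Q z)"
    using Q(2) by (intro bounded_linear_sub bounded_linear_ident) (simp add: linear_conv_bounded_linear)
  have "((\<lambda>y. f y - Q (f y)) has_derivative (\<lambda>w. f' w - Q (f' w))) (at x0)"
    by (rule bounded_linear.has_derivative[OF bl f'])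
  moreover have "f y - Q (f y) = 0" if "y \<in> ?S" for y
  proof -
    have "f y \<in> flag_gens (Suc k)"
      unfolding f_def using commutator_deriv_flag_gens[OF v] crd_inv_in_cdom[OF cc that] cdom_carrier[OF c0(1)] by blast
    then show ?thesis using Q(3) span_superset unfolding flag_def by fastforce
  qed
  ultimately have "((\<lambda>y. 0) has_derivative (\<lambda>w. f' w - Q (f' w))) (at x0)"
    by (rule has_derivative_transform_within_open[OF _ open_crd_cdom[OF cc] x0_in])
  from fun_cong[OF has_derivative_unique[OF this has_derivative_const], of w]
  show ?thesis using Q(1)[of "lie_br v w"] by (simp add: f'w)
qed

text \<open>\<open>lie_br_flag_gens\<close> treats a generator in the first argument; linearity
  extends this to the span, and skew-symmetry moves it to the second argument.\<close>

lemma lie_br_flag: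
  assumes "v \<in> flag k"
  shows "lie_br u v \<in> flag (Suc k)"
proof -
  have "subspace (flag (Suc k))" unfolding flag_def by (rule subspace_span)
  from linear_subspace_vimage[OF linear_lie_br(1)[of u] this]
  have "subspace {v. lie_br v u \<in> flag (Suc k)}" by (simp add: vimage_def)
  then have "flag k \<subseteq> {v. lie_br v u \<in> flag (Suc k)}"
    using lie_br_flag_gens unfolding flag_def[of k] by (intro span_minimal) blast
  then have "- lie_br v u \<in> flag (Suc k)"
    using assms \<open>subspace (flag (Suc k))\<close> subspace_neg by blast
  then show ?thesis by (simp add: lie_br_mixed)
qed

end


section \<open>The quotient by a discrete subgroup\<close>

text \<open>Transition maps of the quotient are left translations by elements of the subgroup that
  change from point to point, so their smoothness is obtained locally.\<close>

lemma smooth_on_local: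
  assumes "\<And>x. x \<in> S \<Longrightarrow> \<exists>U. open U \<and> x \<in> U \<and> smooth_on U f"
  shows "smooth_on S f"
proof -
  have "Ck_on k S f" if "\<And>x. x \<in> S \<Longrightarrow> \<exists>U. open U \<and> x \<in> U \<and> Ck_on k U f" for k
    using that
  proof (induction k arbitrary: f)
    case 0
    show ?case
      unfolding Ck_on.simps
    proof (rule continuous_at_imp_continuous_on, rule ballI)
      fix x assume "x \<in> S"
      then obtain U where "open U" "x \<in> U" "continuous_on U f" using 0 by force
      then show "isCont f x" by (simp add: continuous_on_eq_continuous_at)
    qed
  next
    case (Suc k)
    have "Ck_on k S (\<lambda>x. frechet_derivative f (at x) v)" for v
    proof (rule Suc.IH)
      show "\<exists>U. open U \<and> x \<in> U \<and> Ck_on k U (\<lambda>x. frechet_derivative f (at x) v)" if "x \<in> S" for x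
        using Suc.prems[OF that] unfolding Ck_on.simps by blast
    qed
    then show ?case using Suc.prems unfolding Ck_on.simps by blast
  qed
  then show ?thesis using assms unfolding smooth_on_def by meson
qed

context lie_group_manifold
begin

text \<open>Defined through \<open>tangent_map\<close> because left-invariance of the complex
  structures is a statement about that map; \<open>lvec_component\<close> connects it with
  \<open>lfield\<close>.\<close>

definition lvec :: "'e \<Rightarrow> 'g \<Rightarrow> ('g, 'e) tvec" where
  "lvec v g = tangent_map M M (\<lambda>x. g \<otimes> x) \<one> (tvec_of M \<one> c0 v)"

lemma lvec_component: "d \<in> atlas M \<Longrightarrow> g \<in> cdom d \<Longrightarrow> lvec v g d = lfield v g d"
  using cdom_carrier[of d g] tvec_of_tangent_space(2)[OF c0]
  by (simp add: lvec_def tangent_map_def lfield_def x0_def Let_def flip: c0_def)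

lemma lvec_tangent_space:
  assumes g: "g \<in> carrier G"
  shows "lvec v g \<in> tangent_space M g"
proof -
  have "lvec v g d = frechet_derivative (transition c d) (at (crd c g)) (lvec v g c)"
    if c: "c \<in> atlas M" "g \<in> cdom c" and d: "d \<in> atlas M" "g \<in> cdom d" for c d
  proof -
    have "((crd d \<circ> (\<lambda>p. \<one> \<otimes> p) \<circ> crd_inv c) has_derivative
        frechet_derivative (crd d \<circ> (\<lambda>p. \<one> \<otimes> p) \<circ> crd_inv c) (at (crd c g))) (at (crd c g))"
      by (rule has_derivative_left[OF one_closed c(1) d(1) c(2)]) (use g d in simp)
    then have "((crd d \<circ> crd_inv c) has_derivative
        frechet_derivative (crd d \<circ> (\<lambda>p. \<one> \<otimes> p) \<circ> crd_inv c) (at (crd c g))) (at (crd c g))"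
      by (rule has_derivative_crd_inv_cong[OF chart[OF c(1)] openin_cdom[OF chart[OF c(1)]] c(2,2), rotated])
        (use cdom_carrier[OF c(1)] in simp)
    from frechet_derivative_at[OF this] show ?thesis
      using lfield_translate[OF one_closed c(1) d(1) c(2), of v] c d g
      by (simp add: lvec_component transition_def)
  qed
  moreover have "lvec v g c = 0" if "\<not> (c \<in> atlas M \<and> g \<in> cdom c)" for c
    using that g by (auto simp: lvec_def tangent_map_def)
  ultimately show ?thesis
    unfolding tangent_space_def by blast
qed

definition endo_alg :: "('g, 'e) endo \<Rightarrow> 'e \<Rightarrow> 'e" where
  "endo_alg S v = S \<one> (tvec_of M \<one> c0 v) c0"

context
  fixes S assumes S: "endo_field M S"
begin

lemma endo_tvec_of: "S \<one> (tvec_of M \<one> c0 v) = tvec_of M \<one> c0 (endo_alg S v)"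
proof -
  have "S \<one> (tvec_of M \<one> c0 v) \<in> tangent_space M \<one>"
    using S tvec_of_tangent_space(1)[OF c0] by (simp add: endo_field_def points_carrier)
  from tvec_of_component[OF c0 this] show ?thesis by (simp add: endo_alg_def)
qed

lemma linear_endo_alg: "linear (endo_alg S)"
proof -
  have tv: "tvec_of M \<one> c0 (a *\<^sub>R u + b *\<^sub>R v) = (\<lambda>c. a *\<^sub>R tvec_of M \<one> c0 u c + b *\<^sub>R tvec_of M \<one> c0 v c)" for a b u v
    by (rule tangent_space_eqI[OF _ _ c0])
      (simp_all add: tvec_of_tangent_space[OF c0] tangent_space_add tangent_space_scaleR)
  have "S \<one> (\<lambda>c. a *\<^sub>R tvec_of M \<one> c0 u c + b *\<^sub>R tvec_of M \<one> c0 v c)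
      = (\<lambda>c. a *\<^sub>R S \<one> (tvec_of M \<one> c0 u) c + b *\<^sub>R S \<one> (tvec_of M \<one> c0 v) c)" for a b u v
    using S tvec_of_tangent_space(1)[OF c0] unfolding endo_field_def points_carrier by blast
  then have *: "endo_alg S (a *\<^sub>R u + b *\<^sub>R v) = a *\<^sub>R endo_alg S u + b *\<^sub>R endo_alg S v" for a b u v
    unfolding endo_alg_def tv by simp
  show ?thesis
    using *[of 1 _ 1] *[of _ _ 0] by (simp add: linear_iff)
qed

text \<open>Holomorphy of the translation by \<open>g\<close>, applied at the point
  \<open>\<one>\<close>.\<close>

lemma endo_lvec:
  assumes "left_invariant G M S" "g \<in> carrier G"
  shows "S g (lvec v g) = lvec (endo_alg S v) g"
proof -
  have "tangent_map M M (\<lambda>x. g \<otimes> x) \<one> (S \<one> (tvec_of M \<one> c0 v)) = S (g \<otimes> \<one>) (lvec v g)"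
    using assms tvec_of_tangent_space(1)[OF c0]
    unfolding left_invariant_def holomorphic_map_def lvec_def by (simp add: points_carrier)
  then show ?thesis using assms(2) by (simp add: endo_tvec_of lvec_def)
qed

end

lemma endo_alg_square:
  assumes "almost_complex M S"
  shows "endo_alg S (endo_alg S v) = - v"
proof -
  have "endo_field M S" using assms by (simp add: almost_complex_def)
  from endo_tvec_of[OF this] have "endo_alg S (endo_alg S v) = S \<one> (S \<one> (tvec_of M \<one> c0 v)) c0"
    by (simp add: endo_alg_def)
  then show ?thesis
    using assms tvec_of_tangent_space[OF c0] by (simp add: almost_complex_def points_carrier)
qed

lemma endo_alg_anticommute:
  assumes "hypercomplex M I J K"
  shows "endo_alg J (endo_alg I v) = - endo_alg I (endo_alg J v)"
proof -
  have IJ: "endo_field M I" "endo_field M J"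
    using assms by (simp_all add: hypercomplex_def integrable_acs_def almost_complex_def)
  have "(\<lambda>c. - J \<one> (I \<one> (tvec_of M \<one> c0 v)) c) = I \<one> (J \<one> (tvec_of M \<one> c0 v))"
    using assms tvec_of_tangent_space(1)[OF c0] by (simp add: hypercomplex_def points_carrier)
  from fun_cong[OF this, of c0] have "- endo_alg J (endo_alg I v) = endo_alg I (endo_alg J v)"
    by (simp add: endo_tvec_of[OF IJ(1)] endo_tvec_of[OF IJ(2)] tvec_of_tangent_space(2)[OF c0])
  then show ?thesis by (metis minus_minus)
qed

end

locale lie_group_quotient = lie_group_manifold G M
  for G :: "('g, 'b) monoid_scheme" (structure) and M :: "('g, 'e::euclidean_space) manifold" +
  fixes \<Gamma> :: "'g set"
  assumes discrete: "discrete_subgroup \<Gamma> G (mtop M)"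
begin

abbreviation \<pi> :: "'g \<Rightarrow> 'g set" where "\<pi> \<equiv> coset_proj G \<Gamma>"

abbreviation N :: "('g set, 'e) manifold" where "N \<equiv> quotient_manifold G M \<Gamma>"

lemma subgroup: "subgroup \<Gamma> G"
  using discrete by (simp add: discrete_subgroup_def)

lemma in_group: "\<gamma> \<in> \<Gamma> \<Longrightarrow> \<gamma> \<in> carrier G"
  using subgroup.mem_carrier[OF subgroup] .

lemma proj_translate:
  assumes "\<gamma> \<in> \<Gamma>" "g \<in> carrier G"
  shows "\<pi> (\<gamma> \<otimes> g) = \<pi> g"
proof -
  have "\<gamma> \<otimes> g \<in> \<pi> g" using assms by (auto simp: r_coset_def)
  from repr_independence[OF this assms(2) subgroup] show ?thesis by simp
qed

lemma proj_eqE: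
  assumes "\<pi> g = \<pi> h" "g \<in> carrier G" "h \<in> carrier G"
  obtains \<gamma> where "\<gamma> \<in> \<Gamma>" "h = \<gamma> \<otimes> g"
  using rcos_self[OF assms(3) subgroup] assms(1) by (auto simp: r_coset_def)

lemma mtop_N: "mtop N = quotient_top (mtop M) \<pi>"
  by (simp add: quotient_manifold_def)

lemma points_N: "points N = \<pi> ` carrier G"
  by (simp add: mtop_N topspace_quotient_top points_carrier)

text \<open>The saturation of \<open>U\<close> is the union of its preimages under the translations
  by elements of \<open>\<Gamma>\<close>, each of which is open.\<close>

lemma open_proj:
  assumes "openin (mtop M) U"
  shows "openin (mtop N) (\<pi> ` U)"
proof -
  have U: "U \<subseteq> carrier G" using openin_subset[OF assms] points_carrier by simp
  have "{x \<in> carrier G. \<pi> x \<in> \<pi> ` U} = (\<Union>\<gamma>\<in>\<Gamma>. {x \<in> carrier G. \<gamma> \<otimes> x \<in> U})" (is "?l = ?r")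
  proof
    show "?l \<subseteq> ?r"
    proof
      fix x assume "x \<in> ?l"
      then obtain u where u: "x \<in> carrier G" "u \<in> U" "\<pi> x = \<pi> u" by auto
      then obtain \<gamma> where "\<gamma> \<in> \<Gamma>" "u = \<gamma> \<otimes> x" using proj_eqE U by (metis subsetD)
      then show "x \<in> ?r" using u by auto
    qed
    show "?r \<subseteq> ?l"
    proof
      fix x assume "x \<in> ?r"
      then obtain \<gamma> where "\<gamma> \<in> \<Gamma>" "x \<in> carrier G" "\<gamma> \<otimes> x \<in> U" by blast
      then show "x \<in> ?l" using proj_translate[of \<gamma> x] by (auto intro!: image_eqI[of _ _ "\<gamma> \<otimes> x"])
    qed
  qed
  moreover have "openin (mtop M) {x \<in> carrier G. \<gamma> \<otimes> x \<in> U}" if "\<gamma> \<in> \<Gamma>" for \<gamma>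
    using openin_continuous_map_preimage[OF continuous_left[OF in_group[OF that]] assms] by (simp add: points_carrier)
  ultimately show ?thesis
    using U unfolding mtop_N openin_quotient_top points_carrier by (auto intro!: openin_Union)
qed

lemma open_proj_preimage:
  "openin (mtop N) V \<Longrightarrow> openin (mtop M) {x \<in> carrier G. \<pi> x \<in> V}"
  unfolding mtop_N openin_quotient_top points_carrier by simp

section \<open>Charts of the quotient\<close>

definition sheet :: "('g, 'e) chart \<Rightarrow> 'g set \<Rightarrow> bool" where
  "sheet c W \<longleftrightarrow> c \<in> atlas M \<and> openin (mtop M) W \<and> W \<subseteq> cdom c \<and> inj_on \<pi> W"

definition qchart :: "('g, 'e) chart \<Rightarrow> 'g set \<Rightarrow> ('g set, 'e) chart" where
  "qchart c W = (\<pi> ` W, crd c \<circ> inv_into W \<pi>)"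

lemma atlas_N: "atlas N = {qchart c W |c W. sheet c W}"
  by (simp add: quotient_manifold_def qchart_def sheet_def conj_assoc)

lemma qchart_atlas: "sheet c W \<Longrightarrow> qchart c W \<in> atlas N"
  unfolding atlas_N by blast

text \<open>If \<open>U\<close> meets \<open>\<Gamma>\<close> in \<open>\<one>\<close> only, the projection is injective on an open set \<open>W\<close> with
  \<open>W W\<^sup>-\<^sup>1 \<subseteq> U\<close>.\<close>

lemma sheet_exists:
  assumes g: "g \<in> carrier G"
  obtains c W where "sheet c W" "g \<in> W"
proof -
  have "openin (subtopology (mtop M) \<Gamma>) {\<one>}"
    using discrete subgroup.one_closed[OF subgroup] by (simp add: discrete_subgroup_def)
  then obtain U where U: "openin (mtop M) U" "{\<one>} = U \<inter> \<Gamma>" by (auto simp: openin_subtopology)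
  then have one: "\<one> \<in> U" by blast
  let ?P = "prod_topology (mtop M) (mtop M)"
  have "continuous_map ?P (mtop M) (\<lambda>z. fst z \<otimes> inv (snd z))"
    by (intro continuous_mult continuous_map_fst continuous_map_compose[OF continuous_map_snd continuous_inv, unfolded o_def])
  note oP = openin_continuous_map_preimage[OF this U(1)]
  have "\<exists>A B. openin (mtop M) A \<and> openin (mtop M) B \<and> g \<in> A \<and> g \<in> B \<and>
      A \<times> B \<subseteq> {z \<in> topspace ?P. fst z \<otimes> inv (snd z) \<in> U}"
    using iffD1[OF openin_prod_topology_alt oP, rule_format, of g g] g one by (simp add: points_carrier)
  then obtain A B where AB: "openin (mtop M) A" "openin (mtop M) B" "g \<in> A" "g \<in> B"
      "A \<times> B \<subseteq> {z \<in> topspace ?P. fst z \<otimes> inv (snd z) \<in> U}"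
    by blast
  define c where "c = chart_at M g"
  have c: "c \<in> atlas M" "g \<in> cdom c" using chart_at[of g] g points_carrier by (auto simp: c_def)
  define W where "W = A \<inter> B \<inter> cdom c"
  have "inj_on \<pi> W"
  proof (rule inj_onI)
    fix x y assume xy: "x \<in> W" "y \<in> W" "\<pi> x = \<pi> y"
    then have cxy: "x \<in> carrier G" "y \<in> carrier G" using cdom_carrier[OF c(1)] by (auto simp: W_def)
    then obtain \<gamma> where \<gamma>: "\<gamma> \<in> \<Gamma>" "y = \<gamma> \<otimes> x" using proj_eqE[OF xy(3)] by blast
    have "(y, x) \<in> A \<times> B" using xy by (simp add: W_def)
    then have "y \<otimes> inv x \<in> U" using AB(5) by fastforce
    moreover have "y \<otimes> inv x = \<gamma>" using \<gamma> in_group cxy by (simp add: m_assoc)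
    ultimately have "\<gamma> = \<one>" using U(2) \<gamma>(1) by blast
    then show "x = y" using \<gamma>(2) cxy by simp
  qed
  then have "sheet c W"
    using c AB openin_cdom[OF chart[OF c(1)]] by (auto simp: sheet_def W_def intro!: openin_Int)
  moreover have "g \<in> W" using AB c by (simp add: W_def)
  ultimately show thesis by (rule that)
qed

context
  fixes c W assumes cW: "sheet c W"
begin

lemma sheet_atlas: "c \<in> atlas M" and sheet_open: "openin (mtop M) W" and sheet_cdom: "W \<subseteq> cdom c"
  and sheet_inj: "inj_on \<pi> W"
  using cW by (simp_all add: sheet_def)

lemma sheet_carrier: "p \<in> W \<Longrightarrow> p \<in> carrier G"
  using sheet_cdom cdom_carrier[OF sheet_atlas] by blast

lemma crd_qchart: "p \<in> W \<Longrightarrow> crd (qchart c W) (\<pi> p) = crd c p"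
  by (simp add: qchart_def sheet_inj)

lemma cdom_qchart: "cdom (qchart c W) = \<pi> ` W"
  by (simp add: qchart_def)

lemma image_qchart: "V \<subseteq> W \<Longrightarrow> crd (qchart c W) ` \<pi> ` V = crd c ` V"
  using crd_qchart by (force simp: image_iff)

lemma crd_inv_qchart: 
  assumes "x \<in> crd c ` W"
  shows "crd_inv (qchart c W) x = \<pi> (crd_inv c x)" "crd_inv c x \<in> W"
proof -
  obtain p where p: "p \<in> W" "x = crd c p" using assms by blast
  then have x: "crd_inv c x = p" using crd_inv_crd[OF chart[OF sheet_atlas]] sheet_cdom by blast
  then show "crd_inv c x \<in> W" using p by simp
  have "inj_on (crd (qchart c W)) (\<pi> ` W)"
    using inj_on_subset[OF inj_on_crd[OF chart[OF sheet_atlas]] sheet_cdom]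
    by (auto simp: inj_on_def crd_qchart)
  then have "inv_into (\<pi> ` W) (crd (qchart c W)) (crd (qchart c W) (\<pi> p)) = \<pi> p"
    using p by (simp add: inv_into_f_f)
  then show "crd_inv (qchart c W) x = \<pi> (crd_inv c x)"
    unfolding x by (simp add: crd_inv_def cdom_qchart crd_qchart[OF p(1)] p(2))
qed

text \<open>On \<open>W\<close> the projection is injective, and \<open>c\<close> is a homeomorphism
  onto its image. Continuity of the composed chart is the openness of the projection, and its
  openness is the continuity of the projection.\<close>

lemma chart_on_qchart: "chart_on (mtop N) (qchart c W)"
proof -
  note cc = chart[OF sheet_atlas]
  have im: "crd (qchart c W) ` \<pi> ` W = crd c ` W" by (rule image_qchart) simp
  have oW: "open (crd c ` W)" by (rule open_crd_image[OF cc sheet_open sheet_cdom])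
  have top: "topspace (subtopology (mtop N) (\<pi> ` W)) = \<pi> ` W"
    using openin_subset[OF open_proj[OF sheet_open]] by (simp add: Int_absorb1)
  have "homeomorphic_map (subtopology (mtop N) (\<pi> ` W)) (top_of_set (crd c ` W)) (crd (qchart c W))"
  proof (rule bijective_open_imp_homeomorphic_map)
    show "continuous_map (subtopology (mtop N) (\<pi> ` W)) (top_of_set (crd c ` W)) (crd (qchart c W))"
      unfolding continuous_map_def
    proof (intro conjI allI impI)
      show "crd (qchart c W) \<in> topspace (subtopology (mtop N) (\<pi> ` W)) \<rightarrow> topspace (top_of_set (crd c ` W))"
        unfolding top using im by auto
      fix U assume U: "openin (top_of_set (crd c ` W)) U"
      then have "open U" using oW openin_open_eq by blast
      then have "openin (top_of_set (crd c ` cdom c)) (crd c ` cdom c \<inter> U)"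
        by (simp add: openin_open_Int)
      from openin_continuous_map_preimage[OF homeomorphic_imp_continuous_map[OF chart_homeomorphic_map[OF cc]] this]
      have "openin (subtopology (mtop M) (cdom c)) {p \<in> cdom c. crd c p \<in> U}"
        using openin_subset[OF openin_cdom[OF cc]] by (simp add: Int_absorb1 conj_commute cong: conj_cong)
      then have "openin (mtop M) {p \<in> cdom c. crd c p \<in> U}"
        using openin_cdom[OF cc] openin_trans_full by blast
      then have "openin (mtop M) (W \<inter> {p \<in> cdom c. crd c p \<in> U})"
        using sheet_open by (intro openin_Int)
      then have "openin (mtop N) (\<pi> ` (W \<inter> {p \<in> cdom c. crd c p \<in> U}))" by (rule open_proj)
      moreover have "\<pi> ` (W \<inter> {p \<in> cdom c. crd c p \<in> U}) = {x \<in> \<pi> ` W. crd (qchart c W) x \<in> U}"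
        using sheet_cdom by (auto simp: crd_qchart)
      ultimately show "openin (subtopology (mtop N) (\<pi> ` W))
          {x \<in> topspace (subtopology (mtop N) (\<pi> ` W)). crd (qchart c W) x \<in> U}"
        unfolding top by (simp add: openin_subtopology_alt) blast
    qed
    show "open_map (subtopology (mtop N) (\<pi> ` W)) (top_of_set (crd c ` W)) (crd (qchart c W))"
      unfolding open_map_def
    proof (intro allI impI)
      fix V assume V: "openin (subtopology (mtop N) (\<pi> ` W)) V"
      then have VN: "openin (mtop N) V" "V \<subseteq> \<pi> ` W"
        using openin_trans_full[OF _ open_proj[OF sheet_open]] openin_subset[OF V] top by auto
      have "openin (mtop M) (W \<inter> {x \<in> carrier G. \<pi> x \<in> V})"
        using sheet_open open_proj_preimage[OF VN(1)] by (rule openin_Int)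
      then have "open (crd c ` (W \<inter> {x \<in> carrier G. \<pi> x \<in> V}))"
        using sheet_cdom by (intro open_crd_image[OF cc]) auto
      moreover have "crd (qchart c W) ` V = crd c ` (W \<inter> {x \<in> carrier G. \<pi> x \<in> V})"
      proof -
        have "V = \<pi> ` (W \<inter> {x \<in> carrier G. \<pi> x \<in> V})"
          using VN(2) sheet_carrier by (auto simp: image_iff)
        then show ?thesis using image_qchart[of "W \<inter> {x \<in> carrier G. \<pi> x \<in> V}"] by simp
      qed
      ultimately show "openin (top_of_set (crd c ` W)) (crd (qchart c W) ` V)"
        by (auto intro: open_subset)
    qed
    show "crd (qchart c W) ` topspace (subtopology (mtop N) (\<pi> ` W)) = topspace (top_of_set (crd c ` W))"
      unfolding top im by simp
    show "inj_on (crd (qchart c W)) (topspace (subtopology (mtop N) (\<pi> ` W)))"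
      unfolding top using inj_on_subset[OF inj_on_crd[OF cc] sheet_cdom] by (auto simp: inj_on_def crd_qchart)
  qed
  then show ?thesis
    using oW open_proj[OF sheet_open] by (simp add: chart_on_def cdom_qchart im)
qed

text \<open>The section of the projection with values in \<open>W\<close> differs from any given
  lift by an element of \<open>\<Gamma>\<close>; this turns transition maps into
  translations.\<close>

lemma inv_into_proj:
  assumes "\<gamma> \<in> \<Gamma>" "p \<in> carrier G" "\<gamma> \<otimes> p \<in> W"
  shows "inv_into W \<pi> (\<pi> p) = \<gamma> \<otimes> p"
  using inv_into_f_f[OF sheet_inj assms(3)] proj_translate[OF assms(1,2)] by simp

end

text \<open>Near a point, the transition maps of the quotient are left translations in the charts of the group.\<close>

lemma has_derivative_qchart:
  assumes dW: "sheet d W" and c: "c \<in> atlas M" "g \<in> cdom c" and \<gamma>: "\<gamma> \<in> \<Gamma>" "\<gamma> \<otimes> g \<in> W"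
  shows "((crd (qchart d W) \<circ> \<pi> \<circ> crd_inv c) has_derivative
     frechet_derivative (crd d \<circ> (\<lambda>p. \<gamma> \<otimes> p) \<circ> crd_inv c) (at (crd c g))) (at (crd c g))"
proof -
  have g: "g \<in> carrier G" by (rule cdom_carrier[OF c])
  have "openin (mtop M) {p \<in> carrier G. \<gamma> \<otimes> p \<in> W}"
    using openin_continuous_map_preimage[OF continuous_left[OF in_group[OF \<gamma>(1)]] sheet_open[OF dW]]
    by (simp add: points_carrier)
  moreover have "((crd d \<circ> (\<lambda>p. \<gamma> \<otimes> p) \<circ> crd_inv c) has_derivative
     frechet_derivative (crd d \<circ> (\<lambda>p. \<gamma> \<otimes> p) \<circ> crd_inv c) (at (crd c g))) (at (crd c g))"
    using sheet_cdom[OF dW] \<gamma> by (intro has_derivative_left[OF in_group[OF \<gamma>(1)] c(1) sheet_atlas[OF dW] c(2)]) blast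
  moreover have "(crd d \<circ> (\<lambda>p. \<gamma> \<otimes> p)) p = (crd (qchart d W) \<circ> \<pi>) p" if "p \<in> {p \<in> carrier G. \<gamma> \<otimes> p \<in> W}" for p
    using crd_qchart[OF dW, of "\<gamma> \<otimes> p"] proj_translate[OF \<gamma>(1)] that by simp
  ultimately show ?thesis
    using g \<gamma> has_derivative_crd_inv_cong[OF chart[OF c(1)] _ _ c(2)] by blast
qed

lemma transition_qchart:
  assumes cV: "sheet c V" and dW: "sheet d W" and \<gamma>: "\<gamma> \<in> \<Gamma>"
    and y: "y \<in> crd c ` V" "\<gamma> \<otimes> crd_inv c y \<in> W"
  shows "transition (qchart c V) (qchart d W) y = (crd d \<circ> (\<lambda>p. \<gamma> \<otimes> p) \<circ> crd_inv c) y"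
  using crd_inv_qchart[OF cV y(1)] inv_into_proj[OF dW \<gamma> sheet_carrier[OF cV] y(2)]
  by (simp add: transition_def qchart_def)

lemma open_transition_domain:
  assumes cV: "sheet c V" and dW: "sheet d W" and \<gamma>: "\<gamma> \<in> \<Gamma>"
  shows "open {y \<in> crd c ` V. \<gamma> \<otimes> crd_inv c y \<in> W}"
proof -
  have o: "openin (mtop M) (V \<inter> {p \<in> carrier G. \<gamma> \<otimes> p \<in> W})"
    using openin_continuous_map_preimage[OF continuous_left[OF in_group[OF \<gamma>(1)]] sheet_open[OF dW]] sheet_open[OF cV]
    by (intro openin_Int) (simp_all add: points_carrier)
  have "{y \<in> crd c ` V. \<gamma> \<otimes> crd_inv c y \<in> W} = crd c ` (V \<inter> {p \<in> carrier G. \<gamma> \<otimes> p \<in> W})"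
    using sheet_cdom[OF cV] sheet_carrier[OF cV] crd_inv_crd[OF chart[OF sheet_atlas[OF cV]]] by (auto simp: subset_iff)
  then show ?thesis
    using open_crd_image[OF chart[OF sheet_atlas[OF cV]] o] sheet_cdom[OF cV] by auto
qed

sublocale quot: atlas_manifold N
proof
  show "chart_on (mtop N) c'" if "c' \<in> atlas N" for c'
    using that chart_on_qchart by (auto simp: atlas_N)
  show "points N = (\<Union>c\<in>atlas N. cdom c)"
  proof
    show "points N \<subseteq> (\<Union>c\<in>atlas N. cdom c)"
    proof
      fix p assume "p \<in> points N"
      then obtain g where g: "g \<in> carrier G" "p = \<pi> g" by (auto simp: points_N)
      obtain c W where "sheet c W" "g \<in> W" using sheet_exists[OF g(1)] .
      then have "qchart c W \<in> atlas N" "p \<in> cdom (qchart c W)"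
        using g(2) qchart_atlas cdom_qchart by auto
      then show "p \<in> (\<Union>c\<in>atlas N. cdom c)" by blast
    qed
    show "(\<Union>c\<in>atlas N. cdom c) \<subseteq> points N"
      using sheet_carrier by (auto simp: atlas_N points_N cdom_qchart)
  qed
  fix c' d' assume "c' \<in> atlas N" "d' \<in> atlas N"
  then obtain c V d W where cV: "sheet c V" and dW: "sheet d W" and c': "c' = qchart c V" and d': "d' = qchart d W"
    by (auto simp: atlas_N)
  show "smooth_on (crd c' ` (cdom c' \<inter> cdom d')) (transition c' d')"
  proof (rule smooth_on_local)
    fix x assume "x \<in> crd c' ` (cdom c' \<inter> cdom d')"
    then obtain q where q: "q \<in> \<pi> ` V" "q \<in> \<pi> ` W" "x = crd c' q"
      by (auto simp: c' d' cdom_qchart[OF cV] cdom_qchart[OF dW])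
    obtain v w where vw: "v \<in> V" "q = \<pi> v" "w \<in> W" "q = \<pi> w" using q(1,2) by blast
    then have x: "x = crd c v" "\<pi> v = \<pi> w" using q(3) crd_qchart[OF cV] by (simp_all add: c')
    then obtain \<gamma> where \<gamma>: "\<gamma> \<in> \<Gamma>" "w = \<gamma> \<otimes> v"
      using proj_eqE[OF x(2) sheet_carrier[OF cV vw(1)] sheet_carrier[OF dW vw(3)]] by blast
    let ?U = "{y \<in> crd c ` V. \<gamma> \<otimes> crd_inv c y \<in> W}"
    note oU = open_transition_domain[OF cV dW \<gamma>(1)]
    have "crd_inv c x = v"
      using vw x sheet_cdom[OF cV] crd_inv_crd[OF chart[OF sheet_atlas[OF cV]]] by auto
    then have "x \<in> ?U" using vw x \<gamma> by auto
    moreover have "smooth_on ?U (crd d \<circ> (\<lambda>p. \<gamma> \<otimes> p) \<circ> crd_inv c)"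
      by (rule smooth_on_subset[OF smooth_left[OF in_group[OF \<gamma>(1)] sheet_atlas[OF cV] sheet_atlas[OF dW]]])
        (use sheet_cdom[OF cV] sheet_cdom[OF dW] in auto)
    then have "smooth_on ?U (transition c' d')"
      by (rule smooth_on_cong[OF oU, rotated]) (simp add: transition_qchart[OF cV dW \<gamma>(1)] c' d')
    ultimately show "\<exists>U. open U \<and> x \<in> U \<and> smooth_on U (transition c' d')" using oU by blast
  qed
qed

text \<open>An arbitrary choice without any continuity; \<open>frame_qchart\<close> shows that the
  frame does not depend on it.\<close>

definition lift :: "'g set \<Rightarrow> 'g" where
  "lift p = (SOME g. g \<in> carrier G \<and> \<pi> g = p)"

definition frame :: "'e \<Rightarrow> ('g set, 'e) vfield" where
  "frame v p = (if p \<in> points N then tangent_map M N \<pi> (lift p) (lvec v (lift p)) else (\<lambda>_. 0))"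

lemma lift: "p \<in> points N \<Longrightarrow> lift p \<in> carrier G" "p \<in> points N \<Longrightarrow> \<pi> (lift p) = p"
  unfolding lift_def points_N using someI_ex[of "\<lambda>g. g \<in> carrier G \<and> \<pi> g = p"] by auto

lemma frame_outside_chart: "\<not> (d \<in> atlas N \<and> p \<in> cdom d) \<Longrightarrow> frame v p d = 0"
  using lift(2)[of p] by (auto simp: frame_def tangent_map_def)

text \<open>The chosen lift and \<open>w\<close> differ by the translation by some
  \<open>\<gamma>\<close>, which preserves left-invariant fields and does not change the
  projection.\<close>

lemma frame_qchart:
  assumes dW: "sheet d W" and w: "w \<in> W"
  shows "frame v (\<pi> w) (qchart d W) = lfield v w d"
proof -
  define g where "g = lift (\<pi> w)"
  have pN: "\<pi> w \<in> points N" using sheet_carrier[OF dW w] by (auto simp: points_N)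
  have g: "g \<in> carrier G" "\<pi> g = \<pi> w" using lift[OF pN] by (simp_all add: g_def)
  obtain \<gamma> where \<gamma>: "\<gamma> \<in> \<Gamma>" "w = \<gamma> \<otimes> g" using proj_eqE[OF g(2,1) sheet_carrier[OF dW w]] .
  define c where "c = chart_at M g"
  have c: "c \<in> atlas M" "g \<in> cdom c" using chart_at[of g] g points_carrier by (auto simp: c_def)
  have "frame v (\<pi> w) (qchart d W) = frechet_derivative (crd (qchart d W) \<circ> \<pi> \<circ> crd_inv c) (at (crd c g)) (lfield v g c)"
    using pN w dW g(2) unfolding frame_def tangent_map_def g_def[symmetric] c_def[symmetric] Let_def
    by (simp add: qchart_atlas[OF dW] cdom_qchart[OF dW] lvec_component[OF c])
  also have "\<dots> = lfield v (\<gamma> \<otimes> g) d"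
    using frechet_derivative_at[OF has_derivative_qchart[OF dW c \<gamma>(1)]] \<gamma> w sheet_cdom[OF dW]
      lfield_translate[OF in_group[OF \<gamma>(1)] c(1) sheet_atlas[OF dW] c(2), of v] by auto
  finally show ?thesis by (simp add: \<gamma>(2))
qed

lemma atlas_N_cases:
  assumes "c' \<in> atlas N" "p \<in> cdom c'"
  obtains c W w where "sheet c W" "c' = qchart c W" "w \<in> W" "p = \<pi> w"
  using assms by (auto simp: atlas_N cdom_qchart)

text \<open>Since transition maps are locally translations by elements of \<open>\<Gamma>\<close>,
  \<open>lfield_translate\<close> is the required transformation law.\<close>

lemma frame_tangent_space: "frame v p \<in> tangent_space N p"
proof -
  have "frame v p d' = frechet_derivative (transition c' d') (at (crd c' p)) (frame v p c')"
    if c'A: "c' \<in> atlas N" "p \<in> cdom c'" and d'A: "d' \<in> atlas N" "p \<in> cdom d'" for c' d'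
  proof -
    obtain c V a where cV: "sheet c V" and c': "c' = qchart c V" and a: "a \<in> V" "p = \<pi> a"
      using atlas_N_cases[OF c'A] .
    obtain d W b where dW: "sheet d W" and d': "d' = qchart d W" and b: "b \<in> W" "p = \<pi> b"
      using atlas_N_cases[OF d'A] .
    have ac: "a \<in> cdom c" "a \<in> carrier G" using a sheet_cdom[OF cV] sheet_carrier[OF cV] by auto
    obtain \<gamma> where \<gamma>: "\<gamma> \<in> \<Gamma>" "b = \<gamma> \<otimes> a"
      using proj_eqE[of a b] a b ac sheet_carrier[OF dW b(1)] by auto
    have xa: "crd_inv c (crd c a) = a" by (rule crd_inv_crd[OF chart[OF sheet_atlas[OF cV]] ac(1)])
    have "((crd d \<circ> (\<lambda>p. \<gamma> \<otimes> p) \<circ> crd_inv c) has_derivative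
      frechet_derivative (crd d \<circ> (\<lambda>p. \<gamma> \<otimes> p) \<circ> crd_inv c) (at (crd c a))) (at (crd c a))"
      using \<gamma> b sheet_cdom[OF dW]
      by (intro has_derivative_left[OF in_group[OF \<gamma>(1)] sheet_atlas[OF cV] sheet_atlas[OF dW] ac(1)]) auto
    then have "(transition c' d' has_derivative
      frechet_derivative (crd d \<circ> (\<lambda>p. \<gamma> \<otimes> p) \<circ> crd_inv c) (at (crd c a))) (at (crd c a))"
      by (rule has_derivative_transform_within_open[OF _ open_transition_domain[OF cV dW \<gamma>(1)]])
        (use a b \<gamma> xa in \<open>auto simp: c' d' transition_qchart[OF cV dW \<gamma>(1)]\<close>)
    from frechet_derivative_at[OF this] show ?thesis
      using lfield_translate[OF in_group[OF \<gamma>(1)] sheet_atlas[OF cV] sheet_atlas[OF dW] ac(1), of v]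
        \<gamma> a b sheet_cdom[OF dW] frame_qchart[OF cV a(1), of v] frame_qchart[OF dW b(1), of v] crd_qchart[OF cV a(1)]
      by (auto simp: c' d')
  qed
  then show ?thesis
    unfolding tangent_space_def using frame_outside_chart by blast
qed

lemma frame_chart:
  assumes cW: "sheet c W" and x: "x \<in> crd c ` W"
  shows "frame v (crd_inv (qchart c W) x) (qchart c W) = lfield v (crd_inv c x) c"
  using crd_inv_qchart[OF cW x] frame_qchart[OF cW] by simp

lemma smooth_lfield_sheet:
  "sheet c W \<Longrightarrow> smooth_on (crd c ` W) (\<lambda>x. lfield v (crd_inv c x) c)"
  using smooth_on_subset[OF smooth_lfield[OF sheet_atlas] image_mono[OF sheet_cdom]] by blast

lemma open_sheet_image: "sheet c W \<Longrightarrow> open (crd c ` W)"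
  using open_crd_image[OF chart[OF sheet_atlas] sheet_open sheet_cdom] by blast

text \<open>The frame and the left-invariant fields have the same coordinate expressions in
  \<open>qchart c W\<close> and \<open>c\<close>, and the bracket is computed from these
  alone.\<close>

lemma frame_bracket:
  assumes cW: "sheet c W" and w: "w \<in> W"
  shows "lie_bracket N (frame u) (frame v) (\<pi> w) (qchart c W) = lfield (lie_br u v) w c"
proof -
  have D: "frechet_derivative (\<lambda>x. frame v (crd_inv (qchart c W) x) (qchart c W)) (at (crd c w))
      = frechet_derivative (\<lambda>x. lfield v (crd_inv c x) c) (at (crd c w))" for v
    by (rule frechet_derivative_transform_within_open[OF _ open_sheet_image[OF cW], symmetric])
      (use w frame_chart[OF cW] smooth_on_differentiable[OF smooth_lfield_sheet[OF cW]] in auto)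
  have "qchart c W \<in> atlas N" "\<pi> w \<in> cdom (qchart c W)"
    using w qchart_atlas[OF cW] by (auto simp: cdom_qchart[OF cW])
  then show ?thesis
    using lfield_bracket[OF sheet_atlas[OF cW] subsetD[OF sheet_cdom[OF cW] w], of v u]
    by (simp add: lie_bracket_def crd_qchart[OF cW w] D frame_qchart[OF cW w])
qed

sublocale quot: frame_manifold N frame lie_br
proof (rule frame_manifold.intro[OF quot.atlas_manifold_axioms], rule frame_manifold_axioms.intro)
  show "frame v \<in> vfields N" for v
  proof (rule quot.vfieldsI[OF frame_tangent_space])
    fix c' assume "c' \<in> atlas N"
    then obtain c W where cW: "sheet c W" and c': "c' = qchart c W" by (auto simp: atlas_N)
    have "crd c' ` cdom c' = crd c ` W"
      by (simp add: c' cdom_qchart[OF cW] image_qchart[OF cW])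
    then show "smooth_on (crd c' ` cdom c') (\<lambda>x. frame v (crd_inv c' x) c')"
      using smooth_on_cong[OF open_sheet_image[OF cW] frame_chart[OF cW, symmetric] smooth_lfield_sheet[OF cW]]
      by (simp add: c')
  qed
  show "linear (\<lambda>v. frame v p c')" for p c'
  proof (cases "c' \<in> atlas N \<and> p \<in> cdom c'")
    case True
    then obtain c W w where cW: "sheet c W" "c' = qchart c W" "w \<in> W" "p = \<pi> w" using atlas_N_cases by metis
    then show ?thesis
      using linear_lfield[OF sheet_atlas[OF cW(1)] subsetD[OF sheet_cdom[OF cW(1)] cW(3)]]
      by (simp add: frame_qchart[OF cW(1)])
  qed (simp add: frame_outside_chart linear_zero)
  show "inj (\<lambda>v. frame v p c')" if c': "c' \<in> atlas N" "p \<in> cdom c'" for p c'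
  proof -
    obtain c W w where cW: "sheet c W" "c' = qchart c W" "w \<in> W" "p = \<pi> w" using atlas_N_cases[OF c'] .
    then show ?thesis
      using inj_lfield[OF sheet_atlas[OF cW(1)] subsetD[OF sheet_cdom[OF cW(1)] cW(3)]]
      by (simp add: frame_qchart[OF cW(1)])
  qed
  show "lie_bracket N (frame u) (frame v) = frame (lie_br u v)" for u v
  proof (intro ext)
    fix p c'
    show "lie_bracket N (frame u) (frame v) p c' = frame (lie_br u v) p c'"
    proof (cases "c' \<in> atlas N \<and> p \<in> cdom c'")
      case True
      then obtain c W w where cW: "sheet c W" "c' = qchart c W" "w \<in> W" "p = \<pi> w" using atlas_N_cases by metis
      then show ?thesis by (simp add: frame_bracket frame_qchart[OF cW(1)])
    next
      case False
      then show ?thesis by (auto simp: lie_bracket_def frame_outside_chart)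
    qed
  qed
qed

text \<open>\<open>S'\<close> is accessible only through the holomorphic projection. At
  \<open>lift p\<close>, the point from which the frame is projected, this leads back to the
  left-invariant structure \<open>S\<close>.\<close>

lemma endo_frame:
  assumes S: "endo_field M S" "left_invariant G M S" and hol: "holomorphic_map M S N S' \<pi>" and p: "p \<in> points N"
  shows "S' p (frame v p) = frame (endo_alg S v) p"
proof -
  note g = lift[OF p]
  have "tangent_map M N \<pi> (lift p) (S (lift p) (lvec v (lift p)))
      = S' (\<pi> (lift p)) (tangent_map M N \<pi> (lift p) (lvec v (lift p)))"
    using hol lvec_tangent_space[OF g(1)] g(1) by (simp add: holomorphic_map_def points_carrier)
  then show ?thesis
    using p g endo_lvec[OF S g(1)] by (simp add: frame_def)
qed

end

theorem corollary3p4: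
  fixes G :: "'g monoid"
    and M :: "('g, 'e::euclidean_space) manifold"
    and \<Gamma> :: "'g set"
    and I J K :: "('g, 'e) endo"
    and N :: "('g set, 'e) manifold"
    and I' J' K' :: "('g set, 'e) endo"
    and D :: "('g set, 'e) conn"
  assumes "lie_group G M"
    and "connected_space (mtop M)"
    and "simply_connected_space (mtop M)"
    and "nilpotent_group G"
    and "hypercomplex M I J K"
    and "left_invariant G M I" and "left_invariant G M J" and "left_invariant G M K"
    and "discrete_subgroup \<Gamma> G (mtop M)"
    and "N = quotient_manifold G M \<Gamma>"
    and "compact_space (mtop N)"
    and "holomorphic_map M I N I' (coset_proj G \<Gamma>)"
    and "holomorphic_map M J N J' (coset_proj G \<Gamma>)"
    and "holomorphic_map M K N K' (coset_proj G \<Gamma>)"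
    and "obata_connection N I' J' K' D"
  shows "\<forall>X\<in>vfields N. \<forall>Y\<in>vfields N. \<forall>p\<in>points N. ricci N D X Y p = 0"
proof -
  interpret group G using assms(1) by (simp add: lie_group_def)
  have sm: "smooth_manifold M" using assms(1) by (simp add: lie_group_def)
  interpret atlas_manifold M
    by unfold_locales (use sm in \<open>simp_all add: smooth_manifold_def\<close>)
  interpret lie_group_quotient G M \<Gamma>
    by unfold_locales (rule assms(1), rule assms(9))
  obtain n where n: "lower_central G n = {\<one>\<^bsub>G\<^esub>}"
    using assms(4) by (auto simp: nilpotent_group_def)
  have acs: "almost_complex M I" "almost_complex M J"
    using assms(5) by (simp_all add: hypercomplex_def integrable_acs_def)
  then have endo: "endo_field M I" "endo_field M J" by (simp_all add: almost_complex_def)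
  have D: "affine_connection N D" "torsion_free N D" "parallel N D I'" "parallel N D J'"
    using assms(15) by (simp_all add: obata_connection_def)
  \<comment> \<open>The algebra comes from \<open>G\<close>, the connection and the complex
    structures from \<open>N\<close>; the nilpotency bound \<open>n\<close> of the group becomes the
    length of the flag.\<close>
  interpret hc: hypercomplex_frame N frame lie_br D I' J' "endo_alg I" "endo_alg J" flag n
    unfolding assms(10)
  proof (intro hypercomplex_frame.intro torsion_free_connection.intro torsion_free_connection_axioms.intro
      hypercomplex_frame_axioms.intro)
    show "frame_manifold (quotient_manifold G M \<Gamma>) frame lie_br" "atlas_manifold (quotient_manifold G M \<Gamma>)"
      by unfold_locales
    show "subspace (flag k)" for k unfolding flag_def by (rule subspace_span)
  qed (use D in \<open>simp_all add: assms(10) endo_frame[OF endo(1) assms(6) assms(12)[unfolded assms(10)]]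
      endo_frame[OF endo(2) assms(7) assms(13)[unfolded assms(10)]] linear_endo_alg endo
      endo_alg_square acs endo_alg_anticommute[OF assms(5)] linear_lie_br flag_0 flag_trivial[OF n] flag_Suc_subset
      lie_br_flag\<close>)
  show ?thesis using hc.ricci_zero by blast
qed

end
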